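(* Let $L\subset\mathbb{P}^n$ be a linear space of dimension $d<n$ not contained in a coordinate hyperplane, let $A\in\mathbb{C}^{(d+1)\times(n+1)}$ be a matrix with projectivized row span $L$, and let $B\in\mathbb{C}^{(n+1)\times(n-d)}$ be a matrix whose columns form a basis of $\ker A$. For variables $t=(t_0,\dots,t_d)^\top$ and $u=(u_0,\dots,u_{n-d-1})^\top$ consider the $(n+1)\times(n+1)$ matrix $$\mathcal{J}_L(t,u)=\begin{pmatrix}{\rm diag}(B\,u)\cdot A^\top & {\rm diag}(A^\top t)\cdot B\end{pmatrix}.$$ If $M(L)$ has no coloops, then $L^{-1}$ is dual defective if and only if all $n\times n$ minors of $\mathcal{J}_L(t,u)$ are identically zero. Equivalently, $\nabla(L^{-1})$ is a hypersurface if and only if $\mathcal{J}_L(t^*,u^* )$ has rank $n$ over $\mathbb{C}$ for some $(t^*,u^* )\in\mathbb{P}^d\times\mathbb{P}^{n-d-1}$.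
   Context: $T\subset\mathbb{P}^n$ is the set of points with all homogeneous coordinates nonzero, and $L^{-1}=\overline{\{(x_0^{-1}:\cdots:x_n^{-1}):x\in L\cap T\}}$. $M(L)$ is the matroid on $\{0,\dots,n\}$ of linear independence of the columns of $A$. $\nabla(L^{-1})\subset(\mathbb{P}^n)^\vee$ is the projective dual variety of $L^{-1}$. $L^{-1}$ is called dual defective if $\nabla(L^{-1})$ has codimension greater than one. For a vector $v$, ${\rm diag}(v)$ is the diagonal matrix with diagonal $v$. *)

theory Defs
  imports
    "HOL-Analysis.Abstract_Topology"
    "HOL-Library.Poly_Mapping"
    "HOL-Library.Extended_Nat"
    "Jordan_Normal_Form.Matrix_Kernel"
    "Jordan_Normal_Form.DL_Rank"
    "Jordan_Normal_Form.DL_Submatrix"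
begin

section \<open>Linear algebra and the column matroid\<close>

abbreviation Cvec :: "nat \<Rightarrow> (complex, complex vec) module"
  where "Cvec m \<equiv> module_vec TYPE(complex) m"

definition lin_dim :: "nat \<Rightarrow> complex vec set \<Rightarrow> nat"
  where "lin_dim m W = vectorspace.dim class_ring ((Cvec m)\<lparr>carrier := W\<rparr>)"

definition columns_form_kernel_basis :: "complex mat \<Rightarrow> complex mat \<Rightarrow> bool"
  where "columns_form_kernel_basis A B \<longleftrightarrow> distinct (cols B) \<and>
    vectorspace.basis class_ring ((Cvec (dim_col A))\<lparr>carrier := mat_kernel A\<rparr>) (set (cols B))"

text \<open>A matroid is given by its family of independent sets. The ground set consists of
  column indices, so \<open>inj_on\<close> is what makes two equal columns a dependent pair.\<close>

definition column_matroid :: "complex mat \<Rightarrow> nat set set"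
  where "column_matroid A = {I. I \<subseteq> {..<dim_col A} \<and> inj_on (col A) I \<and>
    \<not> module.lin_dep class_ring (Cvec (dim_row A)) (col A ` I)}"

definition matroid_bases :: "nat set set \<Rightarrow> nat set set"
  where "matroid_bases M = {I \<in> M. \<forall>J\<in>M. I \<subseteq> J \<longrightarrow> J = I}"

definition matroid_coloop :: "nat set \<Rightarrow> nat set set \<Rightarrow> nat \<Rightarrow> bool"
  where "matroid_coloop E M e \<longleftrightarrow> e \<in> E \<and> (\<forall>I\<in>matroid_bases M. e \<in> I)"

section \<open>Polynomials\<close>

text \<open>Polynomials in the variables $x_0, x_1, \ldots$: finitely supported families of
  coefficients indexed by exponent vectors, multiplied by convolution.\<close>

type_synonym mpoly = "(nat \<Rightarrow>\<^sub>0 nat) \<Rightarrow>\<^sub>0 complex"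

definition mp_const :: "complex \<Rightarrow> mpoly"
  where "mp_const c = Poly_Mapping.single 0 c"

definition mp_var :: "nat \<Rightarrow> mpoly"
  where "mp_var i = Poly_Mapping.single (Poly_Mapping.single i 1) 1"

definition mp_eval :: "mpoly \<Rightarrow> complex vec \<Rightarrow> complex"
  where "mp_eval f v = (\<Sum>m\<in>Poly_Mapping.keys f. Poly_Mapping.lookup f m *
    (\<Prod>i\<in>Poly_Mapping.keys m. (v $ i) ^ Poly_Mapping.lookup m i))"

text \<open>If \<open>x\<^sub>i\<close> does not occur in the monomial \<open>m\<close>, the truncated difference below is \<open>m\<close>,
  but then the coefficient is zero.\<close>

definition mp_partial :: "nat \<Rightarrow> mpoly \<Rightarrow> mpoly"
  where "mp_partial i f = (\<Sum>m\<in>Poly_Mapping.keys f.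
    Poly_Mapping.single (m - Poly_Mapping.single i 1)
      (of_nat (Poly_Mapping.lookup m i) * Poly_Mapping.lookup f m))"

definition homogeneous :: "nat \<Rightarrow> nat \<Rightarrow> mpoly \<Rightarrow> bool"
  where "homogeneous n k f \<longleftrightarrow> (\<forall>m\<in>Poly_Mapping.keys f.
    Poly_Mapping.keys m \<subseteq> {..n} \<and> (\<Sum>i\<in>Poly_Mapping.keys m. Poly_Mapping.lookup m i) = k)"

section \<open>Projective space and its Zariski topology\<close>

text \<open>A point of $\mathbb{P}^n$ is the set of all its homogeneous coordinate vectors.\<close>

definition proj_pt :: "complex vec \<Rightarrow> complex vec set"
  where "proj_pt v = {c \<cdot>\<^sub>v v | c. c \<noteq> 0}"

definition projectivization :: "nat \<Rightarrow> complex vec set \<Rightarrow> complex vec set set"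
  where "projectivization n W = proj_pt ` (W - {0\<^sub>v (n+1)})"

definition proj_space :: "nat \<Rightarrow> complex vec set set"
  where "proj_space n = projectivization n (carrier_vec (n+1))"

definition distinguished_open :: "nat \<Rightarrow> mpoly \<Rightarrow> complex vec set set"
  where "distinguished_open n f = {p \<in> proj_space n. \<exists>v\<in>p. mp_eval f v \<noteq> 0}"

definition zariski :: "nat \<Rightarrow> complex vec set topology"
  where "zariski n =
    topology_generated_by {distinguished_open n f | f. \<exists>k. homogeneous n k f}"

definition irreducible_closed :: "nat \<Rightarrow> complex vec set set \<Rightarrow> bool"
  where "irreducible_closed n Z \<longleftrightarrow> closedin (zariski n) Z \<and> Z \<noteq> {} \<and>
    (\<forall>C1 C2. closedin (zariski n) C1 \<longrightarrow> closedin (zariski n) C2 \<longrightarrow> Z \<subseteq> C1 \<union> C2 \<longrightarrow>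
      Z \<subseteq> C1 \<or> Z \<subseteq> C2)"

text \<open>The usual codimension in a topological space: for irreducible closed \<open>Z\<close> the supremum
  of the lengths of chains of irreducible closed sets starting at \<open>Z\<close>, in general the infimum
  over the irreducible closed subsets (so the empty set has codimension \<open>\<infinity>\<close>).\<close>

definition codim_irreducible :: "nat \<Rightarrow> complex vec set set \<Rightarrow> enat"
  where "codim_irreducible n Z = Sup {enat k | k. \<exists>c.
    c 0 = Z \<and> (\<forall>i\<le>k. irreducible_closed n (c i)) \<and> (\<forall>i<k. c i \<subset> c (Suc i))}"

definition codim :: "nat \<Rightarrow> complex vec set set \<Rightarrow> enat"
  where "codim n Y = (INF Z\<in>{Z. irreducible_closed n Z \<and> Z \<subseteq> Y}. codim_irreducible n Z)"

definition irreducible_component :: "nat \<Rightarrow> complex vec set set \<Rightarrow> complex vec set set \<Rightarrow> bool"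
  where "irreducible_component n Y Z \<longleftrightarrow> irreducible_closed n Z \<and> Z \<subseteq> Y \<and>
    (\<forall>Z'. irreducible_closed n Z' \<longrightarrow> Z \<subseteq> Z' \<longrightarrow> Z' \<subseteq> Y \<longrightarrow> Z' = Z)"

text \<open>Hypersurface: nonempty closed set of pure codimension one.\<close>

definition hypersurface :: "nat \<Rightarrow> complex vec set set \<Rightarrow> bool"
  where "hypersurface n Y \<longleftrightarrow> closedin (zariski n) Y \<and> Y \<noteq> {} \<and>
    (\<forall>Z. irreducible_component n Y Z \<longrightarrow> codim n Z = 1)"

section \<open>Tangent spaces and projective duality\<close>

definition vanishing_forms :: "nat \<Rightarrow> complex vec set set \<Rightarrow> mpoly set"
  where "vanishing_forms n X =
    {f. (\<exists>k. homogeneous n k f) \<and> (\<forall>p\<in>X. \<forall>v\<in>p. mp_eval f v = 0)}"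

text \<open>The linear subspace of $\mathbb{C}^{n+1}$ whose projectivization is the embedded tangent
  space of \<open>X\<close> at \<open>p\<close>.\<close>

definition tangent_cone_space :: "nat \<Rightarrow> complex vec set set \<Rightarrow> complex vec set \<Rightarrow> complex vec set"
  where "tangent_cone_space n X p = {y \<in> carrier_vec (n+1). \<forall>f\<in>vanishing_forms n X. \<forall>v\<in>p.
    (\<Sum>i\<le>n. mp_eval (mp_partial i f) v * y $ i) = 0}"

text \<open>Jacobian criterion for an irreducible variety \<open>X\<close>: a point is smooth iff its embedded
  tangent space has the codimension of \<open>X\<close>. The projective dual is likewise meant for
  irreducible \<open>X\<close>.\<close>

definition smooth_points :: "nat \<Rightarrow> complex vec set set \<Rightarrow> complex vec set set"
  where "smooth_points n X =
    {p \<in> X. enat (lin_dim (n+1) (tangent_cone_space n X p)) + codim n X = enat (n+1)}"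

text \<open>The dual projective space is identified with $\mathbb{P}^n$: the point \<open>(h\<^sub>0 : \<dots> : h\<^sub>n)\<close>
  stands for the hyperplane $\sum_i h_i x_i = 0$.\<close>

definition dual_variety :: "nat \<Rightarrow> complex vec set set \<Rightarrow> complex vec set set"
  where "dual_variety n X = zariski n closure_of
    {q \<in> proj_space n. \<exists>p\<in>smooth_points n X.
      \<forall>h\<in>q. \<forall>y\<in>tangent_cone_space n X p. (\<Sum>i\<le>n. h $ i * y $ i) = 0}"

definition dual_defective :: "nat \<Rightarrow> complex vec set set \<Rightarrow> bool"
  where "dual_defective n X \<longleftrightarrow> codim n (dual_variety n X) > 1"

section \<open>Reciprocal linear spaces\<close>

definition linear_space :: "nat \<Rightarrow> nat \<Rightarrow> complex vec set set \<Rightarrow> bool"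
  where "linear_space n d L \<longleftrightarrow> (\<exists>W. VectorSpace.subspace class_ring W (Cvec (n+1)) \<and>
    lin_dim (n+1) W = d + 1 \<and> L = projectivization n W)"

definition coordinate_hyperplane :: "nat \<Rightarrow> nat \<Rightarrow> complex vec set set"
  where "coordinate_hyperplane n i = {p \<in> proj_space n. \<forall>v\<in>p. v $ i = 0}"

definition torus :: "nat \<Rightarrow> complex vec set set"
  where "torus n = {p \<in> proj_space n. \<forall>v\<in>p. \<forall>i\<le>n. v $ i \<noteq> 0}"

definition reciprocal :: "nat \<Rightarrow> complex vec set set \<Rightarrow> complex vec set set"
  where "reciprocal n L = zariski n closure_of
    {proj_pt (vec (n+1) (\<lambda>i. inverse (v $ i))) | v p. p \<in> L \<inter> torus n \<and> v \<in> p}"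

definition diag_of_vec :: "'a::zero vec \<Rightarrow> 'a mat"
  where "diag_of_vec v = mat_diag (dim_vec v) (\<lambda>i. v $ i)"

text \<open>Polymorphic in the ring of entries, so that it covers both the matrix over the polynomial
  ring and its specialisations over the complex numbers.\<close>

definition J_mat :: "'a::comm_ring_1 mat \<Rightarrow> 'a mat \<Rightarrow> 'a vec \<Rightarrow> 'a vec \<Rightarrow> 'a mat"
  where "J_mat A B t u = mat_of_cols (dim_row B)
    (cols (diag_of_vec (B *\<^sub>v u) * A\<^sup>T) @ cols (diag_of_vec (A\<^sup>T *\<^sub>v t) * B))"

text \<open>All variables live in one polynomial ring: \<open>t\<^sub>i\<close> is \<open>x\<^sub>i\<close> for \<open>i \<le> d\<close> and \<open>u\<^sub>j\<close> is
  \<open>x\<^sub>d\<^sub>+\<^sub>1\<^sub>+\<^sub>j\<close>, where \<open>d + 1\<close> is the number of rows of \<open>A\<close>.\<close>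

definition J_generic :: "complex mat \<Rightarrow> complex mat \<Rightarrow> mpoly mat"
  where "J_generic A B = J_mat (map_mat mp_const A) (map_mat mp_const B)
    (vec (dim_row A) mp_var) (vec (dim_col B) (\<lambda>j. mp_var (dim_row A + j)))"

end

theory Submission
  imports Defs "HOL-Computational_Algebra.Polynomial" "Jordan_Normal_Form.DL_Rank_Submatrix"
begin

text \<open>Put $x = A^T t$ and read products and powers of vectors coordinatewise. Over the torus, $L^{-1}$ is
  parametrised by $x^{-1}$ and its tangent space at $x^{-1}$ is $x^{-2} L$. Hence the conormal vectors are
  $x^2 Bu$, and the dual variety is the closure of the image of $\psi(t, u) = x^2 Bu$; a conormal vector at
  a point outside the torus is the value of a gradient $\nabla f$, $f$ in the ideal of $L^{-1}$, and
  $\nabla f$ is conormal at the points of the torus. Moreover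
  $d\psi_{(t,u)}(t', u') = x \cdot J_L(t, u)(2t', u')$, so the generic rank of $J_L$ is that of $d\psi$.

  Dimensions are compared through Hilbert functions: multiplication by a form vanishing on the smaller set
  shows that their growth exponent increases by at least one along a strict inclusion of irreducible
  closed sets. So chains in $\mathbb{P}^n$ have length at most $n$, and rank $n$ at one point makes the
  dual variety a hypersurface. If the rank is less than $n$ everywhere, then the cone over the dual
  variety with vertex outside it is still a proper subvariety, by the Jacobian criterion for algebraic
  independence, and so the dual variety has codimension at least two.\<close>

section \<open>Forms as functions\<close>

text \<open>Codimension is defined by chains of irreducible closed sets. Lower bounds are therefore
  exhibited, but an upper bound has to control every chain, which is what Hilbert functions are for.
  Already the smooth points of L^{-1} depend on this, since they refer to its codimension; it is
  read off from a full flag of reciprocal linear spaces between a point and the whole space.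

  Genericity is handled on affine lines: a polynomial in one variable that is not zero has finitely
  many roots, so two generic conditions hold together somewhere on the line that joins a witness of
  each.

  The map psi has degree 2 in t and degree 1 in u. Hence (t, -2u) is always in the kernel of its
  differential and (t, -u) in that of J_L: rank n is the largest possible, and the dual variety is
  never the whole space. If all minors of order n vanish, there is a second kernel direction, so
  some kernel direction lies in any chosen hyperplane; this is why the term z_0^3 q can be added to
  psi without making its differential injective.\<close>

abbreviation keys where "keys \<equiv> Poly_Mapping.keys"
abbreviation lookup where "lookup \<equiv> Poly_Mapping.lookup"
abbreviation single where "single \<equiv> Poly_Mapping.single"

definition mono_eval :: "(nat \<Rightarrow>\<^sub>0 nat) \<Rightarrow> complex vec \<Rightarrow> complex"
  where "mono_eval m v = (\<Prod>i\<in>keys m. (v $ i) ^ lookup m i)"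

definition mdeg :: "(nat \<Rightarrow>\<^sub>0 nat) \<Rightarrow> nat"
  where "mdeg m = (\<Sum>i\<in>keys m. lookup m i)"

lemma mono_eval_superset:
  assumes "finite K" "keys m \<subseteq> K"
  shows "mono_eval m v = (\<Prod>i\<in>K. (v $ i) ^ lookup m i)"
  unfolding mono_eval_def
  by (rule prod.mono_neutral_left) (use assms in \<open>auto simp: in_keys_iff\<close>)

lemma mdeg_superset:
  assumes "finite K" "keys m \<subseteq> K"
  shows "mdeg m = (\<Sum>i\<in>K. lookup m i)"
  unfolding mdeg_def
  by (rule sum.mono_neutral_left) (use assms in \<open>auto simp: in_keys_iff\<close>)

lemma keys_add_nat: "keys (m + m') = keys m \<union> keys (m' :: nat \<Rightarrow>\<^sub>0 nat)"
  by (auto simp: in_keys_iff lookup_add)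

lemma mono_eval_add: "mono_eval (m + m') v = mono_eval m v * mono_eval m' v"
proof -
  let ?K = "keys m \<union> keys m'"
  show ?thesis
    by (simp add: mono_eval_superset[of ?K] keys_add_nat lookup_add power_add prod.distrib)
qed

lemma mdeg_add: "mdeg (m + m') = mdeg m + mdeg m'"
proof -
  let ?K = "keys m \<union> keys m'"
  show ?thesis
    by (simp add: mdeg_superset[of ?K] keys_add_nat lookup_add sum.distrib)
qed

lemma mono_eval_0 [simp]: "mono_eval 0 v = 1" by (simp add: mono_eval_def)
lemma mdeg_0 [simp]: "mdeg 0 = 0" by (simp add: mdeg_def)
lemma mono_eval_single [simp]: "mono_eval (single i k) v = (v $ i) ^ k"
  by (cases "k = 0") (auto simp: mono_eval_def)
lemma mdeg_single [simp]: "mdeg (single i k) = k"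
  by (cases "k = 0") (auto simp: mdeg_def)

lemma mp_eval_mon: "mp_eval f v = (\<Sum>m\<in>keys f. lookup f m * mono_eval m v)"
  by (simp add: mp_eval_def mono_eval_def)

lemma mp_eval_superset:
  assumes "finite K" "keys f \<subseteq> K"
  shows "mp_eval f v = (\<Sum>m\<in>K. lookup f m * mono_eval m v)"
  unfolding mp_eval_mon
  by (rule sum.mono_neutral_left) (use assms in \<open>auto simp: in_keys_iff\<close>)

lemma mp_eval_0 [simp]: "mp_eval 0 v = 0" by (simp add: mp_eval_def)

lemma mp_eval_single [simp]: "mp_eval (single m c) v = c * mono_eval m v"
  by (cases "c = 0") (auto simp: mp_eval_mon)

lemma mp_eval_add [simp]: "mp_eval (f + g) v = mp_eval f v + mp_eval g v"
proof -
  let ?K = "keys f \<union> keys g"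
  have "keys (f + g) \<subseteq> ?K" by (rule Poly_Mapping.keys_add)
  then show ?thesis
    by (simp add: mp_eval_superset[of ?K] lookup_add algebra_simps sum.distrib)
qed

lemma mp_eval_sum [simp]: "mp_eval (\<Sum>i\<in>I. f i) v = (\<Sum>i\<in>I. mp_eval (f i) v)"
  by (induct I rule: infinite_finite_induct) auto

lemma poly_mapping_expand:
  "f = (\<Sum>m\<in>keys f. single m (lookup f m))"
proof (rule poly_mapping_eqI)
  fix k
  show "lookup f k = lookup (\<Sum>m\<in>keys f. single m (lookup f m)) k"
    by (simp add: lookup_sum lookup_single when_def sum.delta in_keys_iff)
qed

lemma mp_eval_mult [simp]: "mp_eval (f * g) v = mp_eval f v * mp_eval g v"
proof -
  have "f * g = (\<Sum>m\<in>keys f. \<Sum>k\<in>keys g.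
      single (m + k) (lookup f m * lookup g k))"
    by (subst poly_mapping_expand[of f], subst poly_mapping_expand[of g])
       (simp add: sum_product mult_single)
  then have "mp_eval (f * g) v = (\<Sum>m\<in>keys f. \<Sum>k\<in>keys g.
      (lookup f m * mono_eval m v) * (lookup g k * mono_eval k v))"
    by (simp add: mono_eval_add mult_ac)
  then show ?thesis by (simp add: mp_eval_mon sum_product)
qed

lemma mp_eval_1 [simp]: "mp_eval 1 v = 1"
  using mp_eval_single[of 0 1 v] by simp

lemma mp_eval_const [simp]: "mp_eval (mp_const c) v = c"
  by (simp add: mp_const_def)

lemma mp_eval_var [simp]: "mp_eval (mp_var i) v = v $ i"
  by (simp add: mp_var_def)

lemma homogeneous_iff: "homogeneous n k f \<longleftrightarrow>
    (\<forall>m\<in>keys f. keys m \<subseteq> {..n} \<and> mdeg m = k)"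
  by (simp add: homogeneous_def mdeg_def)

lemma homogeneous_0: "homogeneous n k 0"
  by (simp add: homogeneous_iff)

lemma homogeneous_add: "homogeneous n k f \<Longrightarrow> homogeneous n k g \<Longrightarrow> homogeneous n k (f + g)"
  using Poly_Mapping.keys_add[of f g] by (fastforce simp: homogeneous_iff)

lemma homogeneous_sum: "(\<And>i. i \<in> I \<Longrightarrow> homogeneous n k (f i)) \<Longrightarrow> homogeneous n k (\<Sum>i\<in>I. f i)"
  by (induct I rule: infinite_finite_induct) (auto simp: homogeneous_0 homogeneous_add)

lemma homogeneous_mult:
  assumes "homogeneous n k f" "homogeneous n l g" shows "homogeneous n (k + l) (f * g)"
  unfolding homogeneous_iff
proof
  fix m assume "m \<in> keys (f * g)"
  then obtain a b where "m = a + b" "a \<in> keys f" "b \<in> keys g"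
    using Poly_Mapping.keys_mult[of f g] by auto
  then show "keys m \<subseteq> {..n} \<and> mdeg m = k + l"
    using assms by (auto simp: homogeneous_iff keys_add_nat mdeg_add)
qed

lemma homogeneous_single:
  "keys m \<subseteq> {..n} \<Longrightarrow> mdeg m = k \<Longrightarrow> homogeneous n k (single m c)"
  by (simp add: homogeneous_iff)

text \<open>Records only the values: a form over the complex numbers is determined by them
  (\<open>zero_of_eval_zero\<close>), and products, powers and substitutions can then be formed
  without writing down a polynomial.\<close>

definition form_fun :: "nat \<Rightarrow> nat \<Rightarrow> (complex vec \<Rightarrow> complex) \<Rightarrow> bool"
  where "form_fun n k \<phi> \<longleftrightarrow> (\<exists>f. homogeneous n k f \<and> (\<forall>v\<in>carrier_vec (n+1). mp_eval f v = \<phi> v))"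

lemma form_fun_eval: "homogeneous n k f \<Longrightarrow> form_fun n k (mp_eval f)"
  unfolding form_fun_def by auto

lemma form_fun_const: "form_fun n 0 (\<lambda>v. c)"
  unfolding form_fun_def
  by (rule exI[of _ "single 0 c"]) (auto intro!: homogeneous_single)

lemma form_fun_zero: "form_fun n k (\<lambda>v. 0)"
  unfolding form_fun_def
  by (rule exI[of _ 0]) (auto intro: homogeneous_0)

lemma form_fun_coord: "i \<le> n \<Longrightarrow> form_fun n 1 (\<lambda>v. v $ i)"
  unfolding form_fun_def
  by (rule exI[of _ "mp_var i"]) (auto simp: mp_var_def intro!: homogeneous_single)

lemma form_fun_add: "form_fun n k \<phi> \<Longrightarrow> form_fun n k \<psi> \<Longrightarrow> form_fun n k (\<lambda>v. \<phi> v + \<psi> v)"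
  unfolding form_fun_def using homogeneous_add mp_eval_add by metis

lemma form_fun_mult: "form_fun n k \<phi> \<Longrightarrow> form_fun n l \<psi> \<Longrightarrow> form_fun n (k + l) (\<lambda>v. \<phi> v * \<psi> v)"
  unfolding form_fun_def using homogeneous_mult mp_eval_mult by metis

lemma form_fun_cmult: "form_fun n k \<phi> \<Longrightarrow> form_fun n k (\<lambda>v. c * \<phi> v)"
  using form_fun_mult[OF form_fun_const] by simp

lemma form_fun_sum:
  "(\<And>i. i \<in> I \<Longrightarrow> form_fun n k (\<phi> i)) \<Longrightarrow> form_fun n k (\<lambda>v. \<Sum>i\<in>I. \<phi> i v)"
  by (induct I rule: infinite_finite_induct) (auto simp: form_fun_zero form_fun_add)

lemma form_fun_prod:
  assumes "finite I" "\<And>i. i \<in> I \<Longrightarrow> form_fun n (k i) (\<phi> i)"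
  shows "form_fun n (\<Sum>i\<in>I. k i) (\<lambda>v. \<Prod>i\<in>I. \<phi> i v)"
  using assms by (induct I rule: finite_induct) (auto simp: form_fun_const form_fun_mult)

lemma form_fun_power: "form_fun n k \<phi> \<Longrightarrow> form_fun n (l * k) (\<lambda>v. \<phi> v ^ l)"
  using form_fun_prod[of "{..<l}" n "\<lambda>_. k" "\<lambda>_. \<phi>"] by simp

lemma form_fun_compose:
  assumes g: "homogeneous N l g" and F: "\<And>i. i \<le> N \<Longrightarrow> form_fun n k (F i)"
  shows "form_fun n (l * k) (\<lambda>v. mp_eval g (vec (N+1) (\<lambda>i. F i v)))"
proof -
  have "form_fun n (l * k) (\<lambda>v. mono_eval m (vec (N+1) (\<lambda>i. F i v)))" if m: "m \<in> keys g" for m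
  proof -
    have km: "keys m \<subseteq> {..N}" "mdeg m = l" using g m by (auto simp: homogeneous_iff)
    have "form_fun n (\<Sum>i\<in>keys m. lookup m i * k)
       (\<lambda>v. \<Prod>i\<in>keys m. F i v ^ lookup m i)"
      by (intro form_fun_prod form_fun_power F) (use km in auto)
    moreover have "(\<Sum>i\<in>keys m. lookup m i * k) = l * k"
      using km(2) by (simp add: mdeg_def flip: sum_distrib_right)
    moreover have "mono_eval m (vec (N+1) (\<lambda>i. F i v)) = (\<Prod>i\<in>keys m. F i v ^ lookup m i)" for v
      unfolding mono_eval_def by (rule prod.cong) (use km in auto)
    ultimately show ?thesis by simp
  qed
  then show ?thesis unfolding mp_eval_mon by (intro form_fun_sum form_fun_cmult)
qed

lemma mono_eval_smult:
  assumes "keys m \<subseteq> {..n}" "v \<in> carrier_vec (n+1)"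
  shows "mono_eval m (c \<cdot>\<^sub>v v) = c ^ mdeg m * mono_eval m v"
proof -
  have "mono_eval m (c \<cdot>\<^sub>v v) = (\<Prod>i\<in>keys m. c ^ lookup m i * (v $ i) ^ lookup m i)"
    unfolding mono_eval_def using assms by (intro prod.cong) (auto simp: power_mult_distrib)
  then show ?thesis
    by (simp add: prod.distrib mono_eval_def mdeg_def power_sum)
qed

lemma homogeneous_smult:
  assumes "homogeneous n k f" "v \<in> carrier_vec (n+1)"
  shows "mp_eval f (c \<cdot>\<^sub>v v) = c ^ k * mp_eval f v"
  unfolding mp_eval_mon sum_distrib_left
  by (rule sum.cong) (use assms in \<open>auto simp: homogeneous_iff mono_eval_smult\<close>)

lemma minus_single_add:
  assumes "lookup m i \<noteq> (0::nat)"
  shows "(m - single i 1) + single i 1 = m"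
  by (rule poly_mapping_eqI) (use assms in \<open>auto simp: lookup_add lookup_minus lookup_single when_def\<close>)

lemma homogeneous_partial:
  assumes "homogeneous n k f"
  shows "homogeneous n (k - 1) (mp_partial i f)"
  unfolding mp_partial_def
proof (rule homogeneous_sum)
  fix m assume m: "m \<in> keys f"
  show "homogeneous n (k - 1) (single (m - single i 1)
      (of_nat (lookup m i) * lookup f m))"
  proof (cases "lookup m i = 0")
    case True then show ?thesis by (simp add: homogeneous_0)
  next
    case False
    let ?m = "m - single i 1"
    have "keys ?m \<union> keys (single i (1::nat)) = keys m" "mdeg ?m + 1 = mdeg m"
      using minus_single_add[OF False] keys_add_nat[of ?m "single i 1"]
        mdeg_add[of ?m "single i 1"] by simp_all
    then show ?thesis using assms m by (intro homogeneous_single) (auto simp: homogeneous_iff)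
  qed
qed

lemma mp_eval_partial:
  "mp_eval (mp_partial i f) v = (\<Sum>m\<in>keys f.
     of_nat (lookup m i) * lookup f m * mono_eval (m - single i 1) v)"
  by (simp add: mp_partial_def)

text \<open>Distinct monomials divisible by x_i have distinct quotients by x_i, so no terms are
  collected. A monomial without x_i, which the truncated difference leaves unchanged, enters with
  the factor zero.\<close>

lemma lookup_partial:
  "lookup (mp_partial i f) m =
     of_nat (lookup m i + 1) * lookup f (m + single i 1)"
proof -
  let ?s = "single i (1::nat)"
  have "lookup (mp_partial i f) m = (\<Sum>m'\<in>keys f.
     if m' = m + ?s then of_nat (lookup m' i) * lookup f m' else 0)"
    unfolding mp_partial_def lookup_sum
  proof (rule sum.cong)
    fix m' assume "m' \<in> keys f"
    show "lookup (single (m' - ?s) (of_nat (lookup m' i) * lookup f m')) m =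
      (if m' = m + ?s then of_nat (lookup m' i) * lookup f m' else 0)"
    proof (cases "lookup m' i = 0")
      case True
      then have "m' \<noteq> m + ?s" by (auto simp: lookup_add)
      with True show ?thesis by simp
    next
      case False
      from minus_single_add[OF this] have "(m' - ?s = m) = (m' = m + ?s)" by auto
      then show ?thesis by (auto simp: lookup_single when_def)
    qed
  qed simp
  also have "\<dots> = of_nat (lookup m i + 1) * lookup f (m + ?s)"
    by (simp add: sum.delta lookup_add in_keys_iff)
  finally show ?thesis .
qed

section \<open>Derivatives of forms along curves\<close>

lemma mono_eval_has_derivative:
  assumes m: "keys m \<subseteq> {..n}"
    and F: "\<And>i. i \<le> n \<Longrightarrow> ((\<lambda>s. F s $ i) has_field_derivative F' i) (at s0)"
  shows "((\<lambda>s. mono_eval m (F s)) has_field_derivative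
     (\<Sum>i\<le>n. of_nat (lookup m i) * mono_eval (m - single i 1) (F s0) * F' i)) (at s0)"
proof -
  have *: "(\<Prod>j\<in>{..n} - {i}. F s0 $ j ^ lookup m j) * F s0 $ i ^ (lookup m i - 1)
     = mono_eval (m - single i 1) (F s0)" if "i \<le> n" for i
  proof -
    have k: "keys (m - single i 1) \<subseteq> {..n}"
      using m by (force simp: in_keys_iff lookup_minus subset_iff)
    have "mono_eval (m - single i 1) (F s0) = (\<Prod>j\<le>n. F s0 $ j ^ lookup (m - single i 1) j)"
      by (rule mono_eval_superset) (use k in auto)
    also have "\<dots> = F s0 $ i ^ lookup (m - single i 1) i *
        (\<Prod>j\<in>{..n} - {i}. F s0 $ j ^ lookup (m - single i 1) j)"
      using that by (subst prod.remove[of _ i]) auto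
    also have "(\<Prod>j\<in>{..n} - {i}. F s0 $ j ^ lookup (m - single i 1) j)
       = (\<Prod>j\<in>{..n} - {i}. F s0 $ j ^ lookup m j)"
      by (rule prod.cong) (auto simp: lookup_minus lookup_single when_def)
    finally show ?thesis by (simp add: lookup_minus mult.commute)
  qed
  have "((\<lambda>s. \<Prod>i\<le>n. (F s $ i) ^ lookup m i) has_field_derivative
     (\<Sum>i\<le>n. (of_nat (lookup m i) * (F' i * F s0 $ i ^ (lookup m i - 1))) *
        (\<Prod>j\<in>{..n} - {i}. F s0 $ j ^ lookup m j))) (at s0)"
    by (rule has_field_derivative_prod) (auto intro!: derivative_eq_intros F)
  also have "(\<Sum>i\<le>n. (of_nat (lookup m i) * (F' i * F s0 $ i ^ (lookup m i - 1))) *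
        (\<Prod>j\<in>{..n} - {i}. F s0 $ j ^ lookup m j))
     = (\<Sum>i\<le>n. of_nat (lookup m i) * mono_eval (m - single i 1) (F s0) * F' i)"
  proof (rule sum.cong)
    fix i assume "i \<in> {..n}"
    then have "i \<le> n" by simp
    show "(of_nat (lookup m i) * (F' i * F s0 $ i ^ (lookup m i - 1))) *
        (\<Prod>j\<in>{..n} - {i}. F s0 $ j ^ lookup m j)
      = of_nat (lookup m i) * mono_eval (m - single i 1) (F s0) * F' i"
      unfolding *[OF \<open>i \<le> n\<close>, symmetric] by (simp only: mult_ac)
  qed simp
  also have "(\<lambda>s. \<Prod>i\<le>n. (F s $ i) ^ lookup m i) = (\<lambda>s. mono_eval m (F s))"
    by (rule ext, rule sym, rule mono_eval_superset) (use m in auto)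
  finally show ?thesis .
qed

text \<open>Arbitrary differentiable curves are allowed because the rule is applied not only to
  straight lines, but also to their images under coordinatewise inversion and under psi.\<close>

lemma mp_eval_chain_rule:
  assumes f: "homogeneous n k f"
    and F: "\<And>i. i \<le> n \<Longrightarrow> ((\<lambda>s. F s $ i) has_field_derivative F' i) (at s0)"
  shows "((\<lambda>s. mp_eval f (F s)) has_field_derivative
     (\<Sum>i\<le>n. mp_eval (mp_partial i f) (F s0) * F' i)) (at s0)"
proof -
  have "((\<lambda>s. mp_eval f (F s)) has_field_derivative
     (\<Sum>m\<in>keys f. lookup f m *
        (\<Sum>i\<le>n. of_nat (lookup m i) * mono_eval (m - single i 1) (F s0) * F' i))) (at s0)"
    unfolding mp_eval_mon
    by (intro DERIV_sum DERIV_cmult mono_eval_has_derivative F) (use f in \<open>auto simp: homogeneous_iff\<close>)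
  also have "(\<Sum>m\<in>keys f. lookup f m *
        (\<Sum>i\<le>n. of_nat (lookup m i) * mono_eval (m - single i 1) (F s0) * F' i))
     = (\<Sum>i\<le>n. mp_eval (mp_partial i f) (F s0) * F' i)"
    unfolding mp_eval_partial sum_distrib_left sum_distrib_right
    by (subst sum.swap) (simp add: algebra_simps)
  finally show ?thesis .
qed

section \<open>Zariski closures and irreducibility\<close>

lemma proj_space_iff: "p \<in> proj_space n \<longleftrightarrow> (\<exists>v\<in>carrier_vec (n+1). v \<noteq> 0\<^sub>v (n+1) \<and> p = proj_pt v)"
  by (auto simp: proj_space_def projectivization_def)

lemma proj_ptI: "v \<in> proj_pt v"
proof -
  have "v = 1 \<cdot>\<^sub>v v" by simp
  then show ?thesis unfolding proj_pt_def by (metis (mono_tags, lifting) mem_Collect_eq zero_neq_one)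
qed

lemma proj_pt_smult: assumes "c \<noteq> 0" shows "proj_pt (c \<cdot>\<^sub>v v) = proj_pt v"
proof -
  have "\<exists>c'. a \<cdot>\<^sub>v v = c' \<cdot>\<^sub>v (c \<cdot>\<^sub>v v) \<and> c' \<noteq> 0" if "a \<noteq> 0" for a
    using assms that by (intro exI[of _ "a / c"]) (simp add: smult_smult_assoc)
  moreover have "\<exists>c'. a \<cdot>\<^sub>v (c \<cdot>\<^sub>v v) = c' \<cdot>\<^sub>v v \<and> c' \<noteq> 0" if "a \<noteq> 0" for a
    using assms that by (intro exI[of _ "a * c"]) (simp add: smult_smult_assoc)
  ultimately show ?thesis unfolding proj_pt_def by blast
qed

lemma smult_vec_eq_zero_iff:
  assumes "v \<in> carrier_vec m" shows "c \<cdot>\<^sub>v v = 0\<^sub>v m \<longleftrightarrow> c = 0 \<or> v = (0\<^sub>v m :: complex vec)"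
  using assms by (auto simp: vec_eq_iff)

lemma proj_space_mem:
  assumes "p \<in> proj_space n" "v \<in> p"
  shows "v \<in> carrier_vec (n+1)" "v \<noteq> 0\<^sub>v (n+1)" "p = proj_pt v"
proof -
  from assms(1) obtain w where w: "w \<in> carrier_vec (n+1)" "w \<noteq> 0\<^sub>v (n+1)" "p = proj_pt w"
    unfolding proj_space_iff by auto
  with assms(2) obtain c where c: "v = c \<cdot>\<^sub>v w" "c \<noteq> 0" unfolding proj_pt_def by auto
  show "v \<in> carrier_vec (n+1)" "v \<noteq> 0\<^sub>v (n+1)" "p = proj_pt v"
    using w c by (auto simp: smult_vec_eq_zero_iff proj_pt_smult)
qed

lemma proj_space_nonempty: "p \<in> proj_space n \<Longrightarrow> \<exists>v. v \<in> p"
  unfolding proj_space_iff using proj_ptI by auto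

lemma proj_pt_in_proj_space:
  "v \<in> carrier_vec (n+1) \<Longrightarrow> v \<noteq> 0\<^sub>v (n+1) \<Longrightarrow> proj_pt v \<in> proj_space n"
  unfolding proj_space_iff by auto

definition vanishes :: "mpoly \<Rightarrow> complex vec set \<Rightarrow> bool"
  where "vanishes f p \<longleftrightarrow> (\<forall>v\<in>p. mp_eval f v = 0)"

lemma vanishes_proj_pt:
  assumes "homogeneous n k f" "v \<in> carrier_vec (n+1)"
  shows "vanishes f (proj_pt v) \<longleftrightarrow> mp_eval f v = 0"
  using assms proj_ptI[of v] by (auto simp: vanishes_def proj_pt_def homogeneous_smult)

lemma vanishes_iff:
  assumes "homogeneous n k f" "p \<in> proj_space n" "v \<in> p"
  shows "vanishes f p \<longleftrightarrow> mp_eval f v = 0"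
  using vanishes_proj_pt[OF assms(1)] proj_space_mem[OF assms(2,3)] by auto

lemma vanishes_mult:
  assumes f: "homogeneous n k f" and g: "homogeneous n l g" and p: "p \<in> proj_space n"
  shows "vanishes (f * g) p \<longleftrightarrow> vanishes f p \<or> vanishes g p"
proof -
  obtain v where v: "v \<in> p" using proj_space_nonempty[OF p] by auto
  show ?thesis
    using vanishes_iff[OF f p v] vanishes_iff[OF g p v] vanishes_iff[OF homogeneous_mult[OF f g] p v] by simp
qed

lemma distinguished_open_iff: "p \<in> distinguished_open n f \<longleftrightarrow> p \<in> proj_space n \<and> \<not> vanishes f p"
  by (auto simp: distinguished_open_def vanishes_def)

lemma topspace_zariski [simp]: "topspace (zariski n) = proj_space n"
proof -
  have "proj_space n \<subseteq> distinguished_open n 1"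
    using proj_space_nonempty by (fastforce simp: distinguished_open_def)
  moreover have "homogeneous n 0 1" by (simp add: homogeneous_iff)
  ultimately have "proj_space n \<subseteq> \<Union> {distinguished_open n f |f. \<exists>k. homogeneous n k f}"
    by blast
  moreover have "\<Union> {distinguished_open n f |f. \<exists>k. homogeneous n k f} \<subseteq> proj_space n"
    by (auto simp: distinguished_open_def)
  ultimately show ?thesis
    unfolding zariski_def topology_generated_by_topspace by (rule subset_antisym[rotated])
qed

text \<open>The distinguished open sets are given only as a subbase. They form a base because the
  intersection of those of f and g is that of the product f g.\<close>

lemma zariski_open_basis:
  assumes "openin (zariski n) U" "p \<in> U"
  shows "\<exists>k f. homogeneous n k f \<and> p \<in> distinguished_open n f \<and> distinguished_open n f \<subseteq> U"
  using assms unfolding zariski_def openin_topology_generated_by_iff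
proof (induction arbitrary: p)
  case Empty
  then show ?case by simp
next
  case (Int a b)
  from Int.IH(1)[of p] Int.prems obtain k f where f: "homogeneous n k f" "p \<in> distinguished_open n f"
    "distinguished_open n f \<subseteq> a" by auto
  from Int.IH(2)[of p] Int.prems obtain l g where g: "homogeneous n l g" "p \<in> distinguished_open n g"
    "distinguished_open n g \<subseteq> b" by auto
  have "homogeneous n (k + l) (f * g)" using f g by (simp add: homogeneous_mult)
  moreover have "distinguished_open n (f * g) = distinguished_open n f \<inter> distinguished_open n g"
    using vanishes_mult[OF f(1) g(1)] by (auto simp: distinguished_open_iff)
  ultimately show ?case using f g by (intro exI[of _ "k + l"] exI[of _ "f * g"]) auto
next
  case (UN K)
  then show ?case by (meson UnionE Union_upper order_trans)
next
  case (Basis s)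
  then show ?case by blast
qed

lemma openin_distinguished: "homogeneous n k f \<Longrightarrow> openin (zariski n) (distinguished_open n f)"
  unfolding zariski_def by (intro topology_generated_by_Basis) auto

lemma closedin_vanishing:
  assumes "homogeneous n k f" shows "closedin (zariski n) {p \<in> proj_space n. vanishes f p}"
proof -
  have "proj_space n - {p \<in> proj_space n. vanishes f p} = distinguished_open n f"
    by (auto simp: distinguished_open_iff)
  then show ?thesis using openin_distinguished[OF assms] by (simp add: closedin_def)
qed

text \<open>Closed sets are common zero sets of forms: a basic open neighbourhood of p inside the
  complement supplies the form.\<close>

lemma closedin_separate:
  assumes "closedin (zariski n) C" "p \<in> proj_space n" "p \<notin> C"
  obtains k f where "homogeneous n k f" "\<forall>q\<in>C. vanishes f q" "\<not> vanishes f p"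
proof -
  have "openin (zariski n) (proj_space n - C)" "C \<subseteq> proj_space n"
    using assms(1) by (auto simp: closedin_def)
  then obtain k f where "homogeneous n k f" "p \<in> distinguished_open n f"
     "distinguished_open n f \<subseteq> proj_space n - C"
    using zariski_open_basis[of n "proj_space n - C" p] assms by auto
  then show ?thesis using \<open>C \<subseteq> proj_space n\<close>
    by (intro that[of k f]) (auto simp: distinguished_open_iff subset_iff)
qed

lemma zariski_closure_iff:
  assumes "S \<subseteq> proj_space n"
  shows "p \<in> zariski n closure_of S \<longleftrightarrow> p \<in> proj_space n \<and>
    (\<forall>k f. homogeneous n k f \<longrightarrow> (\<forall>q\<in>S. vanishes f q) \<longrightarrow> vanishes f p)"
    (is "_ \<longleftrightarrow> ?R")
proof
  assume p: "p \<in> zariski n closure_of S"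
  have "vanishes f p" if "homogeneous n k f" "\<forall>q\<in>S. vanishes f q" for k f
    using closure_of_minimal[OF _ closedin_vanishing[OF that(1)], of S] that(2) assms p by blast
  moreover have "p \<in> proj_space n" using p closure_of_subset_topspace[of "zariski n" S] by auto
  ultimately show ?R by auto
next
  assume R: ?R
  show "p \<in> zariski n closure_of S"
  proof (rule ccontr)
    assume "p \<notin> zariski n closure_of S"
    then obtain k f where "homogeneous n k f" "\<forall>q\<in>zariski n closure_of S. vanishes f q" "\<not> vanishes f p"
      using closedin_separate[of n "zariski n closure_of S" p] R by auto
    moreover have "S \<subseteq> zariski n closure_of S" using assms by (simp add: closure_of_subset)
    ultimately show False using R by blast
  qed
qed

text \<open>The ideal of an irreducible set is prime, tested on forms. It allows cancelling a factor
  in the comparison of Hilbert functions.\<close>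

lemma irreducible_closed_mult:
  assumes Z: "irreducible_closed n Z" and f: "homogeneous n k f" and g: "homogeneous n l g"
    and fg: "\<forall>p\<in>Z. vanishes (f * g) p"
  shows "(\<forall>p\<in>Z. vanishes f p) \<or> (\<forall>p\<in>Z. vanishes g p)"
proof -
  have sub: "Z \<subseteq> proj_space n"
    using Z closedin_subset by (fastforce simp: irreducible_closed_def)
  have "Z \<subseteq> {p \<in> proj_space n. vanishes f p} \<union> {p \<in> proj_space n. vanishes g p}"
    using sub fg vanishes_mult[OF f g] by blast
  then have "Z \<subseteq> {p \<in> proj_space n. vanishes f p} \<or> Z \<subseteq> {p \<in> proj_space n. vanishes g p}"
    using Z closedin_vanishing[OF f] closedin_vanishing[OF g] unfolding irreducible_closed_def by blast
  then show ?thesis by blast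
qed

lemma irreducible_closed_sub: "irreducible_closed n Z \<Longrightarrow> Z \<subseteq> proj_space n"
  using closedin_subset by (fastforce simp: irreducible_closed_def)

text \<open>All density arguments restrict to a line and use that a nonzero polynomial in one
  variable has finitely many roots. This weak form of polynomiality is enough for that, and it is
  easily verified for compositions and determinants.\<close>

definition poly_on_lines :: "nat \<Rightarrow> (complex vec \<Rightarrow> complex) \<Rightarrow> bool"
  where "poly_on_lines N \<phi> \<longleftrightarrow> (\<forall>a\<in>carrier_vec N. \<forall>b\<in>carrier_vec N.
     \<exists>p. \<forall>s. \<phi> (a + s \<cdot>\<^sub>v (b - a)) = poly p s)"

lemma poly_on_lines_const: "poly_on_lines N (\<lambda>_. c)"
  unfolding poly_on_lines_def by (intro ballI exI[of _ "[:c:]"]) simp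

lemma poly_on_lines_coord: "i < N \<Longrightarrow> poly_on_lines N (\<lambda>v. v $ i)"
  unfolding poly_on_lines_def
proof (intro ballI)
  fix a b :: "complex vec" assume "i < N" "a \<in> carrier_vec N" "b \<in> carrier_vec N"
  then show "\<exists>p. \<forall>s. (a + s \<cdot>\<^sub>v (b - a)) $ i = poly p s"
    by (intro exI[of _ "[:a $ i, b $ i - a $ i:]"]) auto
qed

lemma poly_on_lines_add:
  assumes "poly_on_lines N \<phi>" "poly_on_lines N \<psi>"
  shows "poly_on_lines N (\<lambda>v. \<phi> v + \<psi> v)"
  unfolding poly_on_lines_def
proof (intro ballI)
  fix a b :: "complex vec" assume ab: "a \<in> carrier_vec N" "b \<in> carrier_vec N"
  obtain p q where "\<forall>s. \<phi> (a + s \<cdot>\<^sub>v (b - a)) = poly p s" "\<forall>s. \<psi> (a + s \<cdot>\<^sub>v (b - a)) = poly q s"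
    using assms ab unfolding poly_on_lines_def by meson
  then show "\<exists>p. \<forall>s. \<phi> (a + s \<cdot>\<^sub>v (b - a)) + \<psi> (a + s \<cdot>\<^sub>v (b - a)) = poly p s"
    by (intro exI[of _ "p + q"]) simp
qed

lemma poly_on_lines_mult:
  assumes "poly_on_lines N \<phi>" "poly_on_lines N \<psi>"
  shows "poly_on_lines N (\<lambda>v. \<phi> v * \<psi> v)"
  unfolding poly_on_lines_def
proof (intro ballI)
  fix a b :: "complex vec" assume ab: "a \<in> carrier_vec N" "b \<in> carrier_vec N"
  obtain p q where "\<forall>s. \<phi> (a + s \<cdot>\<^sub>v (b - a)) = poly p s" "\<forall>s. \<psi> (a + s \<cdot>\<^sub>v (b - a)) = poly q s"
    using assms ab unfolding poly_on_lines_def by meson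
  then show "\<exists>p. \<forall>s. \<phi> (a + s \<cdot>\<^sub>v (b - a)) * \<psi> (a + s \<cdot>\<^sub>v (b - a)) = poly p s"
    by (intro exI[of _ "p * q"]) simp
qed

lemma poly_on_lines_sum:
  "(\<And>i. i \<in> I \<Longrightarrow> poly_on_lines N (\<phi> i)) \<Longrightarrow> poly_on_lines N (\<lambda>v. \<Sum>i\<in>I. \<phi> i v)"
  by (induct I rule: infinite_finite_induct) (auto simp: poly_on_lines_const poly_on_lines_add)

lemma poly_on_lines_prod:
  "(\<And>i. i \<in> I \<Longrightarrow> poly_on_lines N (\<phi> i)) \<Longrightarrow> poly_on_lines N (\<lambda>v. \<Prod>i\<in>I. \<phi> i v)"
  by (induct I rule: infinite_finite_induct) (auto simp: poly_on_lines_const poly_on_lines_mult)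

lemma poly_on_lines_power: "poly_on_lines N \<phi> \<Longrightarrow> poly_on_lines N (\<lambda>v. \<phi> v ^ k)"
  by (induct k) (auto simp: poly_on_lines_const poly_on_lines_mult)

lemma poly_on_lines_cong:
  assumes "poly_on_lines N \<phi>" "\<And>v. v \<in> carrier_vec N \<Longrightarrow> \<phi> v = \<psi> v" shows "poly_on_lines N \<psi>"
  unfolding poly_on_lines_def
proof (intro ballI)
  fix a b :: "complex vec" assume ab: "a \<in> carrier_vec N" "b \<in> carrier_vec N"
  then obtain p where "\<forall>s. \<phi> (a + s \<cdot>\<^sub>v (b - a)) = poly p s"
    using assms(1) unfolding poly_on_lines_def by blast
  then show "\<exists>p. \<forall>s. \<psi> (a + s \<cdot>\<^sub>v (b - a)) = poly p s"
    using ab by (intro exI[of _ p]) (simp flip: assms(2))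
qed

lemma poly_on_lines_compose:
  assumes g: "homogeneous n l g" and F: "\<And>i. i \<le> n \<Longrightarrow> poly_on_lines N (F i)"
  shows "poly_on_lines N (\<lambda>v. mp_eval g (vec (n+1) (\<lambda>i. F i v)))"
proof -
  have "poly_on_lines N (\<lambda>v. mono_eval m (vec (n+1) (\<lambda>i. F i v)))" if m: "m \<in> keys g" for m
  proof -
    have km: "keys m \<subseteq> {..n}" using g m by (auto simp: homogeneous_iff)
    have "poly_on_lines N (\<lambda>v. \<Prod>i\<in>keys m. F i v ^ lookup m i)"
      by (intro poly_on_lines_prod poly_on_lines_power F) (use km in auto)
    then show ?thesis
    proof (rule poly_on_lines_cong)
      fix v
      show "(\<Prod>i\<in>keys m. F i v ^ lookup m i) = mono_eval m (vec (n+1) (\<lambda>i. F i v))"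
        unfolding mono_eval_def by (rule prod.cong) (use km in auto)
    qed
  qed
  then show ?thesis
    unfolding mp_eval_mon by (intro poly_on_lines_sum poly_on_lines_mult poly_on_lines_const)
qed

lemma poly_on_lines_form_fun:
  assumes "form_fun n k \<phi>" shows "poly_on_lines (n+1) \<phi>"
proof -
  from assms obtain f where f: "homogeneous n k f" "\<And>v. v \<in> carrier_vec (n+1) \<Longrightarrow> mp_eval f v = \<phi> v"
    unfolding form_fun_def by auto
  have "poly_on_lines (n+1) (\<lambda>v. mp_eval f (vec (n+1) (\<lambda>i. v $ i)))"
    by (rule poly_on_lines_compose[OF f(1)]) (auto intro: poly_on_lines_coord)
  then show ?thesis
  proof (rule poly_on_lines_cong)
    fix v :: "complex vec" assume v: "v \<in> carrier_vec (n+1)"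
    then have "vec (n+1) (\<lambda>i. v $ i) = v" by auto
    then show "mp_eval f (vec (n+1) (\<lambda>i. v $ i)) = \<phi> v" using f(2)[OF v] by simp
  qed
qed

lemma line_0: "a \<in> carrier_vec N \<Longrightarrow> b \<in> carrier_vec N \<Longrightarrow> a + (0::complex) \<cdot>\<^sub>v (b - a) = a"
  and line_1: "a \<in> carrier_vec N \<Longrightarrow> b \<in> carrier_vec N \<Longrightarrow> a + (1::complex) \<cdot>\<^sub>v (b - a) = b"
  by auto

lemma poly_on_lines_finite_zeros:
  assumes "poly_on_lines N \<phi>" "a \<in> carrier_vec N" "b \<in> carrier_vec N" "\<phi> a \<noteq> 0 \<or> \<phi> b \<noteq> 0"
  shows "finite {s. \<phi> (a + s \<cdot>\<^sub>v (b - a)) = 0}"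
proof -
  obtain p where p: "\<And>s. \<phi> (a + s \<cdot>\<^sub>v (b - a)) = poly p s"
    using assms(1-3) unfolding poly_on_lines_def by blast
  have "poly p 0 = \<phi> a" "poly p 1 = \<phi> b"
    using p[of 0] p[of 1] by (simp_all only: line_0[OF assms(2,3)] line_1[OF assms(2,3)])
  then have "p \<noteq> 0" using assms(4) by auto
  then show ?thesis unfolding p by (rule poly_roots_finite)
qed

lemma infinite_cofinite_complex: "finite (A :: complex set) \<Longrightarrow> \<exists>s. s \<notin> A"
  using infinite_UNIV_char_0 ex_new_if_finite by blast

text \<open>Induction on K: on the line from a point that suits the earlier functions to a point
  that suits the new one, each function has only finitely many zeros.\<close>

lemma common_nonzero:
  assumes "finite K" "\<And>k. k \<in> K \<Longrightarrow> poly_on_lines N (\<phi> k)"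
    "\<And>k. k \<in> K \<Longrightarrow> \<exists>a\<in>carrier_vec N. \<phi> k a \<noteq> 0"
  shows "\<exists>a\<in>carrier_vec N. \<forall>k\<in>K. \<phi> k a \<noteq> 0"
  using assms
proof (induct K rule: finite_induct)
  case empty
  then show ?case by (auto intro: zero_carrier_vec)
next
  case (insert k K)
  obtain a where a: "a \<in> carrier_vec N" "\<forall>k\<in>K. \<phi> k a \<noteq> 0" using insert by auto
  obtain b where b: "b \<in> carrier_vec N" "\<phi> k b \<noteq> 0" using insert.prems(2)[of k] by auto
  have "finite (\<Union>j\<in>insert k K. {s. \<phi> j (a + s \<cdot>\<^sub>v (b - a)) = 0})"
    using insert a b by (intro finite_UN_I poly_on_lines_finite_zeros) auto
  then obtain s where "s \<notin> (\<Union>j\<in>insert k K. {s. \<phi> j (a + s \<cdot>\<^sub>v (b - a)) = 0})"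
    using infinite_cofinite_complex by blast
  then show ?case using a b by (intro bexI[of _ "a + s \<cdot>\<^sub>v (b - a)"]) auto
qed

text \<open>Stands for a Zariski open part of a linear space. The only property that irreducibility
  of an image needs is that the line through two points of U leaves U for finitely many parameters;
  the linear space may be a proper subspace of the ambient one.\<close>

definition line_open :: "nat \<Rightarrow> complex vec set \<Rightarrow> bool"
  where "line_open N U \<longleftrightarrow> U \<subseteq> carrier_vec N \<and>
    (\<forall>a\<in>U. \<forall>b\<in>U. finite {s. a + s \<cdot>\<^sub>v (b - a) \<notin> U})"

lemma line_openI:
  assumes U: "U \<subseteq> carrier_vec N"
    and K: "\<And>a b. a \<in> U \<Longrightarrow> b \<in> U \<Longrightarrow> \<exists>K. finite K \<and> (\<forall>\<chi>\<in>K. poly_on_lines N \<chi> \<and> \<chi> a \<noteq> 0) \<and>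
      (\<forall>s. (\<forall>\<chi>\<in>K. \<chi> (a + s \<cdot>\<^sub>v (b - a)) \<noteq> 0) \<longrightarrow> a + s \<cdot>\<^sub>v (b - a) \<in> U)"
  shows "line_open N U"
  unfolding line_open_def
proof (intro conjI ballI U)
  fix a b assume ab: "a \<in> U" "b \<in> U"
  then have c: "a \<in> carrier_vec N" "b \<in> carrier_vec N" using U by auto
  obtain K where K: "finite K" "\<And>\<chi>. \<chi> \<in> K \<Longrightarrow> poly_on_lines N \<chi> \<and> \<chi> a \<noteq> 0"
    "\<And>s. (\<forall>\<chi>\<in>K. \<chi> (a + s \<cdot>\<^sub>v (b - a)) \<noteq> 0) \<Longrightarrow> a + s \<cdot>\<^sub>v (b - a) \<in> U"
    using K[OF ab] by meson
  have "finite (\<Union>\<chi>\<in>K. {s. \<chi> (a + s \<cdot>\<^sub>v (b - a)) = 0})"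
    using K(1,2) c by (intro finite_UN_I poly_on_lines_finite_zeros) auto
  then show "finite {s. a + s \<cdot>\<^sub>v (b - a) \<notin> U}" by (rule rev_finite_subset) (use K(3) in blast)
qed

lemma line_open_nonzero:
  assumes F: "\<And>i. i \<le> n \<Longrightarrow> poly_on_lines N (F i)"
  shows "line_open N {z \<in> carrier_vec N. vec (n+1) (\<lambda>i. F i z) \<noteq> 0\<^sub>v (n+1)}" (is "line_open N ?U")
proof (rule line_openI)
  fix a b assume ab: "a \<in> ?U" "b \<in> ?U"
  then obtain i where i: "i \<le> n" "F i a \<noteq> 0" by (auto simp: vec_eq_iff less_Suc_eq_le)
  have "a + s \<cdot>\<^sub>v (b - a) \<in> ?U" if "F i (a + s \<cdot>\<^sub>v (b - a)) \<noteq> 0" for s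
    using that ab i by (auto simp: vec_eq_iff intro!: exI[of _ i])
  then show "\<exists>K. finite K \<and> (\<forall>\<chi>\<in>K. poly_on_lines N \<chi> \<and> \<chi> a \<noteq> 0) \<and>
      (\<forall>s. (\<forall>\<chi>\<in>K. \<chi> (a + s \<cdot>\<^sub>v (b - a)) \<noteq> 0) \<longrightarrow> a + s \<cdot>\<^sub>v (b - a) \<in> ?U)"
    using F i by (intro exI[of _ "{F i}"]) simp
qed auto

text \<open>If neither C1 nor C2 contained the image, forms f and g would separate the image of some
  a from C1 and that of some b from C2. On the line through a and b all but finitely many parameters
  lie in U and avoid the zeros of both, so their images lie outside both sets.\<close>

lemma irreducible_closure_image:
  assumes U: "line_open N U" "U \<noteq> {}"
    and F: "\<And>i. i \<le> n \<Longrightarrow> poly_on_lines N (F i)"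
    and nz: "\<And>t. t \<in> U \<Longrightarrow> vec (n+1) (\<lambda>i. F i t) \<noteq> 0\<^sub>v (n+1)"
  shows "irreducible_closed n (zariski n closure_of ((\<lambda>t. proj_pt (vec (n+1) (\<lambda>i. F i t))) ` U))"
    (is "irreducible_closed n (zariski n closure_of ?S)")
  unfolding irreducible_closed_def
proof (intro conjI allI impI)
  let ?F = "\<lambda>t. vec (n+1) (\<lambda>i. F i t)"
  have S: "?S \<subseteq> proj_space n" using nz by (auto intro!: proj_pt_in_proj_space)
  have Scl: "?S \<subseteq> zariski n closure_of ?S" using S by (simp add: closure_of_subset)
  show "closedin (zariski n) (zariski n closure_of ?S)" by simp
  show "zariski n closure_of ?S \<noteq> {}" using Scl U by auto
  fix C1 C2 assume C: "closedin (zariski n) C1" "closedin (zariski n) C2" "zariski n closure_of ?S \<subseteq> C1 \<union> C2"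
  have "?S \<subseteq> C1 \<or> ?S \<subseteq> C2"
  proof (rule ccontr)
    assume "\<not> (?S \<subseteq> C1 \<or> ?S \<subseteq> C2)"
    then obtain a b where a: "a \<in> U" "proj_pt (?F a) \<notin> C1" and b: "b \<in> U" "proj_pt (?F b) \<notin> C2" by blast
    obtain k f where f: "homogeneous n k f" "\<forall>q\<in>C1. vanishes f q" "\<not> vanishes f (proj_pt (?F a))"
      using closedin_separate[OF C(1), of "proj_pt (?F a)"] a S by blast
    obtain l g where g: "homogeneous n l g" "\<forall>q\<in>C2. vanishes g q" "\<not> vanishes g (proj_pt (?F b))"
      using closedin_separate[OF C(2), of "proj_pt (?F b)"] b S by blast
    have ab: "a \<in> carrier_vec N" "b \<in> carrier_vec N" using a b U by (auto simp: line_open_def)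
    have f': "vanishes f (proj_pt (?F t)) \<longleftrightarrow> mp_eval f (?F t) = 0" for t
      by (rule vanishes_proj_pt[OF f(1)]) auto
    have g': "vanishes g (proj_pt (?F t)) \<longleftrightarrow> mp_eval g (?F t) = 0" for t
      by (rule vanishes_proj_pt[OF g(1)]) auto
    have 1: "finite {s. mp_eval f (?F (a + s \<cdot>\<^sub>v (b - a))) = 0}"
      by (rule poly_on_lines_finite_zeros[OF poly_on_lines_compose[OF f(1) F] ab])
         (use f(3) f' in auto)
    have 2: "finite {s. mp_eval g (?F (a + s \<cdot>\<^sub>v (b - a))) = 0}"
      by (rule poly_on_lines_finite_zeros[OF poly_on_lines_compose[OF g(1) F] ab])
         (use g(3) g' in auto)
    have 3: "finite {s. a + s \<cdot>\<^sub>v (b - a) \<notin> U}" using U a b by (auto simp: line_open_def)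
    obtain s where s: "mp_eval f (?F (a + s \<cdot>\<^sub>v (b - a))) \<noteq> 0" "mp_eval g (?F (a + s \<cdot>\<^sub>v (b - a))) \<noteq> 0"
       "a + s \<cdot>\<^sub>v (b - a) \<in> U"
      using infinite_cofinite_complex[OF finite_UnI[OF finite_UnI[OF 1 2] 3]] by auto
    then have "proj_pt (?F (a + s \<cdot>\<^sub>v (b - a))) \<in> C1 \<union> C2" using Scl C(3) by blast
    then show False using s f(2) g(2) f' g' by blast
  qed
  then show "zariski n closure_of ?S \<subseteq> C1 \<or> zariski n closure_of ?S \<subseteq> C2"
    using C closure_of_minimal by blast
qed

section \<open>Growth of Hilbert functions\<close>

lemma fact_add_ge: "fact k * k ^ s \<le> (fact (k + s) :: nat)"
proof (induct s)
  case (Suc s)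
  have "fact k * k ^ Suc s = k * (fact k * k ^ s)" by simp
  also have "\<dots> \<le> (k + Suc s) * fact (k + s)" by (rule mult_le_mono) (use Suc in auto)
  finally show ?case by (simp add: algebra_simps)
qed simp

text \<open>In k the left side has degree n and the right side degree n + 1. It serves both to bound
  growth exponents by n and to produce algebraic relations.\<close>

lemma binomial_growth_gap: "\<exists>k. (m * k + n) choose n < (k + n + 1) choose (n + 1)"
proof -
  \<comment> \<open>The summand n gives m k + n \<le> (m + 1) k. The product beats the constant that
    remains after multiplying by the factorial of n + 1 and comparing with powers of k.\<close>
  define k where "k = (n + 1) * (m + 1) ^ n + n + 1"
  have k: "n \<le> k" "(n + 1) * (m + 1) ^ n < k" by (auto simp: k_def)
  have "fact (n+1) * ((m * k + n) choose n) = (n + 1) * (((m * k + n) choose n) * fact n)"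
    by (simp add: algebra_simps)
  also have "\<dots> \<le> (n + 1) * (m * k + n) ^ n"
    using binomial_fact_pow[of "m * k + n" n] by (intro mult_le_mono) auto
  also have "\<dots> \<le> (n + 1) * ((m + 1) * k) ^ n"
    by (intro mult_le_mono power_mono) (use k in \<open>auto simp: algebra_simps\<close>)
  also have "\<dots> = ((n + 1) * (m + 1) ^ n) * k ^ n" by (simp only: power_mult_distrib mult.assoc)
  also have "\<dots> < k * k ^ n" using k by simp
  also have "\<dots> = k ^ (n + 1)" by simp
  also have "\<dots> \<le> fact (n+1) * ((k + n + 1) choose (n + 1))"
  proof -
    have "fact k * k ^ (n + 1) \<le> (fact (k + (n + 1)) :: nat)" by (rule fact_add_ge)
    also have "\<dots> = fact k * (fact (n+1) * ((k + (n + 1)) choose (n + 1)))"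
      using binomial_fact_lemma[of "n+1" "k + (n + 1)"] by (simp add: mult_ac)
    finally show ?thesis by (simp add: add.assoc)
  qed
  finally have "(fact (n + 1) :: nat) * (m * k + n choose n) < fact (n + 1) * (k + n + 1 choose (n + 1))" .
  then show ?thesis by (intro exI[of _ k]) simp
qed

text \<open>Gaussian elimination on functions, because unknowns and equations will be indexed by
  monomials as well as by numbers.\<close>

lemma underdetermined_system:
  fixes a :: "'i \<Rightarrow> 'e \<Rightarrow> complex"
  assumes "finite E" "finite I" "card E < card I"
  shows "\<exists>c. (\<exists>i\<in>I. c i \<noteq> 0) \<and> (\<forall>e\<in>E. (\<Sum>i\<in>I. c i * a i e) = 0)"
  using assms
proof (induct E arbitrary: I a rule: finite_induct)
  case empty
  then show ?case by (intro exI[of _ "\<lambda>_. 1"]) (auto simp: card_gt_0_iff)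
next
  case (insert e E)
  show ?case
  proof (cases "\<forall>i\<in>I. a i e = 0")
    case True
    have "card E < card I" using insert by simp
    then obtain c where "(\<exists>i\<in>I. c i \<noteq> 0)" "(\<forall>e\<in>E. (\<Sum>i\<in>I. c i * a i e) = 0)"
      using insert.hyps(3)[OF insert.prems(1), of a] by blast
    then show ?thesis using True by (intro exI[of _ c]) auto
  next
    case False
    then obtain j where j: "j \<in> I" "a j e \<noteq> 0" by auto
    \<comment> \<open>Elimination with pivot \<open>a j e\<close>: the system b no longer involves
      the equation e, and the value of c' at j below is the one that this equation forces on the
      unknown j.\<close>
    define b where "b = (\<lambda>i x. a i x - a i e / a j e * a j x)"
    have "card E < card (I - {j})" using insert j by (simp add: card_insert_if)
    then obtain c where c: "\<exists>i\<in>I - {j}. c i \<noteq> 0" "\<forall>x\<in>E. (\<Sum>i\<in>I - {j}. c i * b i x) = 0"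
      using insert.hyps(3)[of "I - {j}" b] insert.prems by auto
    define c' where "c' = (\<lambda>i. if i = j then - (\<Sum>i\<in>I - {j}. c i * a i e / a j e) else c i)"
    have sum: "(\<Sum>i\<in>I. c' i * a i x) = (\<Sum>i\<in>I - {j}. c i * b i x)" for x
    proof -
      have "(\<Sum>i\<in>I. c' i * a i x) = c' j * a j x + (\<Sum>i\<in>I - {j}. c' i * a i x)"
        using insert.prems j by (simp add: sum.remove)
      also have "(\<Sum>i\<in>I - {j}. c' i * a i x) = (\<Sum>i\<in>I - {j}. c i * a i x)"
        by (rule sum.cong) (auto simp: c'_def)
      also have "c' j * a j x + (\<Sum>i\<in>I - {j}. c i * a i x)
          = (\<Sum>i\<in>I - {j}. c i * a i x - c i * a i e / a j e * a j x)"
        by (simp add: c'_def sum_subtractf sum_distrib_right)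
      also have "\<dots> = (\<Sum>i\<in>I - {j}. c i * b i x)"
        by (rule sum.cong) (simp_all add: b_def right_diff_distrib mult.assoc)
      finally show ?thesis .
    qed
    have "b i e = 0" for i using j by (simp add: b_def)
    then have "\<forall>x\<in>insert e E. (\<Sum>i\<in>I. c' i * a i x) = 0" using c sum by auto
    moreover have "\<exists>i\<in>I. c' i \<noteq> 0" using c by (auto simp: c'_def)
    ultimately show ?thesis by blast
  qed
qed

section \<open>Counting monomials and independent forms\<close>

definition monomials :: "nat set \<Rightarrow> nat \<Rightarrow> (nat \<Rightarrow>\<^sub>0 nat) set"
  where "monomials S k = {m. keys m \<subseteq> S \<and> mdeg m = k}"

text \<open>A monomial is read as the list of its exponents along the sorted variables, so that the
  count of lists of given length and sum applies.\<close>

lemma bij_betw_monomials: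
  assumes "finite S"
  shows "bij_betw (\<lambda>m. map (lookup m) (sorted_list_of_set S))
    (monomials S k) {l. length l = card S \<and> sum_list l = k}"
proof -
  let ?xs = "sorted_list_of_set S"
  have xs: "set ?xs = S" "distinct ?xs" "length ?xs = card S" using assms by auto
  have deg: "sum_list (map (lookup m) ?xs) = mdeg m" if "keys m \<subseteq> S" for m
    using that assms xs by (simp add: sum_list_distinct_conv_sum_set mdeg_superset[of S])
  show ?thesis
  proof (rule bij_betwI')
    fix m m' assume m: "m \<in> monomials S k" "m' \<in> monomials S k"
    show "(map (lookup m) ?xs = map (lookup m') ?xs) = (m = m')"
    proof
      assume *: "map (lookup m) ?xs = map (lookup m') ?xs"
      show "m = m'"
      proof (rule poly_mapping_eqI)
        fix i show "lookup m i = lookup m' i"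
        proof (cases "i \<in> S")
          case True then show ?thesis using * xs by (simp add: map_eq_conv)
        next
          case False
          then have "i \<notin> keys m" "i \<notin> keys m'" using m by (auto simp: monomials_def)
          then show ?thesis by (simp add: in_keys_iff)
        qed
      qed
    qed simp
  next
    fix m assume "m \<in> monomials S k"
    then show "map (lookup m) ?xs \<in> {l. length l = card S \<and> sum_list l = k}"
      using deg xs by (simp add: monomials_def)
  next
    fix l assume l: "l \<in> {l. length l = card S \<and> sum_list l = k}"
    define m where "m = (\<Sum>j<card S. single (?xs ! j) (l ! j))"
    have lk: "lookup m (?xs ! j) = l ! j" if "j < card S" for j
    proof -
      have "lookup m (?xs ! j) = (\<Sum>i<card S. if i = j then l ! i else 0)"
        unfolding m_def lookup_sum
        by (rule sum.cong) (use that xs in \<open>auto simp: lookup_single when_def nth_eq_iff_index_eq\<close>)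
      then show ?thesis using that by simp
    qed
    have keys: "keys m \<subseteq> S"
    proof
      fix i assume "i \<in> keys m"
      then have "(\<Sum>j<card S. lookup (single (?xs ! j) (l ! j)) i) \<noteq> 0"
        by (simp add: m_def lookup_sum in_keys_iff)
      then obtain j where "j < card S" "lookup (single (?xs ! j) (l ! j)) i \<noteq> 0"
        by (meson lessThan_iff sum.neutral)
      then have "i = ?xs ! j" by (auto simp: lookup_single when_def split: if_splits)
      then show "i \<in> S" using \<open>j < card S\<close> xs by (metis nth_mem)
    qed
    have "map (lookup m) ?xs = l"
      by (rule nth_equalityI) (use l lk xs in auto)
    moreover from this have "m \<in> monomials S k" using keys deg[OF keys] l by (auto simp: monomials_def)
    ultimately show "\<exists>m\<in>monomials S k. l = map (lookup m) ?xs" by auto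
  qed
qed

lemma
  assumes "finite S" "card S = r + 1"
  shows finite_monomials: "finite (monomials S k)"
    and card_monomials: "card (monomials S k) = (k + r) choose r"
proof -
  have c: "card (monomials S k) = (k + r) choose k"
    using bij_betw_same_card[OF bij_betw_monomials[OF assms(1), of k]] card_length_sum_list[of "r+1" k] assms(2)
    by simp
  also have "\<dots> = (k + r) choose r" using binomial_symmetric[of k "k + r"] by simp
  finally show "card (monomials S k) = (k + r) choose r" .
  \<comment> \<open>An infinite set has cardinality 0, so the positive count yields
    finiteness.\<close>
  then have "card (monomials S k) \<noteq> 0" by simp
  then show "finite (monomials S k)" using card.infinite[of "monomials S k"] by argo
qed

lemma finite_card_atMost: "finite {..n}" "card {..n} = n + 1" by auto

lemma homogeneous_keys: "homogeneous n k f \<longleftrightarrow> keys f \<subseteq> monomials {..n} k"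
  by (auto simp: homogeneous_iff monomials_def)

lemma single_family_sum:
  assumes "finite I"
  shows "(\<Sum>i\<in>I. mp_const (c i) * f i) = 0 \<longleftrightarrow> (\<forall>m. (\<Sum>i\<in>I. c i * lookup (f i) m) = 0)"
proof -
  have "lookup (\<Sum>i\<in>I. mp_const (c i) * f i) m = (\<Sum>i\<in>I. c i * lookup (f i) m)" for m
    unfolding mp_const_def lookup_sum
    by (rule sum.cong) (simp_all flip: mult_map_scale_conv_mult add: Poly_Mapping.map.rep_eq when_def)
  then show ?thesis by (simp add: poly_mapping_eq_iff fun_eq_iff)
qed

lemma sum_lessThan_add: "(\<Sum>i<N+M. F i) = (\<Sum>i<N. F i) + (\<Sum>i<M. F (N + i))"
  for F :: "nat \<Rightarrow> 'a::comm_monoid_add"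
  by (induct M) (simp_all add: add.assoc)

text \<open>Expresses that the Hilbert function of Z in degree k is at least N: the forms are
  linearly independent modulo the ideal of Z.\<close>

definition independent_forms :: "nat \<Rightarrow> complex vec set set \<Rightarrow> nat \<Rightarrow> nat \<Rightarrow> bool"
  where "independent_forms n Z k N \<longleftrightarrow> (\<exists>f. (\<forall>i<N. homogeneous n k (f i)) \<and>
    (\<forall>c. (\<forall>p\<in>Z. vanishes (\<Sum>i<N. mp_const (c i) * f i) p) \<longrightarrow> (\<forall>i<N. c i = 0)))"

lemma independent_forms_mono:
  assumes "independent_forms n Z k N" "M \<le> N" shows "independent_forms n Z k M"
proof -
  obtain f where f: "\<And>i. i < N \<Longrightarrow> homogeneous n k (f i)"
    "\<And>c. \<forall>p\<in>Z. vanishes (\<Sum>i<N. mp_const (c i) * f i) p \<Longrightarrow> \<forall>i<N. c i = 0"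
    using assms(1) unfolding independent_forms_def by blast
  have "\<forall>i<M. c i = 0" if "\<forall>p\<in>Z. vanishes (\<Sum>i<M. mp_const (c i) * f i) p" for c
  proof -
    have "(\<Sum>i<N. mp_const (if i < M then c i else 0) * f i) = (\<Sum>i<M. mp_const (c i) * f i)"
      using assms(2) by (intro sum.mono_neutral_cong_right) (auto simp: mp_const_def)
    then have "\<forall>i<N. (if i < M then c i else 0) = 0" using that by (intro f(2)) simp
    then show ?thesis using assms(2) by (metis order_less_le_trans)
  qed
  then show ?thesis unfolding independent_forms_def using f(1) assms(2)
    by (intro exI[of _ f]) auto
qed

lemma independent_forms_le:
  assumes "independent_forms n Z k N" shows "N \<le> (k + n) choose n"
proof (rule ccontr)
  assume "\<not> N \<le> (k + n) choose n"
  then have lt: "card (monomials {..n} k) < card {..<N}"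
    using card_monomials[OF finite_card_atMost] by simp
  obtain f where f: "\<And>i. i < N \<Longrightarrow> homogeneous n k (f i)"
    "\<And>c. \<forall>p\<in>Z. vanishes (\<Sum>i<N. mp_const (c i) * f i) p \<Longrightarrow> \<forall>i<N. c i = 0"
    using assms(1) unfolding independent_forms_def by blast
  obtain c where c: "\<exists>i\<in>{..<N}. c i \<noteq> 0"
    "\<forall>m\<in>monomials {..n} k. (\<Sum>i\<in>{..<N}. c i * lookup (f i) m) = 0"
    using underdetermined_system[OF finite_monomials[OF finite_card_atMost] _ lt, of "\<lambda>i. lookup (f i)"]
    by auto
  have "(\<Sum>i\<in>{..<N}. c i * lookup (f i) m) = 0" for m
  proof (cases "m \<in> monomials {..n} k")
    case False
    then have "\<forall>i<N. m \<notin> keys (f i)"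
      using f(1) by (auto simp: homogeneous_keys)
    then show ?thesis by (simp add: in_keys_iff)
  qed (use c in auto)
  then have "(\<Sum>i<N. mp_const (c i) * f i) = 0" by (simp add: single_family_sum)
  then have "\<forall>i<N. c i = 0" by (intro f(2)) (simp add: vanishes_def)
  with c show False by auto
qed

lemma homogeneous_combination:
  "(\<And>i. i \<in> I \<Longrightarrow> homogeneous n k (f i)) \<Longrightarrow> homogeneous n k (\<Sum>i\<in>I. mp_const (c i) * f i)"
  using homogeneous_mult[of n 0 "mp_const _" k] by (intro homogeneous_sum) (auto simp: mp_const_def homogeneous_single)

text \<open>Together with the forms for Z, the h-multiples of the forms of degree l for Z' are used.
  On Z the multiples disappear from a relation, which kills the coefficients of the first family;
  then h can be cancelled, since the ideal of Z' is prime and h is not in it.\<close>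

lemma independent_forms_step:
  assumes Z': "irreducible_closed n Z'" and sub: "Z \<subseteq> Z'"
    and h: "homogeneous n e h" "\<forall>p\<in>Z. vanishes h p" "\<not> (\<forall>p\<in>Z'. vanishes h p)"
    and ZN: "independent_forms n Z (e + l) N" and ZM: "independent_forms n Z' l M"
  shows "independent_forms n Z' (e + l) (N + M)"
proof -
  obtain f where f: "\<And>i. i < N \<Longrightarrow> homogeneous n (e + l) (f i)"
    "\<And>c. \<forall>p\<in>Z. vanishes (\<Sum>i<N. mp_const (c i) * f i) p \<Longrightarrow> \<forall>i<N. c i = 0"
    using ZN unfolding independent_forms_def by blast
  obtain g where g: "\<And>i. i < M \<Longrightarrow> homogeneous n l (g i)"
    "\<And>c. \<forall>p\<in>Z'. vanishes (\<Sum>i<M. mp_const (c i) * g i) p \<Longrightarrow> \<forall>i<M. c i = 0"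
    using ZM unfolding independent_forms_def by blast
  define F where "F = (\<lambda>i. if i < N then f i else h * g (i - N))"
  have "\<forall>i<N+M. homogeneous n (e + l) (F i)"
    using f(1) g(1) h(1) by (auto simp: F_def homogeneous_mult)
  moreover have "\<forall>i<N+M. c i = 0" if c: "\<forall>p\<in>Z'. vanishes (\<Sum>i<N+M. mp_const (c i) * F i) p" for c
  proof -
    define A where "A = (\<Sum>i<N. mp_const (c i) * f i)"
    define B where "B = (\<Sum>i<M. mp_const (c (N + i)) * g i)"
    have AB: "(\<Sum>i<N+M. mp_const (c i) * F i) = A + h * B"
      unfolding A_def B_def by (simp add: sum_lessThan_add F_def sum_distrib_left mult_ac)
    have "\<forall>p\<in>Z. vanishes A p"
      using c h(2) sub unfolding AB by (fastforce simp: vanishes_def)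
    then have c1: "\<forall>i<N. c i = 0" unfolding A_def by (rule f(2))
    then have "A = 0" by (simp add: A_def mp_const_def)
    then have hB: "\<forall>p\<in>Z'. vanishes (h * B) p" using c AB by simp
    have "homogeneous n l B" unfolding B_def by (rule homogeneous_combination) (use g in auto)
    then have "\<forall>p\<in>Z'. vanishes B p" using irreducible_closed_mult[OF Z' h(1) _ hB] h(3) by blast
    then have c2: "\<forall>i<M. c (N + i) = 0" unfolding B_def by (rule g(2))
    show ?thesis
    proof (intro allI impI)
      fix i assume "i < N + M"
      then show "c i = 0" using c1 c2[rule_format, of "i - N"] by (cases "i < N") auto
    qed
  qed
  ultimately show ?thesis unfolding independent_forms_def by blast
qed


text \<open>\<open>growth n Z r\<close> says that the Hilbert function of \<open>Z\<close> grows at least like $k^r$; this takes the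
  place of a lower bound on the dimension.\<close>

definition growth :: "nat \<Rightarrow> complex vec set set \<Rightarrow> nat \<Rightarrow> bool"
  where "growth n Z r \<longleftrightarrow> (\<exists>m\<ge>1. \<forall>k. independent_forms n Z (m * k) ((k + r) choose r))"

lemma nonzero_vec_coord:
  fixes v :: "complex vec"
  assumes "v \<in> carrier_vec N" "v \<noteq> 0\<^sub>v N" shows "\<exists>i<N. v $ i \<noteq> 0"
proof (rule ccontr)
  assume "\<not> ?thesis"
  then have "v = 0\<^sub>v N" using assms(1) by (intro eq_vecI) auto
  with assms(2) show False by simp
qed

lemma growth_0:
  assumes "p \<in> Z" "Z \<subseteq> proj_space n" shows "growth n Z 0"
proof -
  have p: "p \<in> proj_space n" using assms by auto
  then obtain v where v: "v \<in> p" using proj_space_nonempty by auto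
  note v' = proj_space_mem[OF p v]
  obtain i where i: "i \<le> n" "v $ i \<noteq> 0"
    using nonzero_vec_coord[OF v'(1,2)] by (auto simp: less_Suc_eq_le)
  have "independent_forms n Z k 1" for k
    unfolding independent_forms_def
  proof (intro exI[of _ "\<lambda>_. single (single i k) 1"] conjI allI impI)
    show "homogeneous n k (single (single i k) 1)"
      using i by (intro homogeneous_single) (auto simp: keys_single)
    fix c :: "nat \<Rightarrow> complex" and j :: nat
    assume "\<forall>p\<in>Z. vanishes (\<Sum>i'<1. mp_const (c i') * single (single i k) 1) p" "j < 1"
    then show "c j = 0" using assms(1) v i by (auto simp: vanishes_def)
  qed
  then show ?thesis unfolding growth_def by (intro exI[of _ 1]) simp
qed

lemma homogeneous_power: "homogeneous n k f \<Longrightarrow> homogeneous n (l * k) (f ^ l)"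
  by (induct l) (simp add: homogeneous_iff, simp add: homogeneous_mult)

lemma mp_eval_power [simp]: "mp_eval (f ^ l) v = mp_eval f v ^ l"
  by (induct l) auto

text \<open>Telescopes \<open>independent_forms_step\<close> with one form that vanishes on Z but
  not on Z'. Each step contributes a binomial coefficient with lower index r, and by Pascal's rule
  they add up to one with lower index r + 1.\<close>

lemma growth_Suc:
  assumes Z: "irreducible_closed n Z" and Z': "irreducible_closed n Z'" and sub: "Z \<subset> Z'"
    and g: "growth n Z r"
  shows "growth n Z' (r + 1)"
proof -
  obtain m where m: "m \<ge> 1" "\<And>k. independent_forms n Z (m * k) ((k + r) choose r)"
    using g unfolding growth_def by auto
  obtain p where p: "p \<in> Z'" "p \<notin> Z" using sub by auto
  have "p \<in> proj_space n" using p irreducible_closed_sub[OF Z'] by auto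
  then obtain e f where f: "homogeneous n e f" "\<forall>q\<in>Z. vanishes f q" "\<not> vanishes f p"
    using closedin_separate[of n Z p] Z p by (auto simp: irreducible_closed_def)
  obtain q where q: "q \<in> Z" using Z by (auto simp: irreducible_closed_def)
  obtain w where w: "w \<in> q" using proj_space_nonempty q irreducible_closed_sub[OF Z] by blast
  \<comment> \<open>A form of degree 0 is constant, and vanishing on the nonempty Z it would vanish
    at p too. Positive degree gives \<open>e * Suc k \<ge> Suc k\<close>, so that Z supplies enough
    forms in each step.\<close>
  have e: "e \<ge> 1"
  proof (rule ccontr)
    assume "\<not> e \<ge> 1"
    then have "e = 0" by simp
    have keys0: "m = 0" if "m \<in> keys f" for m
    proof -
      have "mdeg m = 0" using f(1) that \<open>e = 0\<close> by (auto simp: homogeneous_iff)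
      then show ?thesis by (auto simp: mdeg_def in_keys_iff intro!: poly_mapping_eqI)
    qed
    then have "mp_eval f v = mp_eval f w" for v
      unfolding mp_eval_mon by (intro sum.cong) (auto dest: keys0)
    then show False using f(2,3) q w by (auto simp: vanishes_def)
  qed
  \<comment> \<open>The hypothesis on Z concerns only degrees divisible by m; with the m-th power
    all degrees in the induction are of this kind.\<close>
  define h where "h = f ^ m"
  have h: "homogeneous n (m * e) h" "\<forall>q\<in>Z. vanishes h q" "\<not> (\<forall>p\<in>Z'. vanishes h p)"
    using f p m(1) by (auto simp: h_def homogeneous_power vanishes_def)
  have "independent_forms n Z' (m * e * k) ((k + (r + 1)) choose (r + 1))" for k
  proof (induct k)
    case 0
    have "growth n Z' 0" using p irreducible_closed_sub[OF Z'] by (intro growth_0) auto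
    then obtain m' where "\<And>k. independent_forms n Z' (m' * k) ((k + 0) choose 0)"
      unfolding growth_def by auto
    from this[of 0] show ?case by simp
  next
    case (Suc k)
    have "independent_forms n Z (m * e * Suc k) ((e * Suc k + r) choose r)"
      using m(2)[of "e * Suc k"] by (simp only: mult.assoc)
    moreover have "(Suc k + r) choose r \<le> (e * Suc k + r) choose r"
      using mult_le_mono1[OF e, of "Suc k"] by (intro binomial_right_mono) simp
    ultimately have "independent_forms n Z (m * e + m * e * k) ((Suc k + r) choose r)"
      by (auto intro: independent_forms_mono)
    from independent_forms_step[OF Z' _ h this Suc] sub
    have "independent_forms n Z' (m * e + m * e * k) (((Suc k + r) choose r) + ((k + (r + 1)) choose (r + 1)))"
      by auto
    then show ?case by (simp add: add.commute)
  qed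
  moreover have "m * e \<ge> 1" using m(1) e by simp
  ultimately show ?thesis unfolding growth_def by blast
qed

text \<open>A larger exponent would give more independent forms than there are monomials in n + 1
  variables.\<close>

lemma growth_le:
  assumes "growth n Z r" shows "r \<le> n"
proof (rule ccontr)
  assume "\<not> r \<le> n"
  then have r: "r \<ge> n + 1" by simp
  obtain m where m: "\<And>k. independent_forms n Z (m * k) ((k + r) choose r)"
    using assms unfolding growth_def by auto
  obtain k where k: "(m * k + n) choose n < (k + n + 1) choose (n + 1)"
    using binomial_growth_gap by blast
  have "(k + n + 1) choose (n + 1) = (k + (n + 1)) choose k"
    using binomial_symmetric[of "n+1" "k + (n+1)"] by (simp add: add.assoc)
  also have "\<dots> \<le> (k + r) choose k" using r by (intro binomial_right_mono) auto
  also have "\<dots> = (k + r) choose r" using binomial_symmetric[of k "k + r"] by simp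
  also have "\<dots> \<le> (m * k + n) choose n" by (rule independent_forms_le[OF m])
  finally show False using k by simp
qed

lemma growth_chain:
  assumes "\<forall>i\<le>k. irreducible_closed n (c i)" "\<forall>i<k. c i \<subset> c (Suc i)" "growth n (c 0) r"
  shows "r + k \<le> n"
proof -
  have "growth n (c i) (r + i)" if "i \<le> k" for i
    using that
  proof (induct i)
    case (Suc i)
    then have "growth n (c (Suc i)) (r + i + 1)"
      using assms by (intro growth_Suc[of n "c i"]) auto
    then show ?case by simp
  qed (use assms in simp)
  from growth_le[OF this[of k]] show ?thesis by simp
qed

text \<open>The monomials in the r + 1 chosen coordinates are themselves the independent forms.
  Geometrically, the projection of Z to these coordinates is dense.\<close>

lemma growth_of_independent_coordinates:
  assumes S: "S \<subseteq> {..n}" "card S = r + 1"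
    and ind: "\<And>k f. keys f \<subseteq> monomials S k \<Longrightarrow> \<forall>p\<in>Z. vanishes f p \<Longrightarrow> f = 0"
  shows "growth n Z r"
proof -
  have fin: "finite S" using S(1) finite_subset by blast
  have "independent_forms n Z k ((k + r) choose r)" for k
  proof -
    let ?N = "(k + r) choose r"
    obtain g where g: "bij_betw g {..<?N} (monomials S k)"
      using ex_bij_betw_nat_finite[OF finite_monomials[OF fin S(2)], of k] card_monomials[OF fin S(2), of k]
      by (auto simp: atLeast0LessThan)
    have gm: "g i \<in> monomials S k" if "i < ?N" for i using g that by (auto simp: bij_betw_def)
    show ?thesis unfolding independent_forms_def
    proof (intro exI[of _ "\<lambda>i. single (g i) 1"] conjI allI impI)
      fix i assume "i < ?N"
      then show "homogeneous n k (single (g i) 1)"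
        using gm[of i] S(1) by (intro homogeneous_single) (auto simp: monomials_def)
    next
      fix c :: "nat \<Rightarrow> complex" and i
      assume c: "\<forall>p\<in>Z. vanishes (\<Sum>i<?N. mp_const (c i) * single (g i) 1) p" and i: "i < ?N"
      define f where "f = (\<Sum>i<?N. single (g i) (c i))"
      have "(\<Sum>i<?N. mp_const (c i) * single (g i) 1) = f"
        by (simp add: f_def mp_const_def mult_single)
      moreover have "keys f \<subseteq> monomials S k"
        unfolding f_def using gm by (intro order_trans[OF Poly_Mapping.keys_sum]) auto
      ultimately have "f = 0" using c by (intro ind) auto
      then have "0 = lookup f (g i)" by simp
      also have "\<dots> = (\<Sum>j<?N. if j = i then c j else 0)"
        unfolding f_def lookup_sum
        by (rule sum.cong) (use g i in \<open>auto simp: lookup_single when_def bij_betw_def dest: inj_onD\<close>)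
      finally show "c i = 0" using i by simp
    qed
  qed
  then show ?thesis unfolding growth_def by (intro exI[of _ 1]) simp
qed

text \<open>There are n + 2 forms in n + 1 variables. For suitable k the monomials of degree k in n
  + 2 variables outnumber those of degree k D in n + 1 variables, so the substituted monomials
  satisfy a linear relation, and its coefficients are those of P.\<close>

lemma forms_algebraically_dependent:
  assumes F: "\<And>i. i \<le> n + 1 \<Longrightarrow> form_fun n D (F i)"
  shows "\<exists>k P. homogeneous (n+1) k P \<and> P \<noteq> 0 \<and>
    (\<forall>v\<in>carrier_vec (n+1). mp_eval P (vec (n+2) (\<lambda>i. F i v)) = 0)"
proof -
  obtain k where k: "(D * k + n) choose n < (k + n + 1) choose (n + 1)"
    using binomial_growth_gap by blast
  let ?I = "monomials {..n+1} k" and ?E = "monomials {..n} (k * D)"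
  have finI: "finite ?I" using finite_monomials[OF finite_card_atMost, of "n+1"] by simp
  have lt: "card ?E < card ?I"
    using k card_monomials[OF finite_card_atMost, of n] card_monomials[OF finite_card_atMost, of "n+1"]
    by (simp add: mult.commute add.assoc)
  have "\<exists>f. homogeneous n (k * D) f \<and> (\<forall>v\<in>carrier_vec (n+1). mp_eval f v = mono_eval m (vec (n+2) (\<lambda>i. F i v)))"
    if m: "m \<in> ?I" for m
  proof -
    have "homogeneous (n+1) k (single m 1)"
      using m by (intro homogeneous_single) (auto simp: monomials_def)
    from form_fun_compose[OF this F] show ?thesis by (simp add: form_fun_def)
  qed
  then obtain f where f: "\<And>m. m \<in> ?I \<Longrightarrow> homogeneous n (k * D) (f m)"
    "\<And>m v. m \<in> ?I \<Longrightarrow> v \<in> carrier_vec (n+1) \<Longrightarrow> mp_eval (f m) v = mono_eval m (vec (n+2) (\<lambda>i. F i v))"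
    by metis
  obtain c where c: "\<exists>m\<in>?I. c m \<noteq> 0" "\<forall>e\<in>?E. (\<Sum>m\<in>?I. c m * lookup (f m) e) = 0"
    using underdetermined_system[OF finite_monomials[OF finite_card_atMost] finI lt, of "\<lambda>m. lookup (f m)"]
    by auto
  have "(\<Sum>m\<in>?I. c m * lookup (f m) e) = 0" for e
  proof (cases "e \<in> ?E")
    case False
    then have "\<forall>m\<in>?I. e \<notin> keys (f m)"
      using f(1) unfolding homogeneous_keys by blast
    then show ?thesis by (simp add: in_keys_iff)
  qed (use c in auto)
  then have rel: "(\<Sum>m\<in>?I. mp_const (c m) * f m) = 0" using finI by (simp add: single_family_sum)
  define P where "P = (\<Sum>m\<in>?I. single m (c m))"
  have lookupP: "lookup P m = (if m \<in> ?I then c m else 0)" for m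
    using finI by (simp add: P_def lookup_sum lookup_single when_def)
  have "P \<noteq> 0" using c(1) lookupP by (metis lookup_zero)
  moreover have "homogeneous (n+1) k P"
    unfolding P_def by (intro homogeneous_sum homogeneous_single) (auto simp: monomials_def)
  moreover have "mp_eval P (vec (n+2) (\<lambda>i. F i v)) = 0" if v: "v \<in> carrier_vec (n+1)" for v
  proof -
    have "mp_eval P (vec (n+2) (\<lambda>i. F i v)) = mp_eval (\<Sum>m\<in>?I. mp_const (c m) * f m) v"
      unfolding P_def using v by (simp add: f(2))
    then show ?thesis by (simp only: rel mp_eval_0)
  qed
  ultimately show ?thesis by blast
qed

section \<open>The Jacobian criterion\<close>

lemma mp_eval_cong:
  assumes "homogeneous n k f" "\<And>i. i \<le> n \<Longrightarrow> v $ i = w $ i"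
  shows "mp_eval f v = mp_eval f w"
  unfolding mp_eval_mon mono_eval_def
  by (intro sum.cong arg_cong2[of _ _ _ _ "(*)"] prod.cong refl)
     (use assms in \<open>force simp: homogeneous_iff\<close>)

text \<open>The alternatives arise from a relation of least degree: its $y$-derivative has smaller degree, so it
  is either identically zero as a polynomial or not a relation.\<close>

lemma separable_relation:
  assumes "homogeneous (n+1) k P" "P \<noteq> 0" "\<forall>v\<in>V. mp_eval P (vec (n+2) (\<lambda>i. if i \<le> n then F i v else y v)) = 0"
  shows "(\<exists>l G. homogeneous n l G \<and> G \<noteq> 0 \<and> (\<forall>v\<in>V. mp_eval G (vec (n+1) (\<lambda>i. F i v)) = 0)) \<or>
    (\<exists>l Q. homogeneous (n+1) l Q \<and> (\<forall>v\<in>V. mp_eval Q (vec (n+2) (\<lambda>i. if i \<le> n then F i v else y v)) = 0) \<and>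
       (\<exists>v\<in>V. mp_eval (mp_partial (n+1) Q) (vec (n+2) (\<lambda>i. if i \<le> n then F i v else y v)) \<noteq> 0))"
  using assms
proof (induct k arbitrary: P rule: less_induct)
  case (less k)
  let ?d = "mp_partial (n+1) P" and ?E = "\<lambda>v. vec (n+2) (\<lambda>i. if i \<le> n then F i v else y v)"
  consider (a) "\<exists>v\<in>V. mp_eval ?d (?E v) \<noteq> 0" | (b) "\<forall>v\<in>V. mp_eval ?d (?E v) = 0" "?d \<noteq> 0" | (c) "?d = 0"
    by blast
  then show ?case
  proof cases
    case a
    then show ?thesis using less.prems by blast
  next
    case b
    then obtain m where "lookup ?d m \<noteq> 0" by (metis lookup_zero poly_mapping_eqI)
    then have "m + single (n+1) 1 \<in> keys P"
      by (simp add: lookup_partial in_keys_iff)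
    then have "k = mdeg (m + single (n+1) 1)" using less.prems(1) by (simp add: homogeneous_iff)
    then have "k - 1 < k" by (simp add: mdeg_add)
    then show ?thesis using less.hyps[of "k - 1" ?d] homogeneous_partial[OF less.prems(1)] b by blast
  next
    case c
    \<comment> \<open>In characteristic 0 a vanishing y-derivative means that y does not occur, so P
      is a relation among the F i alone.\<close>
    have no: "lookup m (n+1) = 0" if m: "m \<in> keys P" for m
    proof (rule ccontr)
      assume *: "lookup m (n+1) \<noteq> 0"
      have "lookup ?d (m - single (n+1) 1) \<noteq> 0"
        using m by (simp only: lookup_partial minus_single_add[OF *])
          (simp only: in_keys_iff mult_eq_0_iff of_nat_eq_0_iff, simp)
      then show False using c by simp
    qed
    have "homogeneous n k P" unfolding homogeneous_iff
    proof (intro ballI conjI subsetI)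
      fix m i assume m: "m \<in> keys P" "i \<in> keys m"
      then have "i \<le> n + 1" using less.prems(1) by (auto simp: homogeneous_iff)
      moreover have "i \<noteq> n + 1" using no[OF m(1)] m(2) by (auto simp: in_keys_iff)
      ultimately show "i \<in> {..n}" by simp
    qed (use less.prems(1) in \<open>auto simp: homogeneous_iff\<close>)
    moreover have "mp_eval P (vec (n+1) (\<lambda>i. F i v)) = mp_eval P (?E v)" for v
      by (rule mp_eval_cong[OF \<open>homogeneous n k P\<close>]) simp
    ultimately show ?thesis using less.prems by metis
  qed
qed

text \<open>If the F i were independent, each power x_j^D would be algebraic over them, by a
  relation whose derivative in the last variable is not identically zero. Differentiating this
  relation at a generic point along the kernel direction w leaves only the last term, a nonzero
  multiple of w_j; so all w_j would vanish. The D-th power gives the additional form the same degree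
  as the F i.\<close>

lemma deficient_forms_dependent:
  assumes D: "D \<ge> 1" and F: "\<And>i. i \<le> n \<Longrightarrow> form_fun n D (F i)"
    and ker: "\<And>v. v \<in> carrier_vec (n+1) \<Longrightarrow> \<exists>w\<in>carrier_vec (n+1). w \<noteq> 0\<^sub>v (n+1) \<and>
      (\<forall>i\<le>n. ((\<lambda>s. F i (v + s \<cdot>\<^sub>v w)) has_field_derivative 0) (at 0))"
  shows "\<exists>k G. homogeneous n k G \<and> G \<noteq> 0 \<and>
    (\<forall>v\<in>carrier_vec (n+1). mp_eval G (vec (n+1) (\<lambda>i. F i v)) = 0)"
proof (rule ccontr)
  assume no: "\<not> ?thesis"
  let ?V = "carrier_vec (n+1) :: complex vec set"
  let ?E = "\<lambda>j v. vec (n+2) (\<lambda>i. if i \<le> n then F i v else (v $ j) ^ D)"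
  define R where "R = (\<lambda>j l Q. homogeneous (n+1) l Q \<and> (\<forall>v\<in>?V. mp_eval Q (?E j v) = 0) \<and>
       (\<exists>v\<in>?V. mp_eval (mp_partial (n+1) Q) (?E j v) \<noteq> 0))"
  have ex: "\<exists>l Q. R j l Q" if j: "j \<le> n" for j
  proof -
    have y: "form_fun n D (\<lambda>v. (v $ j) ^ D)"
      using form_fun_power[OF form_fun_coord[OF j], of D] by simp
    have "form_fun n D (\<lambda>v. if i \<le> n then F i v else (v $ j) ^ D)" if "i \<le> n + 1" for i
      using F[of i] y by (cases "i \<le> n") auto
    from forms_algebraically_dependent[of n D "\<lambda>i v. if i \<le> n then F i v else (v $ j) ^ D", OF this] obtain k P where
      "homogeneous (n+1) k P" "P \<noteq> 0" "\<forall>v\<in>?V. mp_eval P (?E j v) = 0" by blast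
    from separable_relation[OF this] show ?thesis using no unfolding R_def by blast
  qed
  define l where "l = (\<lambda>j. SOME l. \<exists>Q. R j l Q)"
  define Q where "Q = (\<lambda>j. SOME Q. R j (l j) Q)"
  have "R j (l j) (Q j)" if "j \<le> n" for j
    unfolding Q_def l_def by (rule someI_ex, rule someI_ex, rule ex[OF that])
  then have Q: "\<And>j. j \<le> n \<Longrightarrow> homogeneous (n+1) (l j) (Q j)"
    "\<And>j v. j \<le> n \<Longrightarrow> v \<in> ?V \<Longrightarrow> mp_eval (Q j) (?E j v) = 0"
    "\<And>j. j \<le> n \<Longrightarrow> \<exists>v\<in>?V. mp_eval (mp_partial (n+1) (Q j)) (?E j v) \<noteq> 0"
    unfolding R_def by blast+
  \<comment> \<open>Indices up to n carry the derivatives of the n + 1 relations, those from n + 1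
    to 2n + 1 the coordinates. Where all are nonzero, w_j is the only factor of the final derivative
    that could vanish.\<close>
  define \<phi> where "\<phi> = (\<lambda>k v. if k \<le> n then mp_eval (mp_partial (n+1) (Q k)) (?E k v) else v $ (k - (n+1)))"
  have "\<exists>a\<in>?V. \<forall>k\<in>{..2*n+1}. \<phi> k a \<noteq> 0"
  proof (rule common_nonzero)
    fix k assume k: "k \<in> {..2*n+1}"
    show "poly_on_lines (n+1) (\<phi> k)"
    proof (cases "k \<le> n")
      case True
      have "poly_on_lines (n+1) (\<lambda>v. if i \<le> n then F i v else (v $ k) ^ D)" for i
        using poly_on_lines_form_fun[OF F[of i]] True
        by (cases "i \<le> n") (auto intro!: poly_on_lines_power poly_on_lines_coord)
      then have "poly_on_lines (n+1) (\<lambda>v. mp_eval (mp_partial (n+1) (Q k)) (vec (n+1+1) (\<lambda>i. if i \<le> n then F i v else (v $ k) ^ D)))"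
        by (intro poly_on_lines_compose[OF homogeneous_partial[OF Q(1)[OF True]]])
      then show ?thesis using True by (simp add: \<phi>_def)
    next
      case False
      then show ?thesis using k by (auto simp: \<phi>_def intro!: poly_on_lines_coord)
    qed
    show "\<exists>a\<in>?V. \<phi> k a \<noteq> 0"
    proof (cases "k \<le> n")
      case True
      then show ?thesis using Q(3)[OF True] by (simp add: \<phi>_def)
    next
      case False
      then show ?thesis using k by (intro bexI[of _ "vec (n+1) (\<lambda>_. 1)"]) (auto simp: \<phi>_def)
    qed
  qed simp
  then obtain a where a: "a \<in> ?V" "\<And>k. k \<le> 2*n+1 \<Longrightarrow> \<phi> k a \<noteq> 0" by auto
  obtain w where w: "w \<in> ?V" "w \<noteq> 0\<^sub>v (n+1)"
    "\<And>i. i \<le> n \<Longrightarrow> ((\<lambda>s. F i (a + s \<cdot>\<^sub>v w)) has_field_derivative 0) (at 0)"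
    using ker[OF a(1)] by blast
  obtain j where j: "j < n + 1" "w $ j \<noteq> 0" using nonzero_vec_coord[OF w(1,2)] by auto
  then have jn: "j \<le> n" by simp
  have aj: "a $ j \<noteq> 0" using a(2)[of "j + (n+1)"] jn by (simp add: \<phi>_def)
  have \<phi>j: "mp_eval (mp_partial (n+1) (Q j)) (?E j a) \<noteq> 0" using a(2)[of j] jn by (simp add: \<phi>_def)
  have a0: "a + 0 \<cdot>\<^sub>v w = a" using a(1) w(1) by auto
  let ?F' = "\<lambda>i. if i \<le> n then 0 else of_nat D * (a $ j) ^ (D - 1) * w $ j"
  have der: "((\<lambda>s. mp_eval (Q j) (?E j (a + s \<cdot>\<^sub>v w))) has_field_derivative
     (\<Sum>i\<le>n+1. mp_eval (mp_partial i (Q j)) (?E j (a + 0 \<cdot>\<^sub>v w)) * ?F' i)) (at 0)"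
  proof (rule mp_eval_chain_rule[OF Q(1)[OF jn]])
    fix i assume i: "i \<le> n + 1"
    show "((\<lambda>s. ?E j (a + s \<cdot>\<^sub>v w) $ i) has_field_derivative ?F' i) (at 0)"
    proof (cases "i \<le> n")
      case True
      then show ?thesis using w(3)[OF True] by simp
    next
      case False
      have "((\<lambda>s. (a $ j + s * w $ j) ^ D) has_field_derivative of_nat D * (a $ j) ^ (D - 1) * w $ j) (at 0)"
        by (auto intro!: derivative_eq_intros)
      then show ?thesis using False i a(1) w(1) jn by simp
    qed
  qed
  have zero: "(\<lambda>s. mp_eval (Q j) (?E j (a + s \<cdot>\<^sub>v w))) = (\<lambda>_. 0)"
    using Q(2)[OF jn] a(1) w(1) by auto
  have "(\<Sum>i\<le>n+1. mp_eval (mp_partial i (Q j)) (?E j (a + 0 \<cdot>\<^sub>v w)) * ?F' i) = 0"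
    by (rule DERIV_unique[OF der[unfolded zero] DERIV_const])
  then have "mp_eval (mp_partial (n+1) (Q j)) (?E j a) * (of_nat D * (a $ j) ^ (D - 1) * w $ j) = 0"
    unfolding a0 by simp
  then show False using \<phi>j aj j D by simp
qed

section \<open>Linear algebra\<close>

lemma annihilator_separates:
  fixes V :: "(nat \<Rightarrow> complex) set"
  assumes "finite I"
    and "(\<lambda>_. 0) \<in> V"
    and "\<And>v w. v \<in> V \<Longrightarrow> w \<in> V \<Longrightarrow> (\<lambda>i. v i + w i) \<in> V"
    and "\<And>v c. v \<in> V \<Longrightarrow> (\<lambda>i. c * v i) \<in> V"
    and "\<And>v i. v \<in> V \<Longrightarrow> i \<notin> I \<Longrightarrow> v i = 0"
    and "\<And>i. i \<notin> I \<Longrightarrow> h i = 0" and "h \<notin> V"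
  shows "\<exists>y. (\<forall>v\<in>V. (\<Sum>i\<in>I. y i * v i) = 0) \<and> (\<Sum>i\<in>I. y i * h i) \<noteq> 0"
  using assms
proof (induct I arbitrary: V h rule: finite_induct)
  case empty
  then have "h = (\<lambda>_. 0)" by auto
  then show ?case using empty by simp
next
  case (insert j I)
  note add = insert.prems(2) and scale = insert.prems(3)
  show ?case
  proof (cases "\<forall>v\<in>V. v j = 0")
    case True
    show ?thesis
    proof (cases "h j = 0")
      case False
      have "(\<Sum>i\<in>insert j I. (if i = j then 1 else 0) * v i) = v j" for v :: "nat \<Rightarrow> complex"
        using insert.hyps by (simp add: if_distrib[of "\<lambda>x. x * _"] cong: if_cong)
      then show ?thesis using True False by (intro exI[of _ "\<lambda>i. if i = j then 1 else 0"]) auto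
    next
      case h: True
      have "v i = 0" if "v \<in> V" "i \<notin> I" for v i
        using that True insert.prems(4)[of v i] by (cases "i = j") auto
      moreover have "h i = 0" if "i \<notin> I" for i
        using that h insert.prems(5)[of i] by (cases "i = j") auto
      ultimately obtain y where "\<forall>v\<in>V. (\<Sum>i\<in>I. y i * v i) = 0" "(\<Sum>i\<in>I. y i * h i) \<noteq> 0"
        using insert.hyps(3)[of V h] insert.prems by auto
      then show ?thesis using True h insert.hyps by (intro exI[of _ y]) simp
    qed
  next
    case False
    then obtain u where u: "u \<in> V" "u j \<noteq> 0" by auto
    define r where "r = (\<lambda>v i. v i - v j / u j * u i)"
    have rV: "r v \<in> V" if "v \<in> V" for v
      using add[OF that scale[OF u(1), of "- (v j / u j)"]] by (simp add: r_def)
    have r0: "r v j = 0" for v using u(2) by (simp add: r_def)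
    define W where "W = {v \<in> V. v j = 0}"
    have "r h \<notin> W"
    proof
      assume "r h \<in> W"
      then have "r h \<in> V" by (simp add: W_def)
      then have "(\<lambda>i. r h i + h j / u j * u i) \<in> V" using add scale[OF u(1)] by blast
      then show False using insert.prems(6) by (simp add: r_def)
    qed
    moreover have "v i = 0" if "v \<in> W" "i \<notin> I" for v i
      using that insert.prems(4)[of v i] by (cases "i = j") (auto simp: W_def)
    moreover have "r h i = 0" if "i \<notin> I" for i
      using that r0[of h] insert.prems(5)[of i] insert.prems(4)[OF u(1), of i] by (cases "i = j") (auto simp: r_def)
    moreover have "(\<lambda>_. 0) \<in> W" "\<And>v w. v \<in> W \<Longrightarrow> w \<in> W \<Longrightarrow> (\<lambda>i. v i + w i) \<in> W"
      "\<And>v c. v \<in> W \<Longrightarrow> (\<lambda>i. c * v i) \<in> W"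
      using insert.prems(1) add scale by (auto simp: W_def)
    ultimately obtain y where y: "\<forall>v\<in>W. (\<Sum>i\<in>I. y i * v i) = 0" "(\<Sum>i\<in>I. y i * r h i) \<noteq> 0"
      using insert.hyps(3)[of W "r h"] by blast
    \<comment> \<open>The entry at j is chosen so that y' annihilates u; then y' has the same value
      on v as y has on the cleared vector \<open>r v\<close>.\<close>
    define y' where "y' = y(j := - (\<Sum>i\<in>I. y i * u i) / u j)"
    have eq: "(\<Sum>i\<in>insert j I. y' i * v i) = (\<Sum>i\<in>I. y i * r v i)" for v
    proof -
      define c where "c = v j / u j"
      have "(\<Sum>i\<in>I. y' i * v i) = (\<Sum>i\<in>I. y i * v i)"
        by (rule sum.cong) (use insert.hyps in \<open>auto simp: y'_def\<close>)
      then have "(\<Sum>i\<in>insert j I. y' i * v i) = (\<Sum>i\<in>I. y i * v i) - (\<Sum>i\<in>I. y i * u i) * c"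
        using insert.hyps by (simp add: y'_def c_def)
      also have "\<dots> = (\<Sum>i\<in>I. y i * r v i)"
        unfolding r_def c_def[symmetric]
        by (simp add: right_diff_distrib sum_subtractf sum_distrib_left mult_ac)
      finally show ?thesis .
    qed
    have "r v \<in> W" if "v \<in> V" for v using rV[OF that] r0 by (simp add: W_def)
    then show ?thesis using y by (intro exI[of _ y']) (auto simp: eq)
  qed
qed

lemma annihilator_separates_vec:
  fixes V :: "complex vec set"
  assumes V: "V \<subseteq> carrier_vec m" "0\<^sub>v m \<in> V" "\<And>v w. v \<in> V \<Longrightarrow> w \<in> V \<Longrightarrow> v + w \<in> V"
    "\<And>v c. v \<in> V \<Longrightarrow> c \<cdot>\<^sub>v v \<in> V"
    and h: "h \<in> carrier_vec m" "h \<notin> V"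
  shows "\<exists>y\<in>carrier_vec m. (\<forall>v\<in>V. (\<Sum>i<m. y $ i * v $ i) = 0) \<and> (\<Sum>i<m. y $ i * h $ i) \<noteq> 0"
proof -
  define e where "e = (\<lambda>v i. if i < m then (v::complex vec) $ i else 0)"
  have vec_e: "v \<in> carrier_vec m \<Longrightarrow> vec m (e v) = v" for v by (auto simp: e_def)
  have e_inj: "e v = e w \<Longrightarrow> v \<in> carrier_vec m \<Longrightarrow> w \<in> carrier_vec m \<Longrightarrow> v = w" for v w
    using vec_e by metis
  have "\<exists>y. (\<forall>v\<in>e ` V. (\<Sum>i\<in>{..<m}. y i * v i) = 0) \<and> (\<Sum>i\<in>{..<m}. y i * e h i) \<noteq> 0"
  proof (rule annihilator_separates)
    show "(\<lambda>_. 0) \<in> e ` V" using V(2) by (intro image_eqI[of _ _ "0\<^sub>v m"]) (auto simp: e_def)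
    show "(\<lambda>i. v i + w i) \<in> e ` V" if vw: "v \<in> e ` V" "w \<in> e ` V" for v w
    proof -
      obtain a b where "a \<in> V" "b \<in> V" "v = e a" "w = e b" using vw by auto
      moreover from this have "a \<in> carrier_vec m" "b \<in> carrier_vec m" using V(1) by auto
      then have "(\<lambda>i. e a i + e b i) = e (a + b)" by (auto simp: e_def fun_eq_iff)
      ultimately show ?thesis using V(3) by auto
    qed
    show "(\<lambda>i. c * v i) \<in> e ` V" if v: "v \<in> e ` V" for v c
    proof -
      obtain a where "a \<in> V" "v = e a" using v by auto
      moreover from this have "a \<in> carrier_vec m" using V(1) by auto
      then have "(\<lambda>i. c * e a i) = e (c \<cdot>\<^sub>v a)" by (auto simp: e_def fun_eq_iff)
      ultimately show ?thesis using V(4) by auto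
    qed
    show "e h \<notin> e ` V" using e_inj h V(1) by blast
  qed (auto simp: e_def)
  then obtain y where y: "\<forall>v\<in>V. (\<Sum>i<m. y i * v $ i) = 0" "(\<Sum>i<m. y i * h $ i) \<noteq> 0"
    by (auto simp: e_def)
  then show ?thesis by (intro bexI[of _ "vec m y"]) auto
qed

lemma mult_mat_vec_index:
  assumes "M \<in> carrier_mat m k" "v \<in> carrier_vec k" "i < m"
  shows "(M *\<^sub>v v) $ i = (\<Sum>j<k. M $$ (i, j) * v $ j)"
  using assms by (auto simp: scalar_prod_def atLeast0LessThan intro!: sum.cong)

lemma mat_mult_unit_vec:
  assumes "(M :: complex mat) \<in> carrier_mat m k" "i < k" shows "M *\<^sub>v unit_vec k i = col M i"
  by (rule eq_vecI) (use assms in \<open>auto simp: scalar_prod_right_unit\<close>)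

lemma injective_mat_indpt:
  assumes M: "(M :: complex mat) \<in> carrier_mat m k"
    and inj: "\<And>v. v \<in> carrier_vec k \<Longrightarrow> M *\<^sub>v v = 0\<^sub>v m \<Longrightarrow> v = 0\<^sub>v k"
  shows "distinct (cols M)" "\<not> module.lin_dep class_ring (Cvec m) (set (cols M))" "vec_space.rank m M = k"
proof -
  interpret vec_space "TYPE(complex)" m .
  show d: "distinct (cols M)"
  proof (rule ccontr)
    assume "\<not> distinct (cols M)"
    then obtain i j where ij: "i < k" "j < k" "i \<noteq> j" "col M i = col M j"
      using M by (auto simp: distinct_conv_nth)
    have "M *\<^sub>v (unit_vec k i - unit_vec k j) = M *\<^sub>v unit_vec k i - M *\<^sub>v unit_vec k j"
      using M by (intro mult_minus_distrib_mat_vec) auto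
    also have "\<dots> = 0\<^sub>v m" using mat_mult_unit_vec[OF M ij(1)] mat_mult_unit_vec[OF M ij(2)] ij M by auto
    finally have "unit_vec k i - unit_vec k j = (0\<^sub>v k :: complex vec)" by (intro inj) auto
    then have "(unit_vec k i - unit_vec k j) $ i = (0 :: complex)" using ij by simp
    then show False using ij by simp
  qed
  show i: "lin_indpt (set (cols M))"
    using lin_depE[OF M _ d] inj by metis
  show "rank M = k" by (rule lin_indpt_full_rank[OF M d i])
qed

text \<open>A maximal independent set of columns has k elements, so it consists of all the columns
  and these are distinct.\<close>

lemma full_rank_injective:
  assumes M: "(M :: complex mat) \<in> carrier_mat m k" and r: "vec_space.rank m M = k"
    and v: "v \<in> carrier_vec k" "M *\<^sub>v v = 0\<^sub>v m"
  shows "v = 0\<^sub>v k"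
proof (rule ccontr)
  interpret vec_space "TYPE(complex)" m .
  assume nz: "v \<noteq> 0\<^sub>v k"
  obtain S where S: "finite S" "maximal S (\<lambda>T. T \<subseteq> set (cols M) \<and> lin_indpt T)"
    using maximal_exists_superset[of "set (cols M)" "\<lambda>T. T \<subseteq> set (cols M) \<and> lin_indpt T" "{}"]
      unfolding lin_dep_def by auto
  have cS: "card S = k" using rank_card_indpt[OF M S(2)] r by simp
  have sub: "S \<subseteq> set (cols M)" and ind: "lin_indpt S" using S(2) by (auto simp: maximal_def)
  have "card (set (cols M)) \<le> k" using card_length[of "cols M"] M by simp
  then have eq: "S = set (cols M)" using sub cS by (intro card_seteq) auto
  have "distinct (cols M)" using cS eq M by (intro card_distinct) simp
  from lin_depI[OF M v(1) nz v(2) this] show False using ind eq by simp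
qed

lemma lin_dim_image:
  assumes M: "(M :: complex mat) \<in> carrier_mat m k"
  shows "lin_dim m {M *\<^sub>v v | v. v \<in> carrier_vec k} = vec_space.rank m M"
proof -
  interpret vec_space "TYPE(complex)" m .
  have "{M *\<^sub>v v | v. v \<in> carrier_vec k} = span (set (cols M))"
    using col_space_eq[OF M] M unfolding col_space_def by auto
  then show ?thesis unfolding lin_dim_def rank_def by simp
qed

text \<open>A point determines its representatives up to nonzero scalars, and both sets are closed
  under scalars. This identifies the row space of A with the linear space that defines L.\<close>

lemma projectivization_inject:
  assumes W: "W \<subseteq> carrier_vec (n+1)" "0\<^sub>v (n+1) \<in> W" "\<And>c v. v \<in> W \<Longrightarrow> c \<cdot>\<^sub>v v \<in> W"
    and W': "W' \<subseteq> carrier_vec (n+1)" "0\<^sub>v (n+1) \<in> W'" "\<And>c v. v \<in> W' \<Longrightarrow> c \<cdot>\<^sub>v v \<in> W'"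
    and eq: "projectivization n W = projectivization n W'"
  shows "W = W'"
proof -
  have "A \<subseteq> B" if B: "0\<^sub>v (n+1) \<in> B" "\<And>c v. v \<in> B \<Longrightarrow> c \<cdot>\<^sub>v v \<in> B"
    and AB: "projectivization n A = projectivization n B" for A B :: "complex vec set"
  proof
    fix v assume v: "v \<in> A"
    show "v \<in> B"
    proof (cases "v = 0\<^sub>v (n+1)")
      case False
      then have "proj_pt v \<in> projectivization n B" using v AB unfolding projectivization_def by blast
      then obtain w where "w \<in> B" "proj_pt v = proj_pt w" unfolding projectivization_def by blast
      then have "v \<in> proj_pt w" using proj_ptI by blast
      then show ?thesis using B(2) \<open>w \<in> B\<close> by (auto simp: proj_pt_def)
    qed (use B in simp)
  qed
  from this[OF W'(2,3) eq] this[OF W(2,3) eq[symmetric]] show ?thesis by blast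
qed

text \<open>The basis property is formulated inside the kernel; span and linear dependence there
  agree with those of the ambient space (\<open>span_same\<close>, \<open>lindep_same\<close>),
  where they become statements about the matrix B.\<close>

lemma kernel_basis_facts:
  assumes A: "A \<in> carrier_mat m k" and B: "B \<in> carrier_mat k l" and b: "columns_form_kernel_basis A B"
  shows "\<And>u. u \<in> carrier_vec l \<Longrightarrow> A *\<^sub>v (B *\<^sub>v u) = 0\<^sub>v m"
    and "\<And>w. w \<in> carrier_vec k \<Longrightarrow> A *\<^sub>v w = 0\<^sub>v m \<Longrightarrow> \<exists>u\<in>carrier_vec l. w = B *\<^sub>v u"
    and "\<And>u. u \<in> carrier_vec l \<Longrightarrow> B *\<^sub>v u = 0\<^sub>v k \<Longrightarrow> u = 0\<^sub>v l"
proof -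
  interpret kernel m k A by unfold_locales (rule A)
  have bas: "basis (set (cols B))" and d: "distinct (cols B)"
    using b A unfolding columns_form_kernel_basis_def by auto
  then have sub: "set (cols B) \<subseteq> mat_kernel A" and li: "lin_indpt (set (cols B))"
    and gen: "span (set (cols B)) = mat_kernel A" by (auto simp: Ker.basis_def)
  have "NC.span (set (cols B)) = mat_kernel A" using span_same[OF sub] gen by simp
  then have col: "{y \<in> carrier_vec k. \<exists>x\<in>carrier_vec l. B *\<^sub>v x = y} = mat_kernel A"
    using NC.col_space_eq[OF B] B unfolding NC.col_space_def by simp
  show "A *\<^sub>v (B *\<^sub>v u) = 0\<^sub>v m" if "u \<in> carrier_vec l" for u
  proof -
    have "B *\<^sub>v u \<in> {y \<in> carrier_vec k. \<exists>x\<in>carrier_vec l. B *\<^sub>v x = y}" using that B by auto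
    then have "B *\<^sub>v u \<in> mat_kernel A" by (simp only: col)
    then show ?thesis using mat_kernelD(2)[OF A] by simp
  qed
  show "\<exists>u\<in>carrier_vec l. w = B *\<^sub>v u" if "w \<in> carrier_vec k" "A *\<^sub>v w = 0\<^sub>v m" for w
  proof -
    have "w \<in> mat_kernel A" using mat_kernelI[OF A that] .
    then have "w \<in> {y \<in> carrier_vec k. \<exists>x\<in>carrier_vec l. B *\<^sub>v x = y}" using col by simp
    then show ?thesis by auto
  qed
  show "u = 0\<^sub>v l" if "u \<in> carrier_vec l" "B *\<^sub>v u = 0\<^sub>v k" for u
  proof (rule ccontr)
    assume "u \<noteq> 0\<^sub>v l"
    from NC.lin_depI[OF B that(1) this that(2) d] lindep_same[OF sub] li show False by simp
  qed
qed

section \<open>Minors of order n and rank\<close>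

lemma insert_index_image: assumes "l \<le> n" shows "insert_index l ` {..<n} = {..n} - {l}"
proof
  show "insert_index l ` {..<n} \<subseteq> {..n} - {l}" by (auto simp: insert_index_def)
  show "{..n} - {l} \<subseteq> insert_index l ` {..<n}"
  proof
    fix x assume x: "x \<in> {..n} - {l}"
    then have "x = insert_index l (if x < l then x else x - 1)" "(if x < l then x else x - 1) < n"
      using assms by (auto simp: insert_index_def)
    then show "x \<in> insert_index l ` {..<n}" by blast
  qed
qed

lemma inj_insert_index: "inj (insert_index l)"
  by (auto simp: inj_def insert_index_def split: if_splits)

lemma sum_insert_index:
  fixes f :: "nat \<Rightarrow> 'a::comm_monoid_add"
  assumes "l \<le> n" shows "(\<Sum>i\<in>{..n} - {l}. f i) = (\<Sum>i<n. f (insert_index l i))"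
  unfolding insert_index_image[OF assms, symmetric]
  by (subst sum.reindex) (auto intro: inj_on_subset[OF inj_insert_index])

text \<open>With column c left out, the n + 1 rows satisfy a linear relation y. A row l with y_l
  nonzero is a combination of the others, so a vector killed by the other rows is killed by row l as
  well, and deleting row l keeps the matrix injective.\<close>

lemma det_mat_delete_nonzero:
  assumes M: "(M :: complex mat) \<in> carrier_mat (n+1) (n+1)" and c: "c \<le> n"
    and inj: "\<And>w. w \<in> carrier_vec (n+1) \<Longrightarrow> M *\<^sub>v w = 0\<^sub>v (n+1) \<Longrightarrow> w $ c = 0 \<Longrightarrow> w = 0\<^sub>v (n+1)"
  shows "\<exists>l\<le>n. det (mat_delete M l c) \<noteq> 0"
proof -
  obtain y where y: "\<exists>i\<in>{..n}. y i \<noteq> 0" "\<forall>j\<in>{..n} - {c}. (\<Sum>i\<in>{..n}. y i * M $$ (i, j)) = 0"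
    using underdetermined_system[of "{..n} - {c}" "{..n}" "\<lambda>i j. M $$ (i, j)"] c by auto
  then obtain l where l: "l \<le> n" "y l \<noteq> 0" by auto
  have D: "mat_delete M l c \<in> carrier_mat n n" using mat_delete_carrier[OF M, of l c] by simp
  have "z = 0\<^sub>v n" if z: "z \<in> carrier_vec n" "mat_delete M l c *\<^sub>v z = 0\<^sub>v n" for z
  proof -
    define w where "w = vec (n+1) (\<lambda>j. if j < c then z $ j else if j = c then 0 else z $ (j - 1))"
    have w: "w \<in> carrier_vec (n+1)" "w $ c = 0" using c by (auto simp: w_def)
    have wz: "w $ insert_index c j = z $ j" if "j < n" for j
      using that c by (auto simp: w_def insert_index_def)
    have Mw: "(M *\<^sub>v w) $ i = (\<Sum>j\<le>n. M $$ (i, j) * w $ j)" if "i \<le> n" for i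
      using mult_mat_vec_index[OF M w(1), of i] that by (simp add: lessThan_Suc_atMost)
    have Mw': "(\<Sum>j\<le>n. M $$ (i, j) * w $ j) = (\<Sum>j<n. M $$ (i, insert_index c j) * z $ j)" for i
      using c w(2) by (simp add: sum.remove[of "{..n}" c] sum_insert_index wz)
    have z0: "(M *\<^sub>v w) $ insert_index l i = 0" if i: "i < n" for i
    proof -
      have "insert_index l i \<le> n" using i by (simp add: insert_index_def)
      then have "(M *\<^sub>v w) $ insert_index l i = (\<Sum>j<n. M $$ (insert_index l i, insert_index c j) * z $ j)"
        by (simp only: Mw Mw')
      also have "\<dots> = (\<Sum>j<n. mat_delete M l c $$ (i, j) * z $ j)"
        using M l c i by (intro sum.cong) (auto simp: mat_delete_index)
      also have "\<dots> = (mat_delete M l c *\<^sub>v z) $ i" using mult_mat_vec_index[OF D z(1) i] by simp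
      finally show ?thesis using z(2) i by simp
    qed
    have "(\<Sum>i\<le>n. y i * (M *\<^sub>v w) $ i) = (\<Sum>i\<le>n. \<Sum>j\<le>n. y i * (M $$ (i, j) * w $ j))"
      by (intro sum.cong) (auto simp: Mw sum_distrib_left)
    also have "\<dots> = (\<Sum>j\<le>n. (\<Sum>i\<le>n. y i * M $$ (i, j)) * w $ j)"
      by (subst sum.swap) (simp add: sum_distrib_left mult_ac)
    also have "\<dots> = 0"
      using y(2) w(2) by (intro sum.neutral) auto
    finally have "y l * (M *\<^sub>v w) $ l + (\<Sum>i\<in>{..n} - {l}. y i * (M *\<^sub>v w) $ i) = 0"
      using l by (simp add: sum.remove)
    then have "(M *\<^sub>v w) $ l = 0" using l z0 by (simp add: sum_insert_index)
    then have "(M *\<^sub>v w) $ i = 0" if "i \<le> n" for i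
    proof (cases "i = l")
      case False
      then have "i \<in> insert_index l ` {..<n}" unfolding insert_index_image[OF l(1)] using that by simp
      then show ?thesis using z0 by auto
    qed simp
    then have "M *\<^sub>v w = 0\<^sub>v (n+1)" using M by (intro eq_vecI) (auto simp: less_Suc_eq_le)
    from inj[OF w(1) this w(2)] have "w = 0\<^sub>v (n+1)" .
    then show ?thesis using wz z(1) by (intro eq_vecI) (auto simp: insert_index_def)
  qed
  then have "det (mat_delete M l c) \<noteq> 0"
    using det_0_iff_vec_prod_zero_field[OF D] by blast
  then show ?thesis using l by blast
qed

lemma mat_mult_reindex:
  assumes M: "(M :: complex mat) \<in> carrier_mat m k" and w: "w \<in> carrier_vec k"
    and g: "inj_on g {..<r}" "g ` {..<r} \<subseteq> {..<k}" and z: "\<And>j. j < k \<Longrightarrow> j \<notin> g ` {..<r} \<Longrightarrow> w $ j = 0"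
  shows "mat_of_cols m (map (\<lambda>j. col M (g j)) [0..<r]) *\<^sub>v vec r (\<lambda>j. w $ g j) = M *\<^sub>v w"
proof (rule eq_vecI)
  fix i assume i: "i < dim_vec (M *\<^sub>v w)"
  then have i: "i < m" using M by simp
  have N: "mat_of_cols m (map (\<lambda>j. col M (g j)) [0..<r]) \<in> carrier_mat m r"
    using mat_of_cols_carrier(1)[of m "map (\<lambda>j. col M (g j)) [0..<r]"] by simp
  have "(M *\<^sub>v w) $ i = (\<Sum>j<k. M $$ (i, j) * w $ j)" by (rule mult_mat_vec_index[OF M w i])
  also have "\<dots> = (\<Sum>j\<in>g ` {..<r}. M $$ (i, j) * w $ j)"
    by (rule sum.mono_neutral_right) (use g z in auto)
  also have "\<dots> = (\<Sum>j<r. M $$ (i, g j) * w $ g j)"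
    using g(1) by (simp add: sum.reindex)
  also have "\<dots> = (\<Sum>j<r. mat_of_cols m (map (\<lambda>j. col M (g j)) [0..<r]) $$ (i, j) * vec r (\<lambda>j. w $ g j) $ j)"
    by (rule sum.cong) (use M i g in \<open>auto simp: mat_of_cols_index\<close>)
  finally show "(mat_of_cols m (map (\<lambda>j. col M (g j)) [0..<r]) *\<^sub>v vec r (\<lambda>j. w $ g j)) $ i = (M *\<^sub>v w) $ i"
    using mult_mat_vec_index[OF N, of "vec r (\<lambda>j. w $ g j)" i] i by simp
qed (use M in simp)

text \<open>Take n independent columns and let c be the one left over; M is then injective on the
  vectors with entry 0 at c. The independent family is a set of vectors, so each of its members is
  first assigned a column index.\<close>

lemma rank_imp_minor:
  assumes M: "(M :: complex mat) \<in> carrier_mat (n+1) (n+1)" and r: "vec_space.rank (n+1) M = n"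
  shows "\<exists>l\<le>n. \<exists>c\<le>n. det (mat_delete M l c) \<noteq> 0"
proof -
  interpret vec_space "TYPE(complex)" "n+1" .
  obtain S where S: "finite S" "maximal S (\<lambda>T. T \<subseteq> set (cols M) \<and> lin_indpt T)"
    using maximal_exists_superset[of "set (cols M)" "\<lambda>T. T \<subseteq> set (cols M) \<and> lin_indpt T" "{}"]
      unfolding lin_dep_def by auto
  have cS: "card S = n" using rank_card_indpt[OF M S(2)] r by simp
  have sub: "S \<subseteq> set (cols M)" and ind: "lin_indpt S" using S(2) by (auto simp: maximal_def)
  obtain h where h: "bij_betw h {..<n} S"
    using ex_bij_betw_nat_finite[OF S(1)] cS by (auto simp: atLeast0LessThan)
  have "\<exists>j<n+1. h i = col M j" if "i < n" for i
  proof -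
    have "h i \<in> set (cols M)" using h that sub by (auto simp: bij_betw_def)
    then obtain j where "j < length (cols M)" "h i = cols M ! j" by (metis in_set_conv_nth)
    then show ?thesis using M by auto
  qed
  then obtain g where g: "\<And>i. i < n \<Longrightarrow> g i < n+1 \<and> h i = col M (g i)" by metis
  have injg: "inj_on g {..<n}"
    using h g by (metis (no_types, lifting) bij_betw_def inj_on_def lessThan_iff)
  have gsub: "g ` {..<n} \<subseteq> {..<n+1}" using g by auto
  have "card (g ` {..<n}) = n" using injg by (simp add: card_image)
  then have "card ({..<n+1} - g ` {..<n}) = 1" using gsub by (subst card_Diff_subset) auto
  then obtain c where c: "{..<n+1} - g ` {..<n} = {c}" by (auto simp: card_1_singleton_iff)
  then have "c \<in> {..<n+1}" by blast
  then have cn: "c \<le> n" by simp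
  let ?N = "mat_of_cols (n+1) (map (\<lambda>j. col M (g j)) [0..<n])"
  have N: "?N \<in> carrier_mat (n+1) n"
    using mat_of_cols_carrier(1)[of "n+1" "map (\<lambda>j. col M (g j)) [0..<n]"] by simp
  have colsN: "cols ?N = map h [0..<n]"
    using M g by (subst cols_mat_of_cols) (auto simp: col_def)
  have d: "distinct (cols ?N)" and sN: "set (cols ?N) = S"
    using h unfolding colsN by (auto simp: distinct_map bij_betw_def atLeast0LessThan)
  have "w = 0\<^sub>v (n+1)" if w: "w \<in> carrier_vec (n+1)" "M *\<^sub>v w = 0\<^sub>v (n+1)" "w $ c = 0" for w
  proof -
    have out: "w $ j = 0" if "j < n+1" "j \<notin> g ` {..<n}" for j
    proof -
      have "j \<in> {c}" using that c by blast
      then show ?thesis using w(3) by simp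
    qed
    have "?N *\<^sub>v vec n (\<lambda>j. w $ g j) = 0\<^sub>v (n+1)"
      using mat_mult_reindex[OF M w(1) injg gsub out] w(2) by simp
    then have "vec n (\<lambda>j. w $ g j) = 0\<^sub>v n"
      using lin_depI[OF N vec_carrier _ _ d] ind unfolding sN by blast
    then have "w $ g j = 0" if "j < n" for j using that by (auto simp: vec_eq_iff)
    then have "w $ j = 0" if "j < n+1" for j using that out by blast
    then show ?thesis using w(1) by (intro eq_vecI) auto
  qed
  from det_mat_delete_nonzero[OF M cn this] cn show ?thesis by blast
qed

lemma pick_delete: assumes "l \<le> n" "i < n" shows "pick ({0..n} - {l}) i = insert_index l i"
proof -
  have mem: "insert_index l i \<in> {0..n} - {l}" using assms by (auto simp: insert_index_def)
  have "{a \<in> {0..n} - {l}. a < insert_index l i} = (if i < l then {0..<i} else {0..i} - {l})"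
    using assms by (auto simp: insert_index_def)
  then have "card {a \<in> {0..n} - {l}. a < insert_index l i} = i"
    using assms by simp
  then show ?thesis using pick_card_in_set[OF mem] by simp
qed

lemma submatrix_eq_mat_delete:
  assumes M: "M \<in> carrier_mat (n+1) (n+1)" and l: "l \<le> n" "c \<le> n"
  shows "submatrix M ({0..n} - {l}) ({0..n} - {c}) = mat_delete M l c"
proof -
  have "{i. i < n+1 \<and> i \<in> {0..n} - {k}} = {0..n} - {k}" for k by auto
  then have card: "card {i. i < n+1 \<and> i \<in> {0..n} - {k}} = n" if "k \<le> n" for k
    using that by simp
  have dr: "dim_row M = n+1" "dim_col M = n+1" using M by auto
  show ?thesis
  proof (rule eq_matI)
    fix i j assume "i < dim_row (mat_delete M l c)" "j < dim_col (mat_delete M l c)"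
    then have ij: "i < n" "j < n" using M by auto
    have "submatrix M ({0..n} - {l}) ({0..n} - {c}) $$ (i, j) = M $$ (pick ({0..n} - {l}) i, pick ({0..n} - {c}) j)"
      by (rule submatrix_index) (simp_all only: dr card[OF l(1)] card[OF l(2)] ij)
    also have "\<dots> = mat_delete M l c $$ (i, j)"
      using mat_delete_index[of M n l c i j] M ij l by (simp add: pick_delete)
    finally show "submatrix M ({0..n} - {l}) ({0..n} - {c}) $$ (i, j) = mat_delete M l c $$ (i, j)" .
  next
    show "dim_row (submatrix M ({0..n} - {l}) ({0..n} - {c})) = dim_row (mat_delete M l c)"
      unfolding dim_submatrix dr card[OF l(1)] mat_delete_dim by simp
    show "dim_col (submatrix M ({0..n} - {l}) ({0..n} - {c})) = dim_col (mat_delete M l c)"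
      unfolding dim_submatrix dr card[OF l(2)] mat_delete_dim by simp
  qed
qed

lemma card_n_subset: assumes "I \<subseteq> {0..n}" "card I = n" shows "\<exists>l\<le>n. I = {0..n} - {l}"
proof -
  have "card ({0..n} - I) = 1" using assms finite_subset[OF assms(1)] by (simp add: card_Diff_subset)
  then obtain l where l: "{0..n} - I = {l}" by (auto simp: card_1_singleton_iff)
  then have "I = {0..n} - {l}" "l \<in> {0..n}" using assms(1) by blast+
  then show ?thesis by auto
qed

text \<open>The subsets of {0..n} with n elements are the complements of single indices, which turns
  submatrices into deletions of one row and one column.\<close>

lemma all_minors_zero_iff:
  assumes M: "M \<in> carrier_mat (n+1) (n+1)"
  shows "(\<forall>I J. I \<subseteq> {0..n} \<longrightarrow> J \<subseteq> {0..n} \<longrightarrow> card I = n \<longrightarrow> card J = n \<longrightarrow> det (submatrix M I J) = 0)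
    \<longleftrightarrow> (\<forall>l\<le>n. \<forall>c\<le>n. det (mat_delete M l c) = 0)" (is "?l \<longleftrightarrow> ?r")
proof
  assume l: ?l
  show ?r
  proof (intro allI impI)
    fix l c assume lc: "l \<le> n" "c \<le> n"
    have "det (submatrix M ({0..n} - {l}) ({0..n} - {c})) = 0"
      using l[rule_format, of "{0..n} - {l}" "{0..n} - {c}"] lc by auto
    then show "det (mat_delete M l c) = 0" by (simp only: submatrix_eq_mat_delete[OF M lc])
  qed
next
  assume r: ?r
  show ?l
  proof (intro allI impI)
    fix I J assume IJ: "I \<subseteq> {0..n}" "J \<subseteq> {0..n}" "card I = n" "card J = n"
    obtain l c where lc: "l \<le> n" "c \<le> n" "I = {0..n} - {l}" "J = {0..n} - {c}"
      using card_n_subset[OF IJ(1,3)] card_n_subset[OF IJ(2,4)] by blast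
    show "det (submatrix M I J) = 0"
      using r lc(1,2) unfolding lc(3,4) submatrix_eq_mat_delete[OF M lc(1,2)] by simp
  qed
qed

lemma minor_imp_rank:
  assumes M: "(M :: complex mat) \<in> carrier_mat (n+1) (n+1)" and lc: "l \<le> n" "c \<le> n"
    and det: "det (mat_delete M l c) \<noteq> 0" and sing: "det M = 0"
  shows "vec_space.rank (n+1) M = n"
proof -
  interpret vec_space "TYPE(complex)" "n+1" .
  have "{j. j < n+1 \<and> j \<in> {0..n} - {c}} = {0..n} - {c}" by auto
  then have "card {j. j < n+1 \<and> j \<in> {0..n} - {c}} = n" using lc by simp
  moreover have "card {j. j < n+1 \<and> j \<in> {0..n} - {c}} \<le> rank M"
    by (rule rank_gt_minor[OF M, of "{0..n} - {l}"]) (use det in \<open>simp only: submatrix_eq_mat_delete[OF M lc], simp\<close>)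
  moreover have "rank M < n+1" by (rule det_zero_low_rank[OF M sing])
  ultimately show ?thesis by simp
qed

section \<open>Forms, their values and their partial derivatives\<close>

lemma keys_partial:
  assumes "keys f \<subseteq> monomials S k"
  shows "keys (mp_partial i f) \<subseteq> monomials S (k - 1)"
proof
  fix m assume "m \<in> keys (mp_partial i f)"
  then have "m + single i 1 \<in> keys f"
    by (simp add: in_keys_iff lookup_partial)
  then have "m + single i 1 \<in> monomials S k" using assms by blast
  then show "m \<in> monomials S (k - 1)" by (auto simp: monomials_def keys_add_nat mdeg_add)
qed

text \<open>Induction on the degree: in characteristic 0 a form of positive degree whose partial
  derivatives are all zero is zero. It is applied with V the whole space, where it shows that a form
  is determined by its values, and with V the image of psi.\<close>

lemma zero_of_partials_vanish:
  assumes V: "V \<noteq> {}"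
    and step: "\<And>k f i v. keys f \<subseteq> monomials S k \<Longrightarrow> \<forall>v\<in>V. mp_eval f v = 0 \<Longrightarrow> i \<in> S \<Longrightarrow>
      v \<in> V \<Longrightarrow> mp_eval (mp_partial i f) v = 0"
    and f: "keys f \<subseteq> monomials S k" "\<forall>v\<in>V. mp_eval f v = 0"
  shows "f = 0"
  using f
proof (induct k arbitrary: f)
  case 0
  have "m = 0" if "m \<in> keys f" for m
  proof -
    have "mdeg m = 0" using that 0(1) by (auto simp: monomials_def)
    then show ?thesis by (auto simp: mdeg_def in_keys_iff intro!: poly_mapping_eqI)
  qed
  then have f: "keys f \<subseteq> {0}" by blast
  obtain v where "v \<in> V" using V by blast
  then have "lookup f 0 = 0" using 0(2) mp_eval_superset[OF _ f, of v] by simp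
  then have "0 \<notin> keys f" by (simp add: in_keys_iff)
  then have "keys f = {}" using f by blast
  then show ?case by simp
next
  case (Suc k)
  show ?case
  proof (rule poly_mapping_eqI)
    fix m show "lookup f m = lookup 0 m"
    proof (rule ccontr)
      assume "lookup f m \<noteq> lookup 0 m"
      then have nz: "lookup f m \<noteq> 0" by simp
      then have m: "keys m \<subseteq> S" "mdeg m = Suc k" using Suc(2) by (auto simp: monomials_def in_keys_iff)
      then have "m \<noteq> 0" by auto
      then obtain i where i: "lookup m i \<noteq> 0" by (metis lookup_zero poly_mapping_eqI)
      then have "i \<in> S" using m by (auto simp: in_keys_iff)
      have "mp_partial i f = 0"
      proof (rule Suc(1))
        show "keys (mp_partial i f) \<subseteq> monomials S k" using keys_partial[OF Suc(2), of i] by simp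
        show "\<forall>v\<in>V. mp_eval (mp_partial i f) v = 0" using step[OF Suc(2,3) \<open>i \<in> S\<close>] by blast
      qed
      \<comment> \<open>The coefficient of f at m appears here multiplied by the exponent of x_i in
        m, which is not zero.\<close>
      then have "lookup (mp_partial i f) (m - single i 1) = 0" by simp
      moreover have "lookup (mp_partial i f) (m - single i 1)
         = of_nat (lookup (m - single i 1) i + 1) * lookup f m"
        unfolding lookup_partial minus_single_add[OF i] ..
      ultimately show False using nz by (simp only: mult_eq_0_iff of_nat_eq_0_iff) simp
    qed
  qed
qed

lemma mp_partial_has_derivative:
  assumes f: "homogeneous n k f" and i: "i \<le> n" and v: "v \<in> carrier_vec (n+1)"
  shows "((\<lambda>s. mp_eval f (v + s \<cdot>\<^sub>v unit_vec (n+1) i)) has_field_derivative mp_eval (mp_partial i f) v) (at 0)"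
proof -
  let ?F = "\<lambda>s. v + s \<cdot>\<^sub>v unit_vec (n+1) i"
  have "((\<lambda>s. mp_eval f (?F s)) has_field_derivative
     (\<Sum>j\<le>n. mp_eval (mp_partial j f) (?F 0) * (if j = i then 1 else 0))) (at 0)"
  proof (rule mp_eval_chain_rule[OF f])
    fix j assume "j \<le> n"
    then have eq: "(\<lambda>s. ?F s $ j) = (\<lambda>s. v $ j + s * (if j = i then 1 else 0))" using v i by auto
    show "((\<lambda>s. ?F s $ j) has_field_derivative (if j = i then 1 else 0)) (at 0)"
      unfolding eq by (auto intro!: derivative_eq_intros)
  qed
  moreover have "?F 0 = v" using v by auto
  moreover have "(\<Sum>j\<le>n. mp_eval (mp_partial j f) v * (if j = i then 1 else 0)) = mp_eval (mp_partial i f) v"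
    using i by (simp add: if_distrib[of "(*) _"] cong: if_cong)
  ultimately show ?thesis by (simp only:)
qed

lemma zero_of_eval_zero:
  assumes f: "homogeneous n k f" and z: "\<And>v. v \<in> carrier_vec (n+1) \<Longrightarrow> mp_eval f v = 0"
  shows "f = 0"
proof (rule zero_of_partials_vanish[of "carrier_vec (n+1)" "{..n}" f k])
  show "keys f \<subseteq> monomials {..n} k" using f by (simp add: homogeneous_keys)
  fix l i :: nat and v :: "complex vec" and g :: mpoly
  assume g: "keys g \<subseteq> monomials {..n} l" "\<forall>v\<in>carrier_vec (n+1). mp_eval g v = 0"
    and i: "i \<in> {..n}" and v: "v \<in> carrier_vec (n+1)"
  have hom: "homogeneous n l g" "i \<le> n" using g(1) i by (simp_all add: homogeneous_keys)
  have zero: "(\<lambda>s. mp_eval g (v + s \<cdot>\<^sub>v unit_vec (n+1) i)) = (\<lambda>_. 0)" using g(2) v by auto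
  show "mp_eval (mp_partial i g) v = 0"
    by (rule DERIV_unique[OF mp_partial_has_derivative[OF hom v, unfolded zero] DERIV_const])
qed (use z zero_carrier_vec in blast)+

text \<open>Additivity, and the product rule below, follow at each point from uniqueness of the
  analytic derivative instead of a comparison of coefficients.\<close>

lemma mp_partial_add_eval:
  assumes f: "homogeneous n k f" and g: "homogeneous n k g" and i: "i \<le> n" and v: "v \<in> carrier_vec (n+1)"
  shows "mp_eval (mp_partial i (f + g)) v = mp_eval (mp_partial i f) v + mp_eval (mp_partial i g) v"
  by (rule DERIV_unique[OF mp_partial_has_derivative[OF homogeneous_add[OF f g] i v, unfolded mp_eval_add]
    DERIV_add[OF mp_partial_has_derivative[OF f i v] mp_partial_has_derivative[OF g i v]]])

lemma mp_partial_mult_eval: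
  assumes f: "homogeneous n k f" and g: "homogeneous n l g" and i: "i \<le> n" and v: "v \<in> carrier_vec (n+1)"
  shows "mp_eval (mp_partial i (f * g)) v =
    mp_eval (mp_partial i f) v * mp_eval g v + mp_eval f v * mp_eval (mp_partial i g) v"
proof -
  have v0: "v + 0 \<cdot>\<^sub>v unit_vec (n+1) i = v" using v by auto
  have "((\<lambda>s. mp_eval (f * g) (v + s \<cdot>\<^sub>v unit_vec (n+1) i)) has_field_derivative
     mp_eval (mp_partial i f) v * mp_eval g v + mp_eval (mp_partial i g) v * mp_eval f v) (at 0)"
    unfolding mp_eval_mult
    using DERIV_mult[OF mp_partial_has_derivative[OF f i v] mp_partial_has_derivative[OF g i v]]
    unfolding v0 .
  from DERIV_unique[OF mp_partial_has_derivative[OF homogeneous_mult[OF f g] i v] this]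
  show ?thesis by (simp add: mult.commute)
qed

section \<open>Codimension and reciprocal linear spaces\<close>

text \<open>A chain that starts at Y can be prolonged downwards by any smaller irreducible closed Z,
  so the infimum is attained at Y itself.\<close>

lemma codim_eq_codim_irreducible:
  assumes Y: "irreducible_closed n Y" shows "codim n Y = codim_irreducible n Y"
proof (rule antisym)
  show "codim n Y \<le> codim_irreducible n Y"
    unfolding codim_def using Y by (intro INF_lower) auto
  show "codim_irreducible n Y \<le> codim n Y"
    unfolding codim_def
  proof (rule INF_greatest)
    fix Z assume "Z \<in> {Z. irreducible_closed n Z \<and> Z \<subseteq> Y}"
    then have Z: "irreducible_closed n Z" "Z \<subseteq> Y" by auto
    show "codim_irreducible n Y \<le> codim_irreducible n Z"
    proof (cases "Z = Y")
      case False
      then have "Z \<subset> Y" using Z by auto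
      show ?thesis unfolding codim_irreducible_def[of n Y]
      proof (rule Sup_least)
        fix x assume "x \<in> {enat k |k. \<exists>c. c 0 = Y \<and> (\<forall>i\<le>k. irreducible_closed n (c i)) \<and> (\<forall>i<k. c i \<subset> c (Suc i))}"
        then obtain k c where c: "x = enat k" "c 0 = Y" "\<forall>i\<le>k. irreducible_closed n (c i)" "\<forall>i<k. c i \<subset> c (Suc i)"
          by auto
        define c' where "c' = (\<lambda>i. if i = 0 then Z else c (i - 1))"
        have "c' 0 = Z" by (simp add: c'_def)
        moreover have "\<forall>i\<le>Suc k. irreducible_closed n (c' i)"
          using c(3) Z(1) by (auto simp: c'_def)
        moreover have "\<forall>i<Suc k. c' i \<subset> c' (Suc i)"
        proof (intro allI impI)
          fix i assume "i < Suc k"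
          then show "c' i \<subset> c' (Suc i)"
            using c(4)[rule_format, of "i - 1"] \<open>Z \<subset> Y\<close> c(2) by (cases i) (auto simp: c'_def)
        qed
        ultimately have "enat (Suc k) \<in> {enat k |k. \<exists>c. c 0 = Z \<and> (\<forall>i\<le>k. irreducible_closed n (c i)) \<and> (\<forall>i<k. c i \<subset> c (Suc i))}"
          by blast
        then have "enat (Suc k) \<le> codim_irreducible n Z"
          unfolding codim_irreducible_def by (rule Sup_upper)
        then show "x \<le> codim_irreducible n Z" using c(1)
          by (metis Suc_n_not_le_n enat_ord_simps(1) nle_le order_trans)
      qed
    qed simp
  qed
qed

lemma codim_le_of_growth:
  assumes Y: "irreducible_closed n Y" and g: "growth n Y r"
  shows "codim n Y \<le> enat (n - r)"
  unfolding codim_eq_codim_irreducible[OF Y] codim_irreducible_def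
proof (rule Sup_least)
  fix x assume "x \<in> {enat k |k. \<exists>c. c 0 = Y \<and> (\<forall>i\<le>k. irreducible_closed n (c i)) \<and> (\<forall>i<k. c i \<subset> c (Suc i))}"
  then obtain k c where c: "x = enat k" "c 0 = Y" "\<forall>i\<le>k. irreducible_closed n (c i)" "\<forall>i<k. c i \<subset> c (Suc i)"
    by auto
  have "r + k \<le> n" using growth_chain[OF c(3,4)] g c(2) by simp
  then show "x \<le> enat (n - r)" using c(1) by simp
qed

lemma codim_ge_of_chain:
  assumes Y: "irreducible_closed n Y"
    and c: "c 0 = Y" "\<forall>i\<le>k. irreducible_closed n (c i)" "\<forall>i<k. c i \<subset> c (Suc i)"
  shows "enat k \<le> codim n Y"
  unfolding codim_eq_codim_irreducible[OF Y] codim_irreducible_def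
  by (rule Sup_upper) (use c in blast)

section \<open>Reciprocals of linear subspaces\<close>

definition torus_part :: "nat \<Rightarrow> complex vec set \<Rightarrow> complex vec set"
  where "torus_part n W = {v \<in> W. \<forall>i\<le>n. v $ i \<noteq> 0}"

definition inv_vec :: "nat \<Rightarrow> complex vec \<Rightarrow> complex vec"
  where "inv_vec n v = vec (n+1) (\<lambda>i. inverse (v $ i))"

definition inv_points :: "nat \<Rightarrow> complex vec set \<Rightarrow> complex vec set set"
  where "inv_points n W = (\<lambda>v. proj_pt (inv_vec n v)) ` torus_part n W"

lemma inv_vec_carrier [simp]: "inv_vec n v \<in> carrier_vec (n+1)"
  by (simp add: inv_vec_def)

lemma inv_vec_nonzero: "v \<in> torus_part n W \<Longrightarrow> inv_vec n v \<noteq> 0\<^sub>v (n+1)"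
  by (auto simp: inv_vec_def torus_part_def vec_eq_iff)

lemma inv_points_sub: "inv_points n W \<subseteq> proj_space n"
  unfolding inv_points_def using proj_pt_in_proj_space[OF inv_vec_carrier inv_vec_nonzero] by blast

lemma reciprocal_projectivization:
  assumes W: "W \<subseteq> carrier_vec (n+1)" "\<And>c v. v \<in> W \<Longrightarrow> c \<cdot>\<^sub>v v \<in> W"
  shows "reciprocal n (projectivization n W) = zariski n closure_of (inv_points n W)"
proof -
  have "{proj_pt (vec (n+1) (\<lambda>i. inverse (v $ i))) | v p. p \<in> projectivization n W \<inter> torus n \<and> v \<in> p}
    = inv_points n W" (is "?L = ?R")
  proof
    show "?L \<subseteq> ?R"
    proof
      fix q assume "q \<in> ?L"
      then obtain v p where v: "q = proj_pt (inv_vec n v)" "p \<in> projectivization n W" "p \<in> torus n" "v \<in> p"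
        by (auto simp: inv_vec_def)
      then obtain w where w: "w \<in> W" "p = proj_pt w" by (auto simp: projectivization_def)
      then have "v \<in> W" using W(2) v(4) by (auto simp: proj_pt_def)
      moreover have "\<forall>i\<le>n. v $ i \<noteq> 0" using v by (auto simp: torus_def)
      ultimately show "q \<in> ?R" using v(1) by (auto simp: inv_points_def torus_part_def)
    qed
    show "?R \<subseteq> ?L"
    proof
      fix q assume "q \<in> ?R"
      then obtain v where v: "v \<in> W" "\<forall>i\<le>n. v $ i \<noteq> 0" "q = proj_pt (inv_vec n v)"
        by (auto simp: inv_points_def torus_part_def)
      have nz: "v \<noteq> 0\<^sub>v (n+1)" using v(2) by auto
      have vc: "v \<in> carrier_vec (n+1)" using v(1) W(1) by blast
      have "proj_pt v \<in> projectivization n W" using v(1) nz by (auto simp: projectivization_def)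
      moreover have "proj_pt v \<in> torus n"
        using proj_pt_in_proj_space[OF vc nz] v(2) vc by (auto simp: torus_def proj_pt_def)
      ultimately show "q \<in> ?L" using v(3) proj_ptI unfolding inv_vec_def by blast
    qed
  qed
  then show ?thesis unfolding reciprocal_def by simp
qed

lemma line_open_torus_part:
  assumes W: "W \<subseteq> carrier_vec (n+1)" "\<And>v w. v \<in> W \<Longrightarrow> w \<in> W \<Longrightarrow> v + w \<in> W" "\<And>c v. v \<in> W \<Longrightarrow> c \<cdot>\<^sub>v v \<in> W"
  shows "line_open (n+1) (torus_part n W)"
proof (rule line_openI)
  show "torus_part n W \<subseteq> carrier_vec (n+1)" using W(1) by (auto simp: torus_part_def)
  fix a b assume ab: "a \<in> torus_part n W" "b \<in> torus_part n W"
  then have c: "a \<in> carrier_vec (n+1)" "b \<in> carrier_vec (n+1)" using W(1) by (auto simp: torus_part_def)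
  have "b - a = b + (-1) \<cdot>\<^sub>v a" using c by auto
  then have "a + s \<cdot>\<^sub>v (b - a) \<in> W" for s using W(2,3) ab by (simp add: torus_part_def)
  then show "\<exists>K. finite K \<and> (\<forall>\<chi>\<in>K. poly_on_lines (n+1) \<chi> \<and> \<chi> a \<noteq> 0) \<and>
      (\<forall>s. (\<forall>\<chi>\<in>K. \<chi> (a + s \<cdot>\<^sub>v (b - a)) \<noteq> 0) \<longrightarrow> a + s \<cdot>\<^sub>v (b - a) \<in> torus_part n W)"
    using ab poly_on_lines_coord
    by (intro exI[of _ "(\<lambda>i v. v $ i) ` {..n}"]) (auto simp: torus_part_def)
qed

lemma prod_others_eq:
  fixes w :: "complex vec"
  assumes "\<forall>j\<le>n. w $ j \<noteq> 0" "i \<le> n"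
  shows "(\<Prod>j\<in>{..n} - {i}. w $ j) = (\<Prod>j\<le>n. w $ j) * inverse (w $ i)"
  using assms by (simp add: prod.remove[of "{..n}" i])

text \<open>Inversion is not polynomial, but multiplying by the product of all coordinates gives a
  polynomial map to the same projective points.\<close>

lemma irreducible_inv_points:
  assumes W: "W \<subseteq> carrier_vec (n+1)" "\<And>v w. v \<in> W \<Longrightarrow> w \<in> W \<Longrightarrow> v + w \<in> W" "\<And>c v. v \<in> W \<Longrightarrow> c \<cdot>\<^sub>v v \<in> W"
    and ne: "torus_part n W \<noteq> {}"
  shows "irreducible_closed n (zariski n closure_of (inv_points n W))"
proof -
  let ?F = "\<lambda>i w. \<Prod>j\<in>{..n} - {i}. (w :: complex vec) $ j"
  have F: "vec (n+1) (\<lambda>i. ?F i w) = (\<Prod>j\<le>n. w $ j) \<cdot>\<^sub>v inv_vec n w" "(\<Prod>j\<le>n. w $ j) \<noteq> 0" if "w \<in> torus_part n W" for w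
    using that prod_others_eq[of n w] by (auto simp: torus_part_def inv_vec_def)
  have nz: "vec (n+1) (\<lambda>i. ?F i w) \<noteq> 0\<^sub>v (n+1)" if "w \<in> torus_part n W" for w
    using F[OF that] inv_vec_nonzero[OF that] smult_vec_eq_zero_iff[OF inv_vec_carrier] by simp
  have "irreducible_closed n (zariski n closure_of ((\<lambda>w. proj_pt (vec (n+1) (\<lambda>i. ?F i w))) ` torus_part n W))"
    by (rule irreducible_closure_image[OF line_open_torus_part[OF W] ne _ nz])
       (auto intro!: poly_on_lines_prod poly_on_lines_coord)
  also have "(\<lambda>w. proj_pt (vec (n+1) (\<lambda>i. ?F i w))) ` torus_part n W = inv_points n W"
    unfolding inv_points_def
  proof (rule image_cong)
    fix w assume w: "w \<in> torus_part n W"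
    show "proj_pt (vec (n+1) (\<lambda>i. ?F i w)) = proj_pt (inv_vec n w)"
      unfolding F(1)[OF w] by (rule proj_pt_smult[OF F(2)[OF w]])
  qed simp
  finally show ?thesis .
qed

text \<open>The equation of $L^{-1}$ induced by the linear equation $\sum_i b_i x_i = 0$ of $L$.\<close>

lemma reciprocal_form:
  "\<exists>f. homogeneous n n f \<and>
    (\<forall>v\<in>carrier_vec (n+1). mp_eval f v = (\<Sum>i\<le>n. b i * (\<Prod>j\<in>{..n} - {i}. v $ j)))"
proof -
  have "form_fun n n (\<lambda>v. \<Prod>j\<in>{..n} - {i}. v $ j)" if "i \<le> n" for i
  proof -
    have "form_fun n (\<Sum>j\<in>{..n} - {i}. 1) (\<lambda>v. \<Prod>j\<in>{..n} - {i}. v $ j)"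
      by (intro form_fun_prod form_fun_coord) auto
    then show ?thesis using that by simp
  qed
  then have "form_fun n n (\<lambda>v. \<Sum>i\<le>n. b i * (\<Prod>j\<in>{..n} - {i}. v $ j))"
    by (intro form_fun_sum form_fun_cmult) auto
  then show ?thesis unfolding form_fun_def .
qed

lemma reciprocal_form_eval:
  fixes v :: "complex vec"
  assumes "\<forall>j\<le>n. v $ j \<noteq> 0"
  shows "(\<Sum>i\<le>n. b i * (\<Prod>j\<in>{..n} - {i}. v $ j)) = (\<Prod>j\<le>n. v $ j) * (\<Sum>i\<le>n. b i * inverse (v $ i))"
  unfolding sum_distrib_left
  by (rule sum.cong) (simp_all add: prod_others_eq[OF assms] mult_ac)

lemma torus_inv_vec:
  assumes "\<forall>j\<le>n. w $ j \<noteq> 0" shows "\<forall>j\<le>n. inv_vec n w $ j \<noteq> 0" "i \<le> n \<Longrightarrow> inverse (inv_vec n w $ i) = w $ i"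
  using assms by (auto simp: inv_vec_def)

text \<open>The reciprocal equation of b is, at an inverted vector, the value of b at the original
  vector times a nonzero product. Hence it vanishes on the smaller closure but not at the inverse of
  w'.\<close>

lemma inv_points_closure_psubset:
  assumes W: "W \<subseteq> W'" "W' \<subseteq> carrier_vec (n+1)"
    and b: "\<And>w. w \<in> W \<Longrightarrow> (\<Sum>i\<le>n. b i * w $ i) = 0"
    and w': "w' \<in> torus_part n W'" "(\<Sum>i\<le>n. b i * w' $ i) \<noteq> 0"
  shows "zariski n closure_of (inv_points n W) \<subset> zariski n closure_of (inv_points n W')"
proof -
  obtain f where f: "homogeneous n n f"
    "\<forall>v\<in>carrier_vec (n+1). mp_eval f v = (\<Sum>i\<le>n. b i * (\<Prod>j\<in>{..n} - {i}. v $ j))"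
    using reciprocal_form by blast
  have ev: "mp_eval f (inv_vec n w) = (\<Prod>j\<le>n. inv_vec n w $ j) * (\<Sum>i\<le>n. b i * w $ i)"
    if w: "\<forall>j\<le>n. w $ j \<noteq> 0" for w
    using f(2)[rule_format, OF inv_vec_carrier] reciprocal_form_eval[OF torus_inv_vec(1)[OF w], of b]
      torus_inv_vec(2)[OF w] by simp
  have "inv_points n W \<subseteq> inv_points n W'" using W(1) by (auto simp: inv_points_def torus_part_def)
  then have sub: "zariski n closure_of (inv_points n W) \<subseteq> zariski n closure_of (inv_points n W')"
    by (rule closure_of_mono)
  have "\<forall>q\<in>inv_points n W. vanishes f q"
    using ev b vanishes_proj_pt[OF f(1) inv_vec_carrier] by (auto simp: inv_points_def torus_part_def)
  then have 1: "vanishes f q" if "q \<in> zariski n closure_of (inv_points n W)" for q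
    using that f(1) unfolding zariski_closure_iff[OF inv_points_sub] by blast
  have t': "\<forall>j\<le>n. w' $ j \<noteq> 0" using w'(1) by (simp add: torus_part_def)
  have "(\<Prod>j\<le>n. inv_vec n w' $ j) \<noteq> 0" using torus_inv_vec(1)[OF t'] by simp
  then have "\<not> vanishes f (proj_pt (inv_vec n w'))"
    using vanishes_proj_pt[OF f(1) inv_vec_carrier] ev[OF t'] w'(2) by simp
  moreover have "proj_pt (inv_vec n w') \<in> zariski n closure_of (inv_points n W')"
    using closure_of_subset[of "inv_points n W'" "zariski n"] inv_points_sub w'(1)
    by (auto simp: inv_points_def)
  ultimately show ?thesis using sub 1 by blast
qed

text \<open>For an injective linear map $q$ and a vector $z_0$ with first coordinate nonzero, the images of
  the spans of $z_0, e_1, \ldots, e_j$ form a full flag of linear spaces through $q(z_0)$.\<close>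

definition flag_space :: "nat \<Rightarrow> (complex vec \<Rightarrow> complex vec) \<Rightarrow> complex vec \<Rightarrow> nat \<Rightarrow> complex vec set"
  where "flag_space n q z0 j =
    q ` {z \<in> carrier_vec (n+1). \<forall>i. j < i \<and> i \<le> n \<longrightarrow> z $ i * z0 $ 0 = z0 $ i * z $ 0}"

text \<open>Every member of the flag contains q(z_0), which lies in the torus, so no reciprocal is
  empty. For generic s the vector q(z_0 + s e) with the next unit vector e stays in the torus and
  leaves the smaller space; a linear form separating it makes the inclusion strict.\<close>

lemma reciprocal_flag:
  assumes q: "\<And>z. z \<in> carrier_vec (n+1) \<Longrightarrow> q z \<in> carrier_vec (n+1)"
    "\<And>z w. z \<in> carrier_vec (n+1) \<Longrightarrow> w \<in> carrier_vec (n+1) \<Longrightarrow> q (z + w) = q z + q w"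
    "\<And>c z. z \<in> carrier_vec (n+1) \<Longrightarrow> q (c \<cdot>\<^sub>v z) = c \<cdot>\<^sub>v q z"
    "\<And>z. z \<in> carrier_vec (n+1) \<Longrightarrow> q z = 0\<^sub>v (n+1) \<Longrightarrow> z = 0\<^sub>v (n+1)"
    and z0: "z0 \<in> carrier_vec (n+1)" "z0 $ 0 \<noteq> 0" "\<forall>i\<le>n. q z0 $ i \<noteq> 0"
  defines "X \<equiv> \<lambda>j. zariski n closure_of (inv_points n (flag_space n q z0 j))"
  shows "irreducible_closed n (X j)" "j < n \<Longrightarrow> X j \<subset> X (Suc j)"
proof -
  let ?Z = "\<lambda>j. {z \<in> carrier_vec (n+1). \<forall>i. j < i \<and> i \<le> n \<longrightarrow> z $ i * z0 $ 0 = z0 $ i * z $ 0}"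
  have sub: "flag_space n q z0 j \<subseteq> carrier_vec (n+1)" for j
    using q(1) by (auto simp: flag_space_def)
  have add: "v + w \<in> flag_space n q z0 j" if vw: "v \<in> flag_space n q z0 j" "w \<in> flag_space n q z0 j" for v w j
  proof -
    obtain a b where ab: "a \<in> ?Z j" "b \<in> ?Z j" "v = q a" "w = q b" using vw by (auto simp: flag_space_def)
    then have "a + b \<in> ?Z j" by (auto simp: distrib_left distrib_right)
    moreover have "v + w = q (a + b)" using ab q(2) by simp
    ultimately show ?thesis unfolding flag_space_def by blast
  qed
  have scale: "c \<cdot>\<^sub>v v \<in> flag_space n q z0 j" if v: "v \<in> flag_space n q z0 j" for c v j
  proof -
    obtain a where a: "a \<in> ?Z j" "v = q a" using v by (auto simp: flag_space_def)
    then have "c \<cdot>\<^sub>v a \<in> ?Z j" by auto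
    moreover have "c \<cdot>\<^sub>v v = q (c \<cdot>\<^sub>v a)" using a q(3) by simp
    ultimately show ?thesis unfolding flag_space_def by blast
  qed
  have "z0 \<in> ?Z j" for j using z0(1) by auto
  then have z0F: "q z0 \<in> torus_part n (flag_space n q z0 j)" for j
    using z0(3) by (auto simp: torus_part_def flag_space_def)
  then show "irreducible_closed n (X j)" unfolding X_def
    by (intro irreducible_inv_points sub add scale) auto
  assume j: "j < n"
  define e where "e = (unit_vec (n+1) (Suc j) :: complex vec)"
  have e: "e \<in> carrier_vec (n+1)" by (simp add: e_def)
  \<comment> \<open>The line through q z0 in direction q e is written in the shape a + s (b - a) of
    \<open>poly_on_lines\<close>. No coordinate vanishes at s = 0; that value is excluded afterwards
    so that the point really moves.\<close>
  have "finite (\<Union>i\<in>{..n}. {s. (q z0 + s \<cdot>\<^sub>v ((q z0 + q e) - q z0)) $ i = 0})"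
    using z0 q(1)[OF z0(1)] q(1)[OF e]
    by (intro finite_UN_I poly_on_lines_finite_zeros[of "n+1" "\<lambda>v. v $ _"] poly_on_lines_coord) auto
  then have "finite (insert 0 (\<Union>i\<in>{..n}. {s. (q z0 + s \<cdot>\<^sub>v ((q z0 + q e) - q z0)) $ i = 0}))" by simp
  from infinite_cofinite_complex[OF this] obtain s where
    "s \<notin> insert 0 (\<Union>i\<in>{..n}. {s. (q z0 + s \<cdot>\<^sub>v ((q z0 + q e) - q z0)) $ i = 0})" ..
  then have s: "s \<noteq> 0" "\<forall>i\<le>n. (q z0 + s \<cdot>\<^sub>v ((q z0 + q e) - q z0)) $ i \<noteq> 0"
    by blast+
  let ?z = "z0 + s \<cdot>\<^sub>v e"
  have z: "?z \<in> carrier_vec (n+1)" using z0 e by simp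
  have "q ?z = q z0 + s \<cdot>\<^sub>v q e" using q z0(1) e by simp
  also have "\<dots> = q z0 + s \<cdot>\<^sub>v ((q z0 + q e) - q z0)" using q(1)[OF z0(1)] q(1)[OF e] by auto
  finally have tz: "\<forall>i\<le>n. q ?z $ i \<noteq> 0" using s by simp
  have zi: "?z $ i = z0 $ i + (if i = Suc j then s else 0)" if "i \<le> n" for i
    using that z0(1) j by (auto simp: e_def)
  have "?z \<in> ?Z (Suc j)" using z zi z0(1) by auto
  then have qz: "q ?z \<in> torus_part n (flag_space n q z0 (Suc j))"
    using tz by (auto simp: torus_part_def flag_space_def)
  have "q ?z \<notin> flag_space n q z0 j"
  proof
    assume "q ?z \<in> flag_space n q z0 j"
    then obtain a where a: "a \<in> ?Z j" "q ?z = q a" by (auto simp: flag_space_def)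
    then have ac: "a \<in> carrier_vec (n+1)" by simp
    have "q (?z + (-1) \<cdot>\<^sub>v a) = q ?z + (-1) \<cdot>\<^sub>v q a" using q(2)[OF z] q(3)[OF ac] ac by simp
    also have "\<dots> = 0\<^sub>v (n+1)" using a(2) q(1)[OF ac] by auto
    finally have q0: "q (?z + (-1) \<cdot>\<^sub>v a) = 0\<^sub>v (n+1)" .
    have "?z + (-1) \<cdot>\<^sub>v a \<in> carrier_vec (n+1)" using z ac by simp
    from q(4)[OF this q0] have eq0: "?z + (-1) \<cdot>\<^sub>v a = 0\<^sub>v (n+1)" .
    have za: "?z $ i = a $ i" if "i \<le> n" for i
    proof -
      have "(?z + (-1) \<cdot>\<^sub>v a) $ i = 0" unfolding eq0 using that by simp
      then have "?z $ i + (-1) * a $ i = 0" using that z ac by simp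
      then show ?thesis by simp
    qed
    have "a $ Suc j * z0 $ 0 = z0 $ Suc j * a $ 0" using a(1) j by auto
    then have "?z $ Suc j * z0 $ 0 = z0 $ Suc j * ?z $ 0" using za[of "Suc j"] za[of 0] j by simp
    then show False using zi[of "Suc j"] zi[of 0] j s(1) z0(2) by (auto simp: algebra_simps)
  qed
  moreover have "0\<^sub>v (n+1) \<in> flag_space n q z0 j"
  proof -
    have "0 \<cdot>\<^sub>v q z0 \<in> flag_space n q z0 j" using z0F[of j] by (intro scale) (simp add: torus_part_def)
    moreover have "0 \<cdot>\<^sub>v q z0 = 0\<^sub>v (n+1)" using q(1)[OF z0(1)] by auto
    ultimately show ?thesis by (simp only:)
  qed
  ultimately obtain y where y: "\<forall>v\<in>flag_space n q z0 j. (\<Sum>i<n+1. y $ i * v $ i) = 0"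
    "(\<Sum>i<n+1. y $ i * q ?z $ i) \<noteq> 0"
    using annihilator_separates_vec[of "flag_space n q z0 j" "n+1" "q ?z"] sub add scale q(1)[OF z] by blast
  have "flag_space n q z0 j \<subseteq> flag_space n q z0 (Suc j)" by (auto simp: flag_space_def)
  then show "X j \<subset> X (Suc j)" unfolding X_def
    by (rule inv_points_closure_psubset[OF _ sub _ qz, where b = "\<lambda>i. y $ i"])
       (use y in \<open>simp_all add: lessThan_Suc_atMost\<close>)
qed

section \<open>Tangent spaces and the dual variety\<close>

text \<open>A point where \<phi> is nonzero could be moved to one where all the \<chi> k are nonzero
  as well, by \<open>common_nonzero\<close>.\<close>

lemma eval_eq_zero_of_dense:
  assumes \<phi>: "poly_on_lines N \<phi>" and K: "finite K" "\<And>k. k \<in> K \<Longrightarrow> poly_on_lines N (\<chi> k)"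
    "\<And>k. k \<in> K \<Longrightarrow> \<exists>a\<in>carrier_vec N. \<chi> k a \<noteq> 0"
    and z: "\<And>a. a \<in> carrier_vec N \<Longrightarrow> (\<And>k. k \<in> K \<Longrightarrow> \<chi> k a \<noteq> 0) \<Longrightarrow> \<phi> a = 0"
    and v: "v \<in> carrier_vec N"
  shows "\<phi> v = 0"
proof (rule ccontr)
  assume nz: "\<phi> v \<noteq> 0"
  \<comment> \<open>\<open>None\<close> stands for \<phi> and \<open>Some k\<close> for the excluded
    zero set of \<open>\<chi> k\<close>.\<close>
  have "\<exists>a\<in>carrier_vec N. \<forall>k\<in>insert None (Some ` K). (case k of None \<Rightarrow> \<phi> | Some k \<Rightarrow> \<chi> k) a \<noteq> 0"
    by (rule common_nonzero) (use assms nz in auto)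
  then show False using z by auto
qed

definition row_form :: "nat \<Rightarrow> complex mat \<Rightarrow> complex vec \<Rightarrow> nat \<Rightarrow> complex"
  where "row_form d A z i = (\<Sum>j<d+1. A $$ (j, i) * z $ j)"

definition ker_form :: "nat \<Rightarrow> nat \<Rightarrow> complex mat \<Rightarrow> complex vec \<Rightarrow> nat \<Rightarrow> complex"
  where "ker_form n d B z i = (\<Sum>j<n-d. B $$ (i, j) * z $ (d + 1 + j))"

text \<open>The variables $(t, u)$ are gathered in one vector $z$ of length $n + 1$, so that $X(z) = A^T t$
  and $Y(z) = B u$.\<close>

locale reciprocal_plane =
  fixes n d :: nat and A B :: "complex mat"
  assumes d_less: "d < n"
    and orthogonal: "\<And>z z'. z \<in> carrier_vec (n+1) \<Longrightarrow> z' \<in> carrier_vec (n+1) \<Longrightarrow>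
      (\<Sum>i\<le>n. row_form d A z i * ker_form n d B z' i) = 0"
    and annihilator: "\<And>w. (\<And>z. z \<in> carrier_vec (n+1) \<Longrightarrow> (\<Sum>i\<le>n. row_form d A z i * w i) = 0) \<Longrightarrow>
      \<exists>z\<in>carrier_vec (n+1). \<forall>i\<le>n. w i = ker_form n d B z i"
    and row_inj: "\<And>z j. z \<in> carrier_vec (n+1) \<Longrightarrow> (\<And>i. i \<le> n \<Longrightarrow> row_form d A z i = 0) \<Longrightarrow> j \<le> d \<Longrightarrow> z $ j = 0"
    and ker_inj: "\<And>z j. z \<in> carrier_vec (n+1) \<Longrightarrow> (\<And>i. i \<le> n \<Longrightarrow> ker_form n d B z i = 0) \<Longrightarrow> j < n - d \<Longrightarrow> z $ (d + 1 + j) = 0"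
    and row_nonzero: "\<And>i. i \<le> n \<Longrightarrow> \<exists>z\<in>carrier_vec (n+1). row_form d A z i \<noteq> 0"
begin

abbreviation X where "X \<equiv> row_form d A"
abbreviation Y where "Y \<equiv> ker_form n d B"

lemma X_add: "z \<in> carrier_vec (n+1) \<Longrightarrow> w \<in> carrier_vec (n+1) \<Longrightarrow> X (z + w) i = X z i + X w i"
  using d_less by (simp add: row_form_def distrib_left sum.distrib)

lemma Y_add: "z \<in> carrier_vec (n+1) \<Longrightarrow> w \<in> carrier_vec (n+1) \<Longrightarrow> Y (z + w) i = Y z i + Y w i"
  using d_less by (simp add: ker_form_def distrib_left sum.distrib)

lemma X_smult: "z \<in> carrier_vec (n+1) \<Longrightarrow> X (c \<cdot>\<^sub>v z) i = c * X z i"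
  using d_less by (simp add: row_form_def sum_distrib_left algebra_simps)

lemma Y_smult: "z \<in> carrier_vec (n+1) \<Longrightarrow> Y (c \<cdot>\<^sub>v z) i = c * Y z i"
  using d_less by (simp add: ker_form_def sum_distrib_left mult_ac)

lemma X_cong: "(\<And>j. j \<le> d \<Longrightarrow> z $ j = w $ j) \<Longrightarrow> X z i = X w i"
  unfolding row_form_def by (rule sum.cong) auto

lemma Y_cong: "(\<And>j. j < n - d \<Longrightarrow> z $ (d + 1 + j) = w $ (d + 1 + j)) \<Longrightarrow> Y z i = Y w i"
  unfolding ker_form_def by (rule sum.cong) auto

lemma form_fun_X: "form_fun n 1 (\<lambda>z. X z i)"
  unfolding row_form_def using d_less by (intro form_fun_sum form_fun_cmult form_fun_coord) auto

lemma form_fun_Y: "form_fun n 1 (\<lambda>z. Y z i)"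
  unfolding ker_form_def using d_less by (intro form_fun_sum form_fun_cmult form_fun_coord) auto

text \<open>X depends only on the coordinates up to d and Y only on the others. Taking these two
  blocks from different vectors allows t and u to be scaled or varied independently.\<close>

definition join :: "complex vec \<Rightarrow> complex vec \<Rightarrow> complex vec"
  where "join z w = vec (n+1) (\<lambda>i. if i \<le> d then z $ i else w $ i)"

lemma join_carrier [simp]: "join z w \<in> carrier_vec (n+1)" by (simp add: join_def)
lemma X_join: "X (join z w) i = X z i" by (rule X_cong) (use d_less in \<open>auto simp: join_def\<close>)
lemma Y_join: "Y (join z w) i = Y w i" by (rule Y_cong) (use d_less in \<open>auto simp: join_def\<close>)

lemma X_0: "X (0\<^sub>v (Suc n)) i = 0" using d_less by (simp add: row_form_def)
lemma Y_0: "Y (0\<^sub>v (Suc n)) i = 0" using d_less by (simp add: ker_form_def)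

lemma ker_nonzero: "\<exists>i\<le>n. \<exists>z\<in>carrier_vec (n+1). Y z i \<noteq> 0"
proof (rule ccontr)
  assume no: "\<not> ?thesis"
  have "(unit_vec (n+1) (d + 1 + 0) :: complex vec) $ (d + 1 + 0) = 0"
    by (rule ker_inj) (use no d_less in auto)
  then show False using d_less by simp
qed

definition W :: "complex vec set"
  where "W = {vec (n+1) (X z) | z. z \<in> carrier_vec (n+1)}"

definition variety :: "complex vec set set"
  where "variety = zariski n closure_of (inv_points n W)"

lemma W_I: "z \<in> carrier_vec (n+1) \<Longrightarrow> v = vec (n+1) (X z) \<Longrightarrow> v \<in> W"
  unfolding W_def by (rule CollectI, rule exI[of _ z], rule conjI)

lemma W_E:
  assumes "v \<in> W" obtains z where "z \<in> carrier_vec (n+1)" "v = vec (n+1) (X z)"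
  using assms unfolding W_def by (elim CollectE exE conjE)

lemma vec_X_add: "z \<in> carrier_vec (n+1) \<Longrightarrow> w \<in> carrier_vec (n+1) \<Longrightarrow> vec (n+1) (X z) + vec (n+1) (X w) = vec (n+1) (X (z + w))"
  by (auto simp: X_add)

lemma vec_X_smult: "z \<in> carrier_vec (n+1) \<Longrightarrow> c \<cdot>\<^sub>v vec (n+1) (X z) = vec (n+1) (X (c \<cdot>\<^sub>v z))"
  by (auto simp: X_smult)

lemma W_carrier: "W \<subseteq> carrier_vec (n+1)" by (auto simp: W_def)

lemma W_add: assumes "v \<in> W" "w \<in> W" shows "v + w \<in> W"
proof -
  obtain a where a: "a \<in> carrier_vec (n+1)" "v = vec (n+1) (X a)" using \<open>v \<in> W\<close> by (rule W_E)
  obtain b where b: "b \<in> carrier_vec (n+1)" "w = vec (n+1) (X b)" using \<open>w \<in> W\<close> by (rule W_E)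
  show ?thesis by (rule W_I[of "a + b"]) (use a b in \<open>simp_all only: vec_X_add add_carrier_vec\<close>)
qed

lemma W_smult: assumes "v \<in> W" shows "c \<cdot>\<^sub>v v \<in> W"
proof -
  obtain a where a: "a \<in> carrier_vec (n+1)" "v = vec (n+1) (X a)" using \<open>v \<in> W\<close> by (rule W_E)
  show ?thesis by (rule W_I[of "c \<cdot>\<^sub>v a"]) (use a in \<open>simp_all only: vec_X_smult smult_carrier_vec\<close>)
qed

text \<open>A vector outside W would be separated from W by some y annihilating W; such a y has the
  form B u, against the assumption on w.\<close>

lemma W_eq_annihilator:
  assumes w: "w \<in> carrier_vec (n+1)" and 0: "\<And>z. z \<in> carrier_vec (n+1) \<Longrightarrow> (\<Sum>i\<le>n. Y z i * w $ i) = 0"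
  shows "w \<in> W"
proof (rule ccontr)
  assume "w \<notin> W"
  have "\<exists>y\<in>carrier_vec (n+1). (\<forall>v\<in>W. (\<Sum>i<n+1. y $ i * v $ i) = 0) \<and> (\<Sum>i<n+1. y $ i * w $ i) \<noteq> 0"
  proof (rule annihilator_separates_vec[OF _ _ _ _ w \<open>w \<notin> W\<close>])
    show "W \<subseteq> carrier_vec (n+1)" by (rule W_carrier)
    have "0\<^sub>v (n+1) = vec (n+1) (X (0\<^sub>v (n+1)))" using X_0 by auto
    then show "0\<^sub>v (n+1) \<in> W" by (rule W_I[OF zero_carrier_vec])
    show "v + w \<in> W" if "v \<in> W" "w \<in> W" for v w using that by (rule W_add)
    show "c \<cdot>\<^sub>v v \<in> W" if "v \<in> W" for v c using that by (rule W_smult)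
  qed
  then obtain y where y: "\<forall>v\<in>W. (\<Sum>i\<le>n. y $ i * v $ i) = 0" "(\<Sum>i\<le>n. y $ i * w $ i) \<noteq> 0"
    by (auto simp: lessThan_Suc_atMost)
  have "(\<Sum>i\<le>n. X z i * y $ i) = 0" if z: "z \<in> carrier_vec (n+1)" for z
  proof -
    have "vec (n+1) (X z) \<in> W" by (rule W_I[OF z refl])
    then have "(\<Sum>i\<le>n. y $ i * vec (n+1) (X z) $ i) = 0" using y(1) by blast
    then show ?thesis by (simp add: mult.commute)
  qed
  from annihilator[OF this] obtain z where z: "z \<in> carrier_vec (n+1)" "\<forall>i\<le>n. y $ i = Y z i" by auto
  then have "(\<Sum>i\<le>n. y $ i * w $ i) = (\<Sum>i\<le>n. Y z i * w $ i)" by (intro sum.cong) auto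
  then show False using y(2) 0[OF z(1)] by simp
qed

text \<open>The conjugate of the column span of $B$ is a complement of $W$, because the column span is
  orthogonal to $W$; this extends $A^T$ to an injective map on $\mathbb{C}^{n+1}$.\<close>

definition full_map :: "complex vec \<Rightarrow> complex vec"
  where "full_map z = vec (n+1) (\<lambda>i. X z i + cnj (Y (map_vec cnj z) i))"

lemma full_map_inj:
  assumes z: "z \<in> carrier_vec (n+1)" and 0: "full_map z = 0\<^sub>v (n+1)"
  shows "z = 0\<^sub>v (n+1)"
proof -
  let ?z = "map_vec cnj z"
  have cz: "?z \<in> carrier_vec (n+1)" using z by simp
  have eq: "X z i = - cnj (Y ?z i)" if "i \<le> n" for i
  proof -
    have "full_map z $ i = 0" unfolding 0 using that by simp
    then show ?thesis using that by (simp add: full_map_def eq_neg_iff_add_eq_0)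
  qed
  \<comment> \<open>Inserting the vanishing of \<open>full_map z\<close> into the orthogonality of z
    and its conjugate gives minus a sum of squared absolute values.\<close>
  have "(\<Sum>i\<le>n. X z i * Y ?z i) = (\<Sum>i\<le>n. - complex_of_real ((cmod (Y ?z i))\<^sup>2))"
    unfolding complex_norm_square by (rule sum.cong) (simp_all add: eq mult.commute)
  then have "complex_of_real (\<Sum>i\<le>n. (cmod (Y ?z i))\<^sup>2) = 0"
    using orthogonal[OF z cz] by (simp add: sum_negf)
  then have "(\<Sum>i\<le>n. (cmod (Y ?z i))\<^sup>2) = 0" using of_real_eq_0_iff by blast
  then have Y0: "Y ?z i = 0" if "i \<le> n" for i
    using that by (subst (asm) sum_nonneg_eq_0_iff) auto
  then have X0: "X z i = 0" if "i \<le> n" for i using that eq by simp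
  have "z $ j = 0" if "j < n + 1" for j
  proof (cases "j \<le> d")
    case True
    then show ?thesis using row_inj[OF z X0] by simp
  next
    case False
    then have "?z $ (d + 1 + (j - d - 1)) = 0" using that by (intro ker_inj[OF cz Y0]) auto
    then show ?thesis using False that z by simp
  qed
  then show ?thesis using z by (intro eq_vecI) auto
qed

lemma full_map_add:
  assumes "z \<in> carrier_vec (n+1)" "w \<in> carrier_vec (n+1)"
  shows "full_map (z + w) = full_map z + full_map w"
proof -
  have "map_vec cnj (z + w) = map_vec cnj z + map_vec cnj w" using assms by auto
  then show ?thesis using assms by (auto simp: full_map_def X_add Y_add)
qed

text \<open>Conjugating both the argument and the value of Y keeps the map linear over the complex
  numbers.\<close>

lemma full_map_smult:
  assumes "z \<in> carrier_vec (n+1)" shows "full_map (c \<cdot>\<^sub>v z) = c \<cdot>\<^sub>v full_map z"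
proof -
  have "map_vec cnj (c \<cdot>\<^sub>v z) = cnj c \<cdot>\<^sub>v map_vec cnj z" using assms by auto
  then show ?thesis using assms by (auto simp: full_map_def X_smult Y_smult distrib_left)
qed

lemma full_map_join_0: "full_map (join z (0\<^sub>v (n+1))) = vec (n+1) (X z)"
proof -
  have "Y (map_vec cnj (join z (0\<^sub>v (n+1)))) i = Y (0\<^sub>v (n+1)) i" for i
    by (rule Y_cong) (use d_less in \<open>auto simp: join_def\<close>)
  then have "cnj (Y (map_vec cnj (join z (0\<^sub>v (n+1)))) i) = 0" for i by (simp add: Y_0)
  then show ?thesis unfolding full_map_def X_join by simp
qed

text \<open>The first coordinate is the pivot of the flag, the conditions on X put the point into
  the torus, and the one on Y makes its conormal vector nonzero.\<close>

lemma generic_point: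
  obtains z where "z \<in> carrier_vec (n+1)" "z $ 0 \<noteq> 0" "\<And>i. i \<le> n \<Longrightarrow> X z i \<noteq> 0" "\<exists>i\<le>n. Y z i \<noteq> 0"
proof -
  obtain i0 where i0: "i0 \<le> n" "\<exists>z\<in>carrier_vec (n+1). Y z i0 \<noteq> 0" using ker_nonzero by auto
  let ?\<phi> = "\<lambda>k z. if k \<le> n then X z k else if k = n + 1 then z $ 0 else Y z i0"
  have "\<exists>a\<in>carrier_vec (n+1). \<forall>k\<in>{..n+2}. ?\<phi> k a \<noteq> 0"
  proof (rule common_nonzero)
    fix k assume k: "k \<in> {..n+2}"
    consider "k \<le> n" | "k = n + 1" | "k = n + 2" using k by fastforce
    then show "poly_on_lines (n+1) (?\<phi> k)"
      by cases (use poly_on_lines_form_fun[OF form_fun_X] poly_on_lines_form_fun[OF form_fun_Y]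
        poly_on_lines_coord[of 0 "n+1"] in simp_all)
    have "\<exists>a\<in>carrier_vec (n+1). a $ 0 \<noteq> (0::complex)" by (intro bexI[of _ "unit_vec (n+1) 0"]) auto
    then show "\<exists>a\<in>carrier_vec (n+1). ?\<phi> k a \<noteq> 0"
      using row_nonzero[of k] i0(2) k by (cases "k \<le> n"; cases "k = n + 1") auto
  qed simp
  then obtain a where a: "a \<in> carrier_vec (n+1)" "\<And>k. k \<le> n + 2 \<Longrightarrow> ?\<phi> k a \<noteq> 0" by auto
  show ?thesis
  proof (rule that[OF a(1)])
    show "a $ 0 \<noteq> 0" using a(2)[of "n+1"] by simp
    show "X a i \<noteq> 0" if "i \<le> n" for i using a(2)[of i] that by simp
    show "\<exists>i\<le>n. Y a i \<noteq> 0" using a(2)[of "n+2"] i0(1) by auto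
  qed
qed

text \<open>W is the member of index d of a flag, and the reciprocals form a chain F 0, ..., F n.
  Climbing from F 0 to F d gives the growth exponent d and thus the upper bound; the part from F d
  to F n is a chain of length n - d.\<close>

lemma variety_irreducible: "irreducible_closed n variety"
  and codim_variety: "codim n variety = enat (n - d)"
proof -
  obtain z where z: "z \<in> carrier_vec (n+1)" "z $ 0 \<noteq> 0" "\<And>i. i \<le> n \<Longrightarrow> X z i \<noteq> 0" using generic_point by metis
  define z0 where "z0 = join z (0\<^sub>v (n+1))"
  have "full_map z0 = vec (n+1) (X z)" unfolding z0_def by (rule full_map_join_0)
  then have z0: "z0 \<in> carrier_vec (n+1)" "z0 $ 0 \<noteq> 0" "\<forall>i\<le>n. full_map z0 $ i \<noteq> 0"
    using z by (auto simp: z0_def join_def)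
  have fm: "full_map w \<in> carrier_vec (n+1)" for w by (simp add: full_map_def)
  define F where "F = (\<lambda>j. zariski n closure_of (inv_points n (flag_space n full_map z0 j)))"
  have F: "irreducible_closed n (F j)" "j < n \<Longrightarrow> F j \<subset> F (Suc j)" for j
    unfolding F_def by (intro reciprocal_flag[OF fm full_map_add full_map_smult full_map_inj z0]; assumption)+
  have "flag_space n full_map z0 d = W"
  proof
    show "flag_space n full_map z0 d \<subseteq> W"
    proof
      fix v assume "v \<in> flag_space n full_map z0 d"
      then obtain w where w: "w \<in> carrier_vec (n+1)" "\<forall>i. d < i \<and> i \<le> n \<longrightarrow> w $ i * z0 $ 0 = z0 $ i * w $ 0" "v = full_map w"
        by (auto simp: flag_space_def)
      \<comment> \<open>The entries of z0 beyond d are zero and its first entry is not, so the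
        equations of the flag reduce to this.\<close>
      have "w $ i = 0" if "d < i" "i \<le> n" for i
        using w(2) that z0(2) by (auto simp: z0_def join_def)
      then have "w = join w (0\<^sub>v (n+1))" using w(1) by (intro eq_vecI) (auto simp: join_def)
      then have "v = vec (n+1) (X w)" using full_map_join_0 w(3) by metis
      then show "v \<in> W" by (rule W_I[OF w(1)])
    qed
    show "W \<subseteq> flag_space n full_map z0 d"
    proof
      fix v assume "v \<in> W"
      then obtain w where w: "w \<in> carrier_vec (n+1)" "v = vec (n+1) (X w)" by (rule W_E)
      have "v = full_map (join w (0\<^sub>v (n+1)))" using w full_map_join_0 by simp
      moreover have "\<forall>i. d < i \<and> i \<le> n \<longrightarrow> join w (0\<^sub>v (n+1)) $ i * z0 $ 0 = z0 $ i * join w (0\<^sub>v (n+1)) $ 0"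
        by (auto simp: z0_def join_def)
      ultimately show "v \<in> flag_space n full_map z0 d"
        unfolding flag_space_def using join_carrier by blast
    qed
  qed
  then have Fd: "F d = variety" by (simp add: F_def variety_def)
  then show irr: "irreducible_closed n variety" using F(1)[of d] by simp
  have "growth n (F j) j" if "j \<le> n" for j
    using that
  proof (induct j)
    case 0
    obtain p where "p \<in> F 0" using F(1)[of 0] by (auto simp: irreducible_closed_def)
    then show ?case by (rule growth_0[OF _ irreducible_closed_sub[OF F(1)]])
  next
    case (Suc j)
    then have "growth n (F (Suc j)) (j + 1)" by (intro growth_Suc[OF F(1) F(1) F(2)]) auto
    then show ?case by simp
  qed
  then have "growth n variety d" using Fd d_less by (metis less_imp_le)
  then have le: "codim n variety \<le> enat (n - d)" by (rule codim_le_of_growth[OF irr])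
  have "enat (n - d) \<le> codim n variety"
    by (rule codim_ge_of_chain[OF irr, of "\<lambda>i. F (d + i)"]) (use F Fd in auto)
  with le show "codim n variety = enat (n - d)" by (rule antisym)
qed

end

section \<open>Tangent spaces at points of the torus\<close>

lemma eventually_line_nonzero:
  fixes x w :: "nat \<Rightarrow> complex"
  assumes "\<And>i. i \<le> n \<Longrightarrow> x i \<noteq> 0"
  shows "eventually (\<lambda>s. \<forall>i\<le>n. x i + s * w i \<noteq> 0) (nhds 0)"
proof -
  let ?S = "\<Union>i\<le>n. {s. x i + s * w i = 0}"
  have "finite {s. x i + s * w i = 0}" if "i \<le> n" for i
  proof (rule finite_subset)
    show "{s. x i + s * w i = 0} \<subseteq> {- x i / w i}"
    proof
      fix s assume "s \<in> {s. x i + s * w i = 0}"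
      then have s: "x i + s * w i = 0" by simp
      have "w i \<noteq> 0" using s assms[OF that] by auto
      then show "s \<in> {- x i / w i}" using s by (simp add: field_simps eq_neg_iff_add_eq_0)
    qed
  qed simp
  then have "open (- ?S)" by (intro open_Compl finite_imp_closed) auto
  moreover have "0 \<in> - ?S" using assms by simp
  ultimately show ?thesis unfolding eventually_nhds by (intro exI[of _ "- ?S"]) auto
qed

lemma field_derivative_zero_of_eventually:
  fixes g :: "complex \<Rightarrow> complex"
  assumes "(g has_field_derivative D) (at 0)" "eventually (\<lambda>s. g s = 0) (nhds 0)"
  shows "D = 0"
proof -
  have "((\<lambda>_. 0) has_field_derivative D) (at (0::complex))"
    using assms(1) DERIV_cong_ev[OF refl assms(2) refl] by simp
  then show ?thesis by (rule DERIV_unique[OF _ DERIV_const])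
qed

context reciprocal_plane begin

lemma W_orthogonal:
  assumes "w \<in> W" "z \<in> carrier_vec (n+1)" shows "(\<Sum>i\<le>n. Y z i * w $ i) = 0"
proof -
  obtain a where a: "a \<in> carrier_vec (n+1)" "w = vec (n+1) (X a)" using \<open>w \<in> W\<close> by (rule W_E)
  have "(\<Sum>i\<le>n. Y z i * w $ i) = (\<Sum>i\<le>n. X a i * Y z i)" by (rule sum.cong) (simp_all add: a(2))
  then show ?thesis using orthogonal[OF a(1) assms(2)] by simp
qed

lemma variety_sub: "variety \<subseteq> proj_space n"
  using irreducible_closed_sub[OF variety_irreducible] .

lemma inv_point_mem: "w \<in> torus_part n W \<Longrightarrow> proj_pt (inv_vec n w) \<in> variety"
  using closure_of_subset[of "inv_points n W" "zariski n"] inv_points_sub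
  unfolding variety_def inv_points_def by auto

lemma vanishing_forms_variety:
  "f \<in> vanishing_forms n variety \<longleftrightarrow>
    (\<exists>k. homogeneous n k f) \<and> (\<forall>w\<in>torus_part n W. mp_eval f (inv_vec n w) = 0)"
proof -
  have "(\<forall>p\<in>variety. vanishes f p) \<longleftrightarrow> (\<forall>w\<in>torus_part n W. mp_eval f (inv_vec n w) = 0)"
    if f: "homogeneous n k f" for k
  proof
    assume "\<forall>p\<in>variety. vanishes f p"
    then show "\<forall>w\<in>torus_part n W. mp_eval f (inv_vec n w) = 0"
      using inv_point_mem vanishes_proj_pt[OF f inv_vec_carrier] by blast
  next
    assume "\<forall>w\<in>torus_part n W. mp_eval f (inv_vec n w) = 0"
    then have "\<forall>q\<in>inv_points n W. vanishes f q"
      using vanishes_proj_pt[OF f inv_vec_carrier] by (simp add: inv_points_def)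
    then show "\<forall>p\<in>variety. vanishes f p"
      unfolding variety_def using f zariski_closure_iff[OF inv_points_sub] by blast
  qed
  then show ?thesis unfolding vanishing_forms_def vanishes_def by blast
qed

text \<open>The coordinatewise inverse of w0 + s w1 stays on the variety for small s, and its
  velocity at s = 0 is - w1 / w0^2.\<close>

lemma tangent_direction:
  assumes f: "homogeneous n k f" and van: "\<forall>w\<in>torus_part n W. mp_eval f (inv_vec n w) = 0"
    and w0: "w0 \<in> torus_part n W" and w1: "w1 \<in> W"
  shows "(\<Sum>i\<le>n. mp_eval (mp_partial i f) (inv_vec n w0) * (w1 $ i * (inverse (w0 $ i))\<^sup>2)) = 0"
proof -
  have nz: "w0 $ i \<noteq> 0" if "i \<le> n" for i using w0 that by (simp add: torus_part_def)
  have c: "w0 \<in> carrier_vec (n+1)" "w1 \<in> carrier_vec (n+1)" "w0 \<in> W"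
    using w0 w1 W_carrier by (auto simp: torus_part_def)
  let ?F = "\<lambda>s. inv_vec n (w0 + s \<cdot>\<^sub>v w1)"
  have F0: "?F 0 = inv_vec n w0" using c by (auto simp: inv_vec_def)
  have "((\<lambda>s. mp_eval f (?F s)) has_field_derivative
     (\<Sum>i\<le>n. mp_eval (mp_partial i f) (?F 0) * (- (w1 $ i * (inverse (w0 $ i))\<^sup>2)))) (at 0)"
  proof (rule mp_eval_chain_rule[OF f])
    fix i assume i: "i \<le> n"
    have eq: "(\<lambda>s. ?F s $ i) = (\<lambda>s. inverse (w0 $ i + s * w1 $ i))"
      using i c by (auto simp: inv_vec_def)
    show "((\<lambda>s. ?F s $ i) has_field_derivative - (w1 $ i * (inverse (w0 $ i))\<^sup>2)) (at 0)"
      unfolding eq using nz[OF i] by (auto intro!: derivative_eq_intros simp: power2_eq_square)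
  qed
  moreover have "eventually (\<lambda>s. mp_eval f (?F s) = 0) (nhds 0)"
  proof (rule eventually_mono[OF eventually_line_nonzero[of n "\<lambda>i. w0 $ i" "\<lambda>i. w1 $ i", OF nz]])
    fix s assume "\<forall>i\<le>n. w0 $ i + s * w1 $ i \<noteq> 0"
    then have "w0 + s \<cdot>\<^sub>v w1 \<in> torus_part n W"
      using c W_add[OF c(3) W_smult[OF w1]] by (auto simp: torus_part_def)
    then show "mp_eval f (?F s) = 0" using van by blast
  qed
  ultimately have "(\<Sum>i\<le>n. mp_eval (mp_partial i f) (?F 0) * (- (w1 $ i * (inverse (w0 $ i))\<^sup>2))) = 0"
    by (rule field_derivative_zero_of_eventually)
  then show ?thesis unfolding F0 by (simp add: sum_negf)
qed

text \<open>The reciprocal form of the linear relation Y z is, near the point, the product P of the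
  coordinates times the sum Q of the terms Y z i / x_i. As Q vanishes at the point, the derivative
  is P Q' there whatever the derivative of P is, and P is nonzero.\<close>

lemma tangent_equation:
  assumes w0: "w0 \<in> torus_part n W" and z: "z \<in> carrier_vec (n+1)" and y: "y \<in> carrier_vec (n+1)"
    and tan: "\<And>f. f \<in> vanishing_forms n variety \<Longrightarrow>
      (\<Sum>i\<le>n. mp_eval (mp_partial i f) (inv_vec n w0) * y $ i) = 0"
  shows "(\<Sum>i\<le>n. Y z i * (y $ i * (w0 $ i)\<^sup>2)) = 0"
proof -
  let ?v = "inv_vec n w0"
  have nz: "w0 $ i \<noteq> 0" if "i \<le> n" for i using w0 that by (simp add: torus_part_def)
  have tv: "?v $ i \<noteq> 0" "inverse (?v $ i) = w0 $ i" if "i \<le> n" for i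
    using nz[OF that] that by (auto simp: inv_vec_def)
  obtain f where f: "homogeneous n n f"
    "\<And>v. v \<in> carrier_vec (n+1) \<Longrightarrow> mp_eval f v = (\<Sum>i\<le>n. Y z i * (\<Prod>j\<in>{..n} - {i}. v $ j))"
    using reciprocal_form[of n "Y z"] by blast
  have "mp_eval f (inv_vec n w) = 0" if w: "w \<in> torus_part n W" for w
  proof -
    have nw: "\<forall>j\<le>n. w $ j \<noteq> 0" "w \<in> W" using w by (auto simp: torus_part_def)
    show ?thesis
      using f(2)[OF inv_vec_carrier] reciprocal_form_eval[OF torus_inv_vec(1)[OF nw(1)], of "Y z"]
        torus_inv_vec(2)[OF nw(1)] W_orthogonal[OF nw(2) z] by simp
  qed
  then have "f \<in> vanishing_forms n variety" using f(1) vanishing_forms_variety by blast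
  from tan[OF this] have tan0: "(\<Sum>i\<le>n. mp_eval (mp_partial i f) ?v * y $ i) = 0" .
  let ?F = "\<lambda>s. ?v + s \<cdot>\<^sub>v y"
  let ?P = "\<lambda>s. \<Prod>j\<le>n. (?v $ j + s * y $ j)" and ?Q = "\<lambda>s. \<Sum>i\<le>n. Y z i * inverse (?v $ i + s * y $ i)"
  have F0: "?F 0 = ?v" using y by (auto simp: inv_vec_def)
  have d1: "((\<lambda>s. mp_eval f (?F s)) has_field_derivative (\<Sum>i\<le>n. mp_eval (mp_partial i f) (?F 0) * y $ i)) (at 0)"
  proof (rule mp_eval_chain_rule[OF f(1)])
    fix i assume i: "i \<le> n"
    have eq: "(\<lambda>s. ?F s $ i) = (\<lambda>s. ?v $ i + s * y $ i)" using i y by auto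
    show "((\<lambda>s. ?F s $ i) has_field_derivative y $ i) (at 0)"
      unfolding eq by (auto intro!: derivative_eq_intros)
  qed
  obtain P' where dP: "(?P has_field_derivative P') (at 0)"
  proof -
    have "(?P has_field_derivative (\<Sum>i\<le>n. y $ i * (\<Prod>j\<in>{..n} - {i}. (?v $ j + 0 * y $ j)))) (at 0)"
      by (rule has_field_derivative_prod) (auto intro!: derivative_eq_intros)
    then show ?thesis by (rule that)
  qed
  have dQ: "(?Q has_field_derivative (\<Sum>i\<le>n. Y z i * (- (y $ i * (w0 $ i)\<^sup>2)))) (at 0)"
  proof (rule DERIV_sum)
    fix i assume "i \<in> {..n}"
    then have i: "i \<le> n" by simp
    have "((\<lambda>s. inverse (?v $ i + s * y $ i)) has_field_derivative - (y $ i * (inverse (?v $ i))\<^sup>2)) (at 0)"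
      using tv(1)[OF i] by (auto intro!: derivative_eq_intros simp: power2_eq_square)
    then show "((\<lambda>s. Y z i * inverse (?v $ i + s * y $ i)) has_field_derivative Y z i * (- (y $ i * (w0 $ i)\<^sup>2))) (at 0)"
      unfolding tv(2)[OF i] by (rule DERIV_cmult)
  qed
  have Q0: "?Q 0 = 0"
  proof -
    have "?Q 0 = (\<Sum>i\<le>n. Y z i * w0 $ i)" by (rule sum.cong) (simp_all add: tv(2))
    then show ?thesis using W_orthogonal[of w0 z] w0 z by (simp add: torus_part_def)
  qed
  have dPQ: "((\<lambda>s. ?P s * ?Q s) has_field_derivative
      P' * ?Q 0 + (\<Sum>i\<le>n. Y z i * (- (y $ i * (w0 $ i)\<^sup>2))) * ?P 0) (at 0)"
    by (rule DERIV_mult[OF dP dQ])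
  have "eventually (\<lambda>s. mp_eval f (?F s) - ?P s * ?Q s = 0) (nhds 0)"
  proof (rule eventually_mono[OF eventually_line_nonzero[of n "\<lambda>i. ?v $ i" "\<lambda>i. y $ i", OF tv(1)]])
    fix s assume s: "\<forall>i\<le>n. ?v $ i + s * y $ i \<noteq> 0"
    have Fc: "?F s \<in> carrier_vec (n+1)" using y by (simp add: inv_vec_def)
    have Fi: "?F s $ i = ?v $ i + s * y $ i" if "i \<le> n" for i using that y by simp
    have "mp_eval f (?F s) = (\<Prod>j\<le>n. ?F s $ j) * (\<Sum>i\<le>n. Y z i * inverse (?F s $ i))"
      using f(2)[OF Fc] reciprocal_form_eval[of n "?F s" "Y z"] s y by (simp add: Fi)
    also have "\<dots> = ?P s * ?Q s"
      by (intro arg_cong2[of _ _ _ _ "(*)"] prod.cong sum.cong) (simp_all add: Fi)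
    finally show "mp_eval f (?F s) - ?P s * ?Q s = 0" by simp
  qed
  from field_derivative_zero_of_eventually[OF DERIV_diff[OF d1 dPQ] this]
  have "(\<Sum>i\<le>n. Y z i * (- (y $ i * (w0 $ i)\<^sup>2))) * ?P 0 = 0"
    unfolding F0 Q0 tan0 by simp
  moreover have "?P 0 \<noteq> 0" using tv(1) by simp
  ultimately have "(\<Sum>i\<le>n. Y z i * (- (y $ i * (w0 $ i)\<^sup>2))) = 0" by simp
  then show ?thesis by (simp add: sum_negf)
qed

lemma tangent_space_at_torus_point:
  assumes w0: "w0 \<in> torus_part n W"
  shows "tangent_cone_space n variety (proj_pt (inv_vec n w0)) =
    {vec (n+1) (\<lambda>i. w1 $ i * (inverse (w0 $ i))\<^sup>2) | w1. w1 \<in> W}" (is "?T = ?R")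
proof
  have nz: "w0 $ i \<noteq> 0" if "i \<le> n" for i using w0 that by (simp add: torus_part_def)
  show "?T \<subseteq> ?R"
  proof
    fix y assume "y \<in> ?T"
    then have y: "y \<in> carrier_vec (n+1)" and tan: "\<And>f. f \<in> vanishing_forms n variety \<Longrightarrow>
      (\<Sum>i\<le>n. mp_eval (mp_partial i f) (inv_vec n w0) * y $ i) = 0"
      using proj_ptI[of "inv_vec n w0"] by (auto simp: tangent_cone_space_def)
    let ?w = "vec (n+1) (\<lambda>i. y $ i * (w0 $ i)\<^sup>2)"
    have "?w \<in> W"
    proof (rule W_eq_annihilator)
      fix z :: "complex vec" assume z: "z \<in> carrier_vec (n+1)"
      show "(\<Sum>i\<le>n. Y z i * ?w $ i) = 0" using tangent_equation[OF w0 z y tan] by simp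
    qed simp
    moreover have "y = vec (n+1) (\<lambda>i. ?w $ i * (inverse (w0 $ i))\<^sup>2)"
      using y nz by (intro eq_vecI) (auto simp: power2_eq_square field_simps less_Suc_eq_le)
    ultimately show "y \<in> ?R" by blast
  qed
  show "?R \<subseteq> ?T"
  proof
    fix y assume "y \<in> ?R"
    then obtain w1 where w1: "w1 \<in> W" "y = vec (n+1) (\<lambda>i. w1 $ i * (inverse (w0 $ i))\<^sup>2)" by blast
    have "(\<Sum>i\<le>n. mp_eval (mp_partial i f) v * y $ i) = 0"
      if f: "f \<in> vanishing_forms n variety" and v: "v \<in> proj_pt (inv_vec n w0)" for f v
    proof -
      obtain k where k: "homogeneous n k f" and van: "\<forall>w\<in>torus_part n W. mp_eval f (inv_vec n w) = 0"
        using f vanishing_forms_variety by blast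
      obtain c where c: "v = c \<cdot>\<^sub>v inv_vec n w0" using v by (auto simp: proj_pt_def)
      have "(\<Sum>i\<le>n. mp_eval (mp_partial i f) v * y $ i) =
         (\<Sum>i\<le>n. c ^ (k - 1) * (mp_eval (mp_partial i f) (inv_vec n w0) * (w1 $ i * (inverse (w0 $ i))\<^sup>2)))"
        unfolding c w1(2)
        by (rule sum.cong) (simp_all add: homogeneous_smult[OF homogeneous_partial[OF k] inv_vec_carrier])
      also have "\<dots> = 0"
        unfolding sum_distrib_left[symmetric] tangent_direction[OF k van w0 w1(1)] by simp
      finally show ?thesis .
    qed
    moreover have "y \<in> carrier_vec (n+1)" using w1(2) by simp
    ultimately show "y \<in> ?T" unfolding tangent_cone_space_def by blast
  qed
qed

text \<open>The tangent space is the image of the injective matrix diag(w0^{-2}) A^T, hence of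
  dimension d + 1, and the variety has codimension n - d.\<close>

lemma torus_point_smooth:
  assumes w0: "w0 \<in> torus_part n W"
  shows "proj_pt (inv_vec n w0) \<in> smooth_points n variety"
proof -
  have nz: "w0 $ i \<noteq> 0" if "i \<le> n" for i using w0 that by (simp add: torus_part_def)
  define M where "M = mat (n+1) (d+1) (\<lambda>(i, j). A $$ (j, i) * (inverse (w0 $ i))\<^sup>2)"
  have M: "M \<in> carrier_mat (n+1) (d+1)" by (simp add: M_def)
  define ext where "ext = (\<lambda>t :: complex vec. vec (n+1) (\<lambda>i. if i \<le> d then t $ i else 0))"
  have Mt: "M *\<^sub>v t = vec (n+1) (\<lambda>i. X (ext t) i * (inverse (w0 $ i))\<^sup>2)" if t: "t \<in> carrier_vec (d+1)" for t
  proof (rule eq_vecI)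
    fix i assume "i < dim_vec (vec (n+1) (\<lambda>i. X (ext t) i * (inverse (w0 $ i))\<^sup>2))"
    then have i: "i < n + 1" by simp
    have "(M *\<^sub>v t) $ i = (\<Sum>j<d+1. A $$ (j, i) * (inverse (w0 $ i))\<^sup>2 * t $ j)"
      unfolding mult_mat_vec_index[OF M t i] by (rule sum.cong) (use i in \<open>auto simp: M_def\<close>)
    also have "\<dots> = (\<Sum>j<d+1. A $$ (j, i) * ext t $ j) * (inverse (w0 $ i))\<^sup>2"
      unfolding sum_distrib_right by (rule sum.cong) (use d_less in \<open>auto simp: ext_def\<close>)
    finally show "(M *\<^sub>v t) $ i = vec (n+1) (\<lambda>i. X (ext t) i * (inverse (w0 $ i))\<^sup>2) $ i"
      using i by (simp only: row_form_def index_vec)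
  qed (simp add: M_def)
  have extc: "ext t \<in> carrier_vec (n+1)" for t by (simp add: ext_def)
  have "{M *\<^sub>v t | t. t \<in> carrier_vec (d+1)} = {vec (n+1) (\<lambda>i. w1 $ i * (inverse (w0 $ i))\<^sup>2) | w1. w1 \<in> W}" (is "?L = ?R")
  proof
    show "?L \<subseteq> ?R"
    proof
      fix y assume "y \<in> ?L"
      then obtain t where t: "t \<in> carrier_vec (d+1)" "y = M *\<^sub>v t" by blast
      have "y = vec (n+1) (\<lambda>i. vec (n+1) (X (ext t)) $ i * (inverse (w0 $ i))\<^sup>2)" using t Mt by auto
      moreover have "vec (n+1) (X (ext t)) \<in> W" by (rule W_I[OF extc refl])
      ultimately show "y \<in> ?R" by blast
    qed
    show "?R \<subseteq> ?L"
    proof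
      fix y assume "y \<in> ?R"
      then obtain w1 where w1: "w1 \<in> W" "y = vec (n+1) (\<lambda>i. w1 $ i * (inverse (w0 $ i))\<^sup>2)" by blast
      from w1(1) obtain z where z: "z \<in> carrier_vec (n+1)" "w1 = vec (n+1) (X z)" by (rule W_E)
      let ?t = "vec (d+1) (\<lambda>i. z $ i)"
      have "X (ext ?t) i = X z i" for i by (rule X_cong) (use d_less in \<open>auto simp: ext_def\<close>)
      then have "M *\<^sub>v ?t = y" using Mt[of ?t] w1(2) z(2) by auto
      then show "y \<in> ?L" by (intro CollectI exI[of _ ?t]) auto
    qed
  qed
  then have T: "tangent_cone_space n variety (proj_pt (inv_vec n w0)) = {M *\<^sub>v t | t. t \<in> carrier_vec (d+1)}"
    using tangent_space_at_torus_point[OF w0] by simp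
  have "vec_space.rank (n+1) M = d + 1"
  proof (rule injective_mat_indpt(3)[OF M])
    fix t assume t: "t \<in> carrier_vec (d+1)" "M *\<^sub>v t = 0\<^sub>v (n+1)"
    have "X (ext t) i = 0" if "i \<le> n" for i
    proof -
      have "(M *\<^sub>v t) $ i = 0" using t(2) that by simp
      then show ?thesis using Mt[OF t(1)] that nz[OF that] by simp
    qed
    then have "ext t $ j = 0" if "j \<le> d" for j using row_inj[OF extc] that by blast
    then show "t = 0\<^sub>v (d+1)" using t(1) d_less by (intro eq_vecI) (auto simp: ext_def)
  qed
  then have "lin_dim (n+1) (tangent_cone_space n variety (proj_pt (inv_vec n w0))) = d + 1"
    unfolding T lin_dim_image[OF M] .
  then have "enat (lin_dim (n+1) (tangent_cone_space n variety (proj_pt (inv_vec n w0)))) + codim n variety = enat (n+1)"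
    unfolding codim_variety using d_less by simp
  then show ?thesis using inv_point_mem[OF w0] by (simp add: smooth_points_def)
qed

end

section \<open>Conormal vectors and the dual variety\<close>

context reciprocal_plane begin

definition psi :: "complex vec \<Rightarrow> nat \<Rightarrow> complex"
  where "psi z i = (X z i)\<^sup>2 * Y z i"

definition psi_domain :: "complex vec set"
  where "psi_domain = {z \<in> carrier_vec (n+1). (\<forall>i\<le>n. X z i \<noteq> 0) \<and> (\<exists>i\<le>n. Y z i \<noteq> 0)}"

definition conormal_points :: "complex vec set set"
  where "conormal_points = (\<lambda>z. proj_pt (vec (n+1) (psi z))) ` psi_domain"

abbreviation dual_closure :: "complex vec set set"
  where "dual_closure \<equiv> zariski n closure_of conormal_points"

lemma form_fun_psi: "form_fun n 3 (\<lambda>z. psi z i)"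
proof -
  have "form_fun n (2 * 1 + 1) (\<lambda>z. (X z i) ^ 2 * Y z i)"
    by (intro form_fun_mult form_fun_power form_fun_X form_fun_Y)
  then show ?thesis by (simp add: psi_def numeral_3_eq_3)
qed

lemmas poly_on_lines_X = poly_on_lines_form_fun[OF form_fun_X]
lemmas poly_on_lines_Y = poly_on_lines_form_fun[OF form_fun_Y]
lemmas poly_on_lines_psi = poly_on_lines_form_fun[OF form_fun_psi]

lemma psi_nonzero: assumes "z \<in> psi_domain" shows "vec (n+1) (psi z) \<noteq> 0\<^sub>v (n+1)"
proof
  assume 0: "vec (n+1) (psi z) = 0\<^sub>v (n+1)"
  obtain i where i: "i \<le> n" "Y z i \<noteq> 0" "X z i \<noteq> 0" using assms by (auto simp: psi_domain_def)
  have "vec (n+1) (psi z) $ i = 0" unfolding 0 using i by simp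
  then show False using i by (simp add: psi_def)
qed

lemma conormal_points_sub: "conormal_points \<subseteq> proj_space n"
  unfolding conormal_points_def using proj_pt_in_proj_space[OF vec_carrier psi_nonzero] by auto

lemma psi_domain_nonempty: "psi_domain \<noteq> {}"
  by (rule generic_point) (auto simp: psi_domain_def)

lemma line_open_psi_domain: "line_open (n+1) psi_domain"
proof (rule line_openI)
  show "psi_domain \<subseteq> carrier_vec (n+1)" by (auto simp: psi_domain_def)
  fix a b assume ab: "a \<in> psi_domain" "b \<in> psi_domain"
  then obtain i0 where i0: "i0 \<le> n" "Y a i0 \<noteq> 0" by (auto simp: psi_domain_def)
  show "\<exists>K. finite K \<and> (\<forall>\<chi>\<in>K. poly_on_lines (n+1) \<chi> \<and> \<chi> a \<noteq> 0) \<and>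
      (\<forall>s. (\<forall>\<chi>\<in>K. \<chi> (a + s \<cdot>\<^sub>v (b - a)) \<noteq> 0) \<longrightarrow> a + s \<cdot>\<^sub>v (b - a) \<in> psi_domain)"
    using ab i0 poly_on_lines_X poly_on_lines_Y
    by (intro exI[of _ "insert (\<lambda>z. Y z i0) ((\<lambda>i z. X z i) ` {..n})"]) (auto simp: psi_domain_def)
qed

lemma conormal_irreducible: "irreducible_closed n (dual_closure)"
  unfolding conormal_points_def
  using irreducible_closure_image[of "n+1" psi_domain n "\<lambda>i z. psi z i",
      OF line_open_psi_domain psi_domain_nonempty poly_on_lines_psi psi_nonzero] .

lemma poly_zero_of_psi_domain:
  assumes \<phi>: "poly_on_lines (n+1) \<phi>" and 0: "\<And>z. z \<in> psi_domain \<Longrightarrow> \<phi> z = 0"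
    and z: "z \<in> carrier_vec (n+1)"
  shows "\<phi> z = 0"
proof -
  obtain i0 where i0: "i0 \<le> n" "\<exists>z\<in>carrier_vec (n+1). Y z i0 \<noteq> 0" using ker_nonzero by auto
  let ?\<chi> = "\<lambda>k z. if k \<le> n then X z k else Y z i0"
  show ?thesis
  proof (rule eval_eq_zero_of_dense[OF \<phi>, of "{..n+1}" ?\<chi>])
    show "poly_on_lines (n+1) (?\<chi> k)" for k
      using poly_on_lines_X[of k] poly_on_lines_Y[of i0] by (cases "k \<le> n") simp_all
    show "\<exists>a\<in>carrier_vec (n+1). ?\<chi> k a \<noteq> 0" for k
      using row_nonzero[of k] i0(2) by (cases "k \<le> n") simp_all
    fix a :: "complex vec" assume a: "a \<in> carrier_vec (n+1)" "\<And>k. k \<in> {..n+1} \<Longrightarrow> ?\<chi> k a \<noteq> 0"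
    have "X a i \<noteq> 0" if "i \<le> n" for i using a(2)[of i] that by simp
    moreover have "Y a i0 \<noteq> 0" using a(2)[of "n+1"] by simp
    ultimately show "\<phi> a = 0" using a(1) i0(1) by (intro 0) (auto simp: psi_domain_def)
  qed (use z in simp_all)
qed

text \<open>\<open>psi_domain\<close> is dense on lines, so the condition extends to the whole
  vector space, including the zeros of psi. There psi can be differentiated in every
  direction.\<close>

lemma vanishes_conormal_iff:
  assumes g: "homogeneous n l g"
  shows "(\<forall>q\<in>conormal_points. vanishes g q) \<longleftrightarrow> (\<forall>z\<in>carrier_vec (n+1). mp_eval g (vec (n+1) (psi z)) = 0)"
proof
  assume a: "\<forall>q\<in>conormal_points. vanishes g q"
  show "\<forall>z\<in>carrier_vec (n+1). mp_eval g (vec (n+1) (psi z)) = 0"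
  proof
    fix z :: "complex vec" assume z: "z \<in> carrier_vec (n+1)"
    show "mp_eval g (vec (n+1) (psi z)) = 0"
    proof (rule poly_zero_of_psi_domain[OF _ _ z])
      show "poly_on_lines (n+1) (\<lambda>z. mp_eval g (vec (n+1) (psi z)))"
        using poly_on_lines_compose[OF g, of "n+1" "\<lambda>i z. psi z i"] poly_on_lines_psi by simp
      show "mp_eval g (vec (n+1) (psi z)) = 0" if "z \<in> psi_domain" for z
        using a that vanishes_proj_pt[OF g, of "vec (n+1) (psi z)"] by (auto simp: conormal_points_def)
    qed
  qed
next
  assume "\<forall>z\<in>carrier_vec (n+1). mp_eval g (vec (n+1) (psi z)) = 0"
  then show "\<forall>q\<in>conormal_points. vanishes g q"
    using vanishes_proj_pt[OF g, of "vec (n+1) (psi _)"]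
    by (auto simp: conormal_points_def psi_domain_def)
qed

definition dual_points :: "complex vec set set"
  where "dual_points = {q \<in> proj_space n. \<exists>p\<in>smooth_points n variety.
      \<forall>h\<in>q. \<forall>y\<in>tangent_cone_space n variety p. (\<Sum>i\<le>n. h $ i * y $ i) = 0}"

lemma dual_variety_eq: "dual_variety n variety = zariski n closure_of dual_points"
  by (simp add: dual_variety_def dual_points_def)

text \<open>Tangent vectors are w1 / x^2, so the factor x^2 of psi cancels and the orthogonality of
  B u to W remains.\<close>

lemma conormal_points_dual: "conormal_points \<subseteq> dual_points"
proof
  fix q assume "q \<in> conormal_points"
  then obtain z where z: "z \<in> psi_domain" "q = proj_pt (vec (n+1) (psi z))" by (auto simp: conormal_points_def)
  let ?w = "vec (n+1) (X z)"
  have zc: "z \<in> carrier_vec (n+1)" using z by (simp add: psi_domain_def)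
  have wW: "?w \<in> W" by (rule W_I[OF zc refl])
  have w: "?w \<in> torus_part n W" using z(1) wW by (auto simp: torus_part_def psi_domain_def)
  have "(\<Sum>i\<le>n. h $ i * y $ i) = 0"
    if h: "h \<in> q" and y: "y \<in> tangent_cone_space n variety (proj_pt (inv_vec n ?w))" for h y
  proof -
    obtain c where c: "h = c \<cdot>\<^sub>v vec (n+1) (psi z)" using h z(2) by (auto simp: proj_pt_def)
    obtain w1 where w1: "w1 \<in> W" "y = vec (n+1) (\<lambda>i. w1 $ i * (inverse (?w $ i))\<^sup>2)"
      using y unfolding tangent_space_at_torus_point[OF w] by blast
    have "(\<Sum>i\<le>n. h $ i * y $ i) = (\<Sum>i\<le>n. c * (Y z i * w1 $ i))"
      unfolding c w1(2)
      by (rule sum.cong) (use z(1) in \<open>auto simp: psi_def psi_domain_def power2_eq_square field_simps\<close>)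
    also have "\<dots> = 0" unfolding sum_distrib_left[symmetric] W_orthogonal[OF w1(1) zc] by simp
    finally show ?thesis .
  qed
  then show "q \<in> dual_points"
    using torus_point_smooth[OF w] conormal_points_sub \<open>q \<in> conormal_points\<close> unfolding dual_points_def by blast
qed

text \<open>The gradients at a fixed representative of a point form a linear space: two equations can be
  brought to the same degree by multiplying with powers of a linear form that is 1 at that
  representative.\<close>

lemma gradient_of_annihilator:
  assumes p: "p \<in> variety" "v \<in> p" and h: "h \<in> carrier_vec (n+1)"
    and ann: "\<And>y. y \<in> tangent_cone_space n variety p \<Longrightarrow> (\<Sum>i\<le>n. h $ i * y $ i) = 0"
  shows "\<exists>k f. homogeneous n k f \<and> (\<forall>w\<in>torus_part n W. mp_eval f (inv_vec n w) = 0) \<and>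
    (\<forall>i\<le>n. h $ i = mp_eval (mp_partial i f) v)"
proof -
  have pp: "p \<in> proj_space n" using p variety_sub by auto
  note v = proj_space_mem[OF pp p(2)]
  define I where "I = (\<lambda>k f. homogeneous n k f \<and> (\<forall>w\<in>torus_part n W. mp_eval f (inv_vec n w) = 0))"
  have I_vf: "f \<in> vanishing_forms n variety \<longleftrightarrow> (\<exists>k. I k f)" for f
    unfolding I_def vanishing_forms_variety by blast
  have Iv: "mp_eval f v = 0" if "I k f" for k f
  proof -
    have "f \<in> vanishing_forms n variety" using that I_vf by blast
    then show ?thesis using p unfolding vanishing_forms_def by blast
  qed
  define grad where "grad = (\<lambda>f. vec (n+1) (\<lambda>i. mp_eval (mp_partial i f) v))"
  define V where "V = {g. \<exists>k f. I k f \<and> g = grad f}"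
  have V_I: "g \<in> V" if "I k f" "g = grad f" for k f g
    unfolding V_def by (rule CollectI, rule exI[of _ k], rule exI[of _ f], rule conjI[OF that])
  obtain i0 where i0: "i0 \<le> n" "v $ i0 \<noteq> 0" using nonzero_vec_coord[OF v(1,2)] by (auto simp: less_Suc_eq_le)
  define l where "l = (single (single i0 1) (inverse (v $ i0)) :: mpoly)"
  have l: "homogeneous n 1 l" unfolding l_def using i0 by (intro homogeneous_single) auto
  have lv: "mp_eval l v = 1" using i0 by (simp add: l_def)
  \<comment> \<open>By the product rule, since f vanishes at v and l has the value 1 there.\<close>
  have mult: "I (k + j) (f * l ^ j)" "grad (f * l ^ j) = grad f" if f: "I k f" for f k j
  proof -
    have hf: "homogeneous n k f" using f by (simp add: I_def)
    have hl: "homogeneous n j (l ^ j)" using homogeneous_power[OF l, of j] by simp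
    show "I (k + j) (f * l ^ j)" using f homogeneous_mult[OF hf hl] by (auto simp: I_def)
    show "grad (f * l ^ j) = grad f"
    proof (rule eq_vecI)
      fix i assume "i < dim_vec (grad f)"
      then have i: "i \<le> n" "i < n + 1" by (simp_all add: grad_def)
      have "mp_eval (mp_partial i (f * l ^ j)) v = mp_eval (mp_partial i f) v"
        unfolding mp_partial_mult_eval[OF hf hl i(1) v(1)] using Iv[OF f] lv by simp
      then show "grad (f * l ^ j) $ i = grad f $ i" using i(2) by (simp add: grad_def)
    qed (simp add: grad_def)
  qed
  have "h \<in> V"
  proof (rule ccontr)
    assume "h \<notin> V"
    have "\<exists>y\<in>carrier_vec (n+1). (\<forall>g\<in>V. (\<Sum>i<n+1. y $ i * g $ i) = 0) \<and> (\<Sum>i<n+1. y $ i * h $ i) \<noteq> 0"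
    proof (rule annihilator_separates_vec[OF _ _ _ _ h \<open>h \<notin> V\<close>])
      show "V \<subseteq> carrier_vec (n+1)" by (auto simp: V_def grad_def)
      have "I 0 0" "0\<^sub>v (n+1) = grad 0"
        by (auto simp: I_def homogeneous_0 grad_def mp_partial_def)
      then show "0\<^sub>v (n+1) \<in> V" by (rule V_I)
      fix a assume "a \<in> V"
      then obtain k f where f: "I k f" "a = grad f" unfolding V_def by blast
      show "a + b \<in> V" if "b \<in> V" for b
      proof -
        obtain j g where g: "I j g" "b = grad g" using \<open>b \<in> V\<close> unfolding V_def by blast
        let ?f = "f * l ^ j" and ?g = "g * l ^ k"
        have If: "I (k + j) ?f" and Ig: "I (k + j) ?g" using mult(1)[OF f(1), of j] mult(1)[OF g(1), of k] by (simp_all add: add.commute)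
        then have hfg: "homogeneous n (k + j) ?f" "homogeneous n (k + j) ?g" by (simp_all add: I_def)
        have "I (k + j) (?f + ?g)" using If Ig homogeneous_add[OF hfg] unfolding I_def by (simp del: mp_eval_mult)
        moreover have "grad (?f + ?g) = grad ?f + grad ?g"
        proof (rule eq_vecI)
          fix i assume "i < dim_vec (grad ?f + grad ?g)"
          then have i: "i \<le> n" "i < n + 1" by (simp_all add: grad_def)
          show "grad (?f + ?g) $ i = (grad ?f + grad ?g) $ i"
            using mp_partial_add_eval[OF hfg i(1) v(1)] i(2) by (simp add: grad_def)
        qed (simp add: grad_def)
        then have "a + b = grad (?f + ?g)" using mult(2)[OF f(1)] mult(2)[OF g(1)] f(2) g(2) by simp
        ultimately show ?thesis by (rule V_I)
      qed
      show "c \<cdot>\<^sub>v a \<in> V" for c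
      proof -
        let ?c = "single 0 c :: mpoly"
        have hf: "homogeneous n k f" using f by (simp add: I_def)
        have hc: "homogeneous n 0 ?c" by (intro homogeneous_single) auto
        have "I k (f * ?c)" using f homogeneous_mult[OF hf hc] by (auto simp: I_def)
        moreover have "c \<cdot>\<^sub>v grad f = grad (f * ?c)"
        proof (rule eq_vecI)
          fix i assume "i < dim_vec (grad (f * ?c))"
          then have i: "i \<le> n" "i < n + 1" by (simp_all add: grad_def)
          show "(c \<cdot>\<^sub>v grad f) $ i = grad (f * ?c) $ i"
            using mp_partial_mult_eval[OF hf hc i(1) v(1)] Iv[OF f(1)] i(2) by (simp add: grad_def)
        qed (simp add: grad_def)
        ultimately show ?thesis unfolding f(2) by (rule V_I)
      qed
    qed
    then obtain y where y: "y \<in> carrier_vec (n+1)" "\<forall>g\<in>V. (\<Sum>i<n+1. y $ i * g $ i) = 0"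
      "(\<Sum>i<n+1. y $ i * h $ i) \<noteq> 0" by blast
    \<comment> \<open>The gradients at another representative are multiples of those at v, so y
      annihilates them all. Thus y is tangent, and h would have to vanish on it.\<close>
    have "(\<Sum>i\<le>n. mp_eval (mp_partial i f) v' * y $ i) = 0"
      if f: "f \<in> vanishing_forms n variety" and v': "v' \<in> p" for f v'
    proof -
      obtain k where k: "I k f" using f I_vf by blast
      then have hf: "homogeneous n k f" by (simp add: I_def)
      obtain c where c: "v' = c \<cdot>\<^sub>v v" using v' v(3) by (auto simp: proj_pt_def)
      have "grad f \<in> V" by (rule V_I[OF k refl])
      then have 0: "(\<Sum>i<n+1. y $ i * grad f $ i) = 0" using y(2) by blast
      have "(\<Sum>i\<le>n. mp_eval (mp_partial i f) v' * y $ i) = (\<Sum>i<n+1. c ^ (k - 1) * (y $ i * grad f $ i))"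
        unfolding c
        by (rule sum.cong) (auto simp: homogeneous_smult[OF homogeneous_partial[OF hf] v(1)] grad_def)
      then show ?thesis unfolding sum_distrib_left[symmetric] 0 by simp
    qed
    then have "y \<in> tangent_cone_space n variety p" using y(1) unfolding tangent_cone_space_def by blast
    from ann[OF this] show False using y(3) by (simp add: lessThan_Suc_atMost mult.commute)
  qed
  then obtain k f where kf: "I k f" "h = grad f" unfolding V_def by blast
  have "\<forall>i\<le>n. h $ i = mp_eval (mp_partial i f) v" using kf(2) by (simp add: grad_def)
  then show ?thesis using kf(1) unfolding I_def by blast
qed

text \<open>Substitute the gradient of f, whose value at v is h, into g. At inverted torus points
  the gradient is a value of psi, so the resulting form G vanishes there and hence on the whole
  variety; at v this says that g vanishes at h.\<close>

lemma dual_points_vanish: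
  assumes g: "homogeneous n l g" and van: "\<forall>z\<in>carrier_vec (n+1). mp_eval g (vec (n+1) (psi z)) = 0"
    and q: "q \<in> dual_points"
  shows "vanishes g q"
proof -
  obtain p where qp: "q \<in> proj_space n" "p \<in> variety"
    and ann: "\<And>h y. h \<in> q \<Longrightarrow> y \<in> tangent_cone_space n variety p \<Longrightarrow> (\<Sum>i\<le>n. h $ i * y $ i) = 0"
    using q unfolding dual_points_def smooth_points_def by blast
  obtain h where h: "h \<in> q" using proj_space_nonempty[OF qp(1)] by blast
  have pp: "p \<in> proj_space n" using qp(2) variety_sub by blast
  obtain v where v: "v \<in> p" using proj_space_nonempty[OF pp] by blast
  note hc = proj_space_mem[OF qp(1) h]
  obtain k f where f: "homogeneous n k f" "\<forall>w\<in>torus_part n W. mp_eval f (inv_vec n w) = 0"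
    "\<forall>i\<le>n. h $ i = mp_eval (mp_partial i f) v"
    using gradient_of_annihilator[OF qp(2) v hc(1) ann[OF h]] by blast
  let ?grad = "\<lambda>v. vec (n+1) (\<lambda>i. mp_eval (mp_partial i f) v)"
  have "form_fun n (l * (k - 1)) (\<lambda>v. mp_eval g (?grad v))"
    by (rule form_fun_compose[OF g form_fun_eval[OF homogeneous_partial[OF f(1)]]])
  then obtain G where G: "homogeneous n (l * (k - 1)) G"
    "\<And>v. v \<in> carrier_vec (n+1) \<Longrightarrow> mp_eval G v = mp_eval g (?grad v)"
    unfolding form_fun_def by blast
  have "mp_eval G (inv_vec n w) = 0" if w: "w \<in> torus_part n W" for w
  proof -
    have nz: "w $ i \<noteq> 0" if "i \<le> n" for i using w that by (simp add: torus_part_def)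
    obtain a where a: "a \<in> carrier_vec (n+1)" "w = vec (n+1) (X a)"
      using w by (auto simp: torus_part_def elim: W_E)
    let ?h = "?grad (inv_vec n w)"
    have "\<exists>b\<in>carrier_vec (n+1). \<forall>i\<le>n. mp_eval (mp_partial i f) (inv_vec n w) * (inverse (w $ i))\<^sup>2 = Y b i"
    proof (rule annihilator)
      fix z :: "complex vec" assume z: "z \<in> carrier_vec (n+1)"
      have "vec (n+1) (X z) \<in> W" by (rule W_I[OF z refl])
      from tangent_direction[OF f(1,2) w this]
      have "(\<Sum>i\<le>n. mp_eval (mp_partial i f) (inv_vec n w) * (X z i * (inverse (w $ i))\<^sup>2)) = 0" by simp
      then show "(\<Sum>i\<le>n. X z i * (mp_eval (mp_partial i f) (inv_vec n w) * (inverse (w $ i))\<^sup>2)) = 0"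
        by (simp add: mult_ac)
    qed
    then obtain b where b: "b \<in> carrier_vec (n+1)"
      "\<And>i. i \<le> n \<Longrightarrow> mp_eval (mp_partial i f) (inv_vec n w) * (inverse (w $ i))\<^sup>2 = Y b i" by blast
    have "vec (n+1) (psi (join a b)) = ?h"
    proof (rule eq_vecI)
      fix i assume "i < dim_vec ?h"
      then have i: "i \<le> n" "i < n + 1" by simp_all
      have "psi (join a b) i = (w $ i)\<^sup>2 * Y b i" using a(2) i by (simp add: psi_def X_join Y_join)
      also have "\<dots> = mp_eval (mp_partial i f) (inv_vec n w)"
        using nz[OF i(1)] by (simp add: b(2)[OF i(1), symmetric] power2_eq_square field_simps)
      finally show "vec (n+1) (psi (join a b)) $ i = ?h $ i" using i(2) by simp
    qed simp
    then have "mp_eval g ?h = 0" using van join_carrier by metis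
    then show ?thesis using G(2)[OF inv_vec_carrier] by simp
  qed
  then have "G \<in> vanishing_forms n variety" using G(1) vanishing_forms_variety by blast
  then have "mp_eval G v = 0" using qp(2) v unfolding vanishing_forms_def by blast
  then have "mp_eval g (?grad v) = 0" using G(2) proj_space_mem(1)[OF pp v] by simp
  moreover have "?grad v = h" using f(3) hc(1) by (intro eq_vecI) auto
  ultimately show ?thesis using vanishes_iff[OF g qp(1) h] by simp
qed

lemma dual_variety_conormal: "dual_variety n variety = dual_closure"
proof
  have D: "dual_points \<subseteq> proj_space n" by (auto simp: dual_points_def)
  show "dual_closure \<subseteq> dual_variety n variety"
    unfolding dual_variety_eq by (rule closure_of_mono[OF conormal_points_dual])
  have "dual_points \<subseteq> dual_closure"
  proof
    fix q assume q: "q \<in> dual_points"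
    show "q \<in> dual_closure"
      unfolding zariski_closure_iff[OF conormal_points_sub]
      using q D dual_points_vanish[OF _ _ q] vanishes_conormal_iff by blast
  qed
  then show "dual_variety n variety \<subseteq> dual_closure"
    unfolding dual_variety_eq by (rule closure_of_minimal) simp
qed

end

section \<open>The codimension of the dual variety\<close>

lemma irreducible_proj_space: "irreducible_closed n (proj_space n)"
proof -
  let ?U = "{t \<in> carrier_vec (n+1). vec (n+1) (\<lambda>i. t $ i) \<noteq> 0\<^sub>v (n+1)} :: complex vec set"
  have ident: "vec (n+1) (\<lambda>i. t $ i) = t" if "t \<in> carrier_vec (n+1)" for t :: "complex vec" using that by auto
  have line: "line_open (n+1) ?U" by (rule line_open_nonzero[OF poly_on_lines_coord]) simp
  have "unit_vec (n+1) 0 \<noteq> (0\<^sub>v (n+1) :: complex vec)" by (simp add: vec_eq_iff)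
  then have "unit_vec (n+1) 0 \<in> ?U" using ident[OF unit_vec_carrier] by simp
  then have ne: "?U \<noteq> {}" by blast
  have "irreducible_closed n (zariski n closure_of ((\<lambda>t. proj_pt (vec (n+1) (\<lambda>i. t $ i))) ` ?U))"
    by (rule irreducible_closure_image[OF line ne]) (use ident in \<open>auto intro: poly_on_lines_coord\<close>)
  also have "(\<lambda>t. proj_pt (vec (n+1) (\<lambda>i. t $ i))) ` ?U = proj_pt ` (carrier_vec (n+1) - {0\<^sub>v (n+1)})"
    by (rule image_cong) (use ident in auto)
  also have "\<dots> = proj_space n" by (simp add: proj_space_def projectivization_def)
  also have "zariski n closure_of proj_space n = proj_space n"
    using closure_of_topspace[of "zariski n"] by simp
  finally show ?thesis .
qed

text \<open>Vanishing at the origin excludes nonzero constants, so a vector where G is nonzero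
  represents a point.\<close>

lemma form_point_outside:
  assumes G: "homogeneous n k G" "G \<noteq> 0" "mp_eval G (0\<^sub>v (n+1)) = 0"
  obtains v where "v \<in> carrier_vec (n+1)" "v \<noteq> 0\<^sub>v (n+1)" "\<not> vanishes G (proj_pt v)"
proof -
  obtain v where v: "v \<in> carrier_vec (n+1)" "mp_eval G v \<noteq> 0" using zero_of_eval_zero[OF G(1)] G(2) by blast
  moreover from v G(3) have "v \<noteq> 0\<^sub>v (n+1)" by auto
  ultimately show ?thesis using vanishes_proj_pt[OF G(1)] that by blast
qed

context reciprocal_plane begin

text \<open>The entries of J_L(t, u) for the two blocks t and u of z; compare
  \<open>J_mat_jac\<close> and \<open>eval_J_generic\<close>.\<close>

definition jac :: "complex vec \<Rightarrow> complex mat"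
  where "jac z = mat (n+1) (n+1) (\<lambda>(i, j).
    if j < d + 1 then Y z i * A $$ (j, i) else X z i * B $$ (i, j - (d+1)))"

lemma jac_carrier: "jac z \<in> carrier_mat (n+1) (n+1)" by (simp add: jac_def)

lemma jac_mult:
  assumes w: "w \<in> carrier_vec (n+1)" and i: "i \<le> n"
  shows "(jac z *\<^sub>v w) $ i = Y z i * X w i + X z i * Y w i"
proof -
  have n1: "n + 1 = (d + 1) + (n - d)" using d_less by simp
  have "(jac z *\<^sub>v w) $ i = (\<Sum>j<n+1. jac z $$ (i, j) * w $ j)"
    using mult_mat_vec_index[OF jac_carrier w] i by simp
  also have "\<dots> = (\<Sum>j<n+1. (if j < d + 1 then Y z i * A $$ (j, i) else X z i * B $$ (i, j - (d+1))) * w $ j)"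
    by (rule sum.cong) (use i in \<open>auto simp: jac_def\<close>)
  also have "\<dots> = (\<Sum>j<d+1. (Y z i * A $$ (j, i)) * w $ j) + (\<Sum>j<n-d. (X z i * B $$ (i, j)) * w $ (d + 1 + j))"
    unfolding n1 sum_lessThan_add by (intro arg_cong2[of _ _ _ _ "(+)"] sum.cong) auto
  also have "\<dots> = Y z i * X w i + X z i * Y w i"
    unfolding row_form_def ker_form_def sum_distrib_left by (simp only: mult.assoc)
  finally show ?thesis .
qed

text \<open>The factor 2 comes from the square of X. Halving the t-block of the direction,
  \<open>join ((1/2) \<cdot>\<^sub>v w) w\<close>, turns this into X z i times the i-th entry of
  \<open>jac z *\<^sub>v w\<close>.\<close>

lemma psi_derivative:
  assumes "z \<in> carrier_vec (n+1)" "w \<in> carrier_vec (n+1)"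
  shows "((\<lambda>s. psi (z + s \<cdot>\<^sub>v w) i) has_field_derivative
    X z i * (2 * Y z i * X w i + X z i * Y w i)) (at 0)"
proof -
  have eq: "(\<lambda>s. psi (z + s \<cdot>\<^sub>v w) i) = (\<lambda>s. (X z i + s * X w i)\<^sup>2 * (Y z i + s * Y w i))"
    using assms by (simp add: psi_def X_add Y_add X_smult Y_smult)
  show ?thesis unfolding eq
    by (auto intro!: derivative_eq_intros simp: power2_eq_square algebra_simps)
qed

text \<open>Since psi has degree 2 in t and 1 in u, its differential at z kills the direction (t,
  -2u). At the origin every direction is killed, because psi vanishes there to third order.\<close>

lemma conormal_equation:
  "\<exists>k G. homogeneous n k G \<and> G \<noteq> 0 \<and> (\<forall>z\<in>carrier_vec (n+1). mp_eval G (vec (n+1) (psi z)) = 0)"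
proof -
  have "\<exists>k G. homogeneous n k G \<and> G \<noteq> 0 \<and> (\<forall>z\<in>carrier_vec (n+1). mp_eval G (vec (n+1) (\<lambda>i. psi z i)) = 0)"
  proof (rule deficient_forms_dependent[of 3])
    show "form_fun n 3 (\<lambda>z. psi z i)" for i by (rule form_fun_psi)
    fix z :: "complex vec" assume z: "z \<in> carrier_vec (n+1)"
    show "\<exists>w\<in>carrier_vec (n+1). w \<noteq> 0\<^sub>v (n+1) \<and>
      (\<forall>i\<le>n. ((\<lambda>s. psi (z + s \<cdot>\<^sub>v w) i) has_field_derivative 0) (at 0))"
    proof (cases "z = 0\<^sub>v (n+1)")
      case True
      let ?w = "unit_vec (n+1) 0 :: complex vec"
      have "?w $ 0 \<noteq> 0\<^sub>v (n+1) $ 0" by simp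
      then have "?w \<noteq> 0\<^sub>v (n+1)" by metis
      moreover have "X z i = 0" for i using True by (simp add: X_0)
      then have "((\<lambda>s. psi (z + s \<cdot>\<^sub>v ?w) i) has_field_derivative 0) (at 0)" for i
        using psi_derivative[OF z, of ?w i] by simp
      ultimately show ?thesis by (intro bexI[of _ ?w]) auto
    next
      case False
      let ?w = "join z ((-2) \<cdot>\<^sub>v z)"
      obtain j where j: "j < n + 1" "z $ j \<noteq> 0" using nonzero_vec_coord[OF z False] by auto
      then have "?w $ j \<noteq> 0\<^sub>v (n+1) $ j" using z by (auto simp: join_def)
      then have "?w \<noteq> 0\<^sub>v (n+1)" by metis
      moreover have "((\<lambda>s. psi (z + s \<cdot>\<^sub>v ?w) i) has_field_derivative 0) (at 0)" for i
        using psi_derivative[OF z join_carrier, of z "(-2) \<cdot>\<^sub>v z" i]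
        by (simp add: X_join Y_join Y_smult[OF z])
      ultimately show ?thesis using join_carrier by blast
    qed
  qed simp
  then show ?thesis by simp
qed

lemma psi_0: "vec (n+1) (psi (0\<^sub>v (n+1))) = 0\<^sub>v (n+1)"
  by (auto simp: psi_def X_0)

lemma conormal_proper:
  obtains q where "q \<in> carrier_vec (n+1)" "q \<noteq> 0\<^sub>v (n+1)" "proj_pt q \<notin> dual_closure"
proof -
  obtain k G where G: "homogeneous n k G" "G \<noteq> 0" "\<forall>z\<in>carrier_vec (n+1). mp_eval G (vec (n+1) (psi z)) = 0"
    using conormal_equation by blast
  have "mp_eval G (0\<^sub>v (n+1)) = 0" using G(3)[rule_format, OF zero_carrier_vec] unfolding psi_0 .
  then obtain v where v: "v \<in> carrier_vec (n+1)" "v \<noteq> 0\<^sub>v (n+1)" "\<not> vanishes G (proj_pt v)"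
    using form_point_outside[OF G(1,2)] by blast
  have "proj_pt v \<notin> dual_closure"
    using v(3) G(1,3) vanishes_conormal_iff[OF G(1)] zariski_closure_iff[OF conormal_points_sub] by blast
  then show ?thesis using that v by blast
qed

lemma conormal_psubset: "dual_closure \<subset> proj_space n"
proof -
  obtain q where "q \<in> carrier_vec (n+1)" "q \<noteq> 0\<^sub>v (n+1)" "proj_pt q \<notin> dual_closure"
    using conormal_proper by blast
  then have "proj_pt q \<in> proj_space n - dual_closure"
    using proj_pt_in_proj_space by blast
  moreover have "dual_closure \<subseteq> proj_space n"
    using irreducible_closed_sub[OF conormal_irreducible] .
  ultimately show ?thesis by blast
qed

lemma codim_dual_ge_1: "codim n (dual_closure) \<ge> enat 1"
  by (rule codim_ge_of_chain[OF conormal_irreducible, of "\<lambda>i. if i = 0 then dual_closure else proj_space n"])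
     (use conormal_irreducible irreducible_proj_space conormal_psubset in auto)

lemma poly_on_lines_minor: "poly_on_lines (n+1) (\<lambda>z. det (mat_delete (jac z) l c))"
proof -
  have D: "mat_delete (jac z) l c \<in> carrier_mat n n" for z
    using mat_delete_carrier[OF jac_carrier, of z l c] by simp
  have entry: "poly_on_lines (n+1) (\<lambda>z. mat_delete (jac z) l c $$ (i, j))" if "i < n" "j < n" for i j
  proof -
    let ?i = "if i < l then i else Suc i" and ?j = "if j < c then j else Suc j"
    have "(\<lambda>z. mat_delete (jac z) l c $$ (i, j)) =
      (\<lambda>z. if ?j < d + 1 then Y z ?i * A $$ (?j, ?i) else X z ?i * B $$ (?i, ?j - (d+1)))"
      using that by (auto simp: mat_delete_def jac_def fun_eq_iff)
    moreover have "poly_on_lines (n+1) (\<lambda>z. if ?j < d + 1 then Y z ?i * A $$ (?j, ?i) else X z ?i * B $$ (?i, ?j - (d+1)))"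
      by (cases "?j < d + 1") (simp_all only: if_True if_False poly_on_lines_mult[OF poly_on_lines_X poly_on_lines_const]
          poly_on_lines_mult[OF poly_on_lines_Y poly_on_lines_const])
    ultimately show ?thesis by simp
  qed
  have "poly_on_lines (n+1) (\<lambda>z. \<Sum>p\<in>{p. p permutes {0..<n}}. signof p * (\<Prod>i = 0..<n. mat_delete (jac z) l c $$ (i, p i)))"
  proof (intro poly_on_lines_sum poly_on_lines_mult poly_on_lines_const poly_on_lines_prod)
    fix p i assume "p \<in> {p. p permutes {0..<n}}" "i \<in> {0..<n}"
    then show "poly_on_lines (n+1) (\<lambda>z. mat_delete (jac z) l c $$ (i, p i))"
      using permutes_in_image[of p "{0..<n}" i] by (intro entry) auto
  qed
  then show ?thesis unfolding det_def'[OF D] .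
qed

text \<open>If a form in the variables other than $x_l$ vanishes on the image of $\psi$, so do its partial
  derivatives, because the rows of the Jacobian other than $l$ are generically independent.\<close>

lemma dual_growth:
  assumes z0: "z0 \<in> carrier_vec (n+1)" and l: "l \<le> n" and c: "c \<le> n"
    and minor: "det (mat_delete (jac z0) l c) \<noteq> 0"
  shows "growth n (dual_closure) (n - 1)"
proof (rule growth_of_independent_coordinates)
  let ?S = "{..n} - {l}"
  show "?S \<subseteq> {..n}" by blast
  show "card ?S = n - 1 + 1" using l d_less by simp
  fix k f assume f: "keys f \<subseteq> monomials ?S k"
    and van: "\<forall>p\<in>dual_closure. vanishes f p"
  have homS: "homogeneous n j g" if "keys g \<subseteq> monomials ?S j" for g j
    using that unfolding homogeneous_keys monomials_def by blast
  let ?V = "(\<lambda>z. vec (n+1) (psi z)) ` carrier_vec (n+1)"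
  show "f = 0"
  proof (rule zero_of_partials_vanish[OF _ _ f])
    show "?V \<noteq> {}" using zero_carrier_vec by blast
    have "\<forall>q\<in>conormal_points. vanishes f q"
      using van closure_of_subset[of conormal_points "zariski n"] conormal_points_sub by auto
    then show "\<forall>v\<in>?V. mp_eval f v = 0" using vanishes_conormal_iff[OF homS[OF f]] by blast
    fix j i v and g :: mpoly
    assume g: "keys g \<subseteq> monomials ?S j" "\<forall>v\<in>?V. mp_eval g v = 0" and i: "i \<in> ?S" and v: "v \<in> ?V"
    have hg: "homogeneous n j g" by (rule homS[OF g(1)])
    have gl: "mp_partial l g = 0"
    proof (rule poly_mapping_eqI, rule ccontr)
      fix m assume "lookup (mp_partial l g) m \<noteq> lookup 0 m"
      then have "m + single l 1 \<in> keys g" by (simp add: lookup_partial in_keys_iff)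
      then have "keys (m + single l 1) \<subseteq> ?S" using g(1) by (auto simp: monomials_def)
      then show False by (simp add: keys_add_nat)
    qed
    obtain z where z: "z \<in> carrier_vec (n+1)" "v = vec (n+1) (psi z)" using v by blast
    let ?\<phi> = "\<lambda>z. mp_eval (mp_partial i g) (vec (n+1) (psi z))"
    let ?\<chi> = "\<lambda>k z. if k \<le> n then X z k else det (mat_delete (jac z) l c)"
    have "?\<phi> z = 0"
    proof (rule eval_eq_zero_of_dense[of "n+1" ?\<phi> "{..n+1}" ?\<chi>])
      show "poly_on_lines (n+1) ?\<phi>"
        using poly_on_lines_compose[OF homogeneous_partial[OF hg], of "n+1" "\<lambda>i z. psi z i"] poly_on_lines_psi by simp
      show "poly_on_lines (n+1) (?\<chi> k)" for k
        using poly_on_lines_X[of k] poly_on_lines_minor[of l c] by (cases "k \<le> n") simp_all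
      show "\<exists>a\<in>carrier_vec (n+1). ?\<chi> k a \<noteq> 0" for k
        using row_nonzero[of k] z0 minor by (cases "k \<le> n") auto
      fix a :: "complex vec" assume a: "a \<in> carrier_vec (n+1)" "\<And>k. k \<in> {..n+1} \<Longrightarrow> ?\<chi> k a \<noteq> 0"
      have Xa: "X a i \<noteq> 0" if "i \<le> n" for i using a(2)[of i] that by simp
      have det: "det (mat_delete (jac a) l c) \<noteq> 0" using a(2)[of "n+1"] by simp
      \<comment> \<open>The differential of psi is X times \<open>jac\<close>, up to halving the
        t-block, so g(psi) = 0 makes y a left null vector of \<open>jac a\<close>. The entries of X
        are nonzero at a, hence y = 0 suffices.\<close>
      define y where "y = (\<lambda>i. mp_eval (mp_partial i g) (vec (n+1) (psi a)) * X a i)"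
      have yl: "y l = 0" by (simp add: y_def gl)
      have yJ: "(\<Sum>i\<le>n. y i * (jac a *\<^sub>v w) $ i) = 0" if w: "w \<in> carrier_vec (n+1)" for w
      proof -
        let ?w = "join ((1/2) \<cdot>\<^sub>v w) w"
        have a0: "a + 0 \<cdot>\<^sub>v ?w = a" using a(1) by (auto simp: join_def)
        have "((\<lambda>s. mp_eval g (vec (n+1) (psi (a + s \<cdot>\<^sub>v ?w)))) has_field_derivative
          (\<Sum>i\<le>n. mp_eval (mp_partial i g) (vec (n+1) (psi (a + 0 \<cdot>\<^sub>v ?w))) * (X a i * (2 * Y a i * X ?w i + X a i * Y ?w i)))) (at 0)"
        proof (rule mp_eval_chain_rule[OF hg])
          fix i assume "i \<le> n"
          then show "((\<lambda>s. vec (n+1) (psi (a + s \<cdot>\<^sub>v ?w)) $ i) has_field_derivative X a i * (2 * Y a i * X ?w i + X a i * Y ?w i)) (at 0)"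
            using psi_derivative[OF a(1) join_carrier, of "(1/2) \<cdot>\<^sub>v w" w i] by simp
        qed
        moreover have "(\<lambda>s. mp_eval g (vec (n+1) (psi (a + s \<cdot>\<^sub>v ?w)))) = (\<lambda>_. 0)"
          using g(2) a(1) join_carrier by (intro ext) (simp only: ball_simps(9) add_carrier_vec smult_carrier_vec)
        ultimately have d0: "((\<lambda>_. 0) has_field_derivative
          (\<Sum>i\<le>n. mp_eval (mp_partial i g) (vec (n+1) (psi (a + 0 \<cdot>\<^sub>v ?w))) * (X a i * (2 * Y a i * X ?w i + X a i * Y ?w i)))) (at (0::complex))"
          by (simp only:)
        have "(\<Sum>i\<le>n. y i * (jac a *\<^sub>v w) $ i) =
          (\<Sum>i\<le>n. mp_eval (mp_partial i g) (vec (n+1) (psi (a + 0 \<cdot>\<^sub>v ?w))) * (X a i * (2 * Y a i * X ?w i + X a i * Y ?w i)))"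
          unfolding a0
          by (rule sum.cong) (simp_all add: y_def jac_mult[OF w] X_join Y_join X_smult[OF w])
        then show ?thesis using DERIV_unique[OF d0 DERIV_const] by simp
      qed
      have D: "mat_delete (jac a) l c \<in> carrier_mat n n"
        using mat_delete_carrier[OF jac_carrier, of a l c] by simp
      let ?y = "vec n (\<lambda>r. y (insert_index l r))"
      \<comment> \<open>The entry of y at l is zero, so testing on the unit vectors other than the
        one at c gives a left null vector of the invertible minor.\<close>
      have "(mat_delete (jac a) l c)\<^sup>T *\<^sub>v ?y = 0\<^sub>v n"
      proof (rule eq_vecI)
        fix s assume "s < dim_vec (0\<^sub>v n :: complex vec)"
        then have s: "s < n" by simp
        have T: "(mat_delete (jac a) l c)\<^sup>T \<in> carrier_mat n n" using D by simp
        have col: "insert_index c s < n + 1" using s by (simp add: insert_index_def)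
        have "((mat_delete (jac a) l c)\<^sup>T *\<^sub>v ?y) $ s = (\<Sum>r<n. mat_delete (jac a) l c $$ (r, s) * y (insert_index l r))"
          unfolding mult_mat_vec_index[OF T vec_carrier s] by (rule sum.cong) (use carrier_matD[OF D] s in auto)
        also have "\<dots> = (\<Sum>r<n. jac a $$ (insert_index l r, insert_index c s) * y (insert_index l r))"
          using mat_delete_index[of "jac a" n l c _ s] jac_carrier l c s by (intro sum.cong) auto
        also have "\<dots> = (\<Sum>i\<in>{..n} - {l}. jac a $$ (i, insert_index c s) * y i)"
          by (rule sum_insert_index[OF l, symmetric])
        also have "\<dots> = (\<Sum>i\<le>n. y i * (jac a *\<^sub>v unit_vec (n+1) (insert_index c s)) $ i)"
        proof (rule sum.mono_neutral_cong_left)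
          fix i assume "i \<in> {..n} - {l}"
          then show "jac a $$ (i, insert_index c s) * y i = y i * (jac a *\<^sub>v unit_vec (n+1) (insert_index c s)) $ i"
            using col jac_carrier[of a] by (simp add: mat_mult_unit_vec[OF jac_carrier col])
        qed (use yl in auto)
        also have "\<dots> = 0" by (rule yJ) simp
        finally show "((mat_delete (jac a) l c)\<^sup>T *\<^sub>v ?y) $ s = 0\<^sub>v n $ s" using s by simp
      qed (use carrier_matD[OF D] in simp)
      moreover have "det ((mat_delete (jac a) l c)\<^sup>T) \<noteq> 0" using det det_transpose[OF D] by simp
      ultimately have y0: "?y = 0\<^sub>v n"
        using det_0_iff_vec_prod_zero_field[of "(mat_delete (jac a) l c)\<^sup>T" n] D vec_carrier by (metis transpose_carrier_mat)
      have "i \<in> insert_index l ` {..<n}" using i insert_index_image[OF l] by simp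
      then obtain r where r: "r < n" "i = insert_index l r" by blast
      have "?y $ r = 0" unfolding y0 using r by simp
      then have "y i = 0" using r by simp
      then show "?\<phi> a = 0" using Xa[of i] i by (simp add: y_def)
    qed (use z in simp_all)
    then show "mp_eval (mp_partial i g) v = 0" using z(2) by simp
  qed
qed

lemma codim_dual_eq_1:
  assumes "z0 \<in> carrier_vec (n+1)" "l \<le> n" "c \<le> n" "det (mat_delete (jac z0) l c) \<noteq> 0"
  shows "codim n (dual_closure) = enat 1"
proof -
  have "codim n (dual_closure) \<le> enat (n - (n - 1))"
    by (rule codim_le_of_growth[OF conormal_irreducible dual_growth[OF assms]])
  moreover have "n - (n - 1) = 1" using d_less by simp
  ultimately show ?thesis using codim_dual_ge_1 by simp
qed

text \<open>If $\psi$ never has rank $n$, then the cone over the dual variety with vertex \<open>q\<close> is a proper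
  subvariety: it is the closure of the image of $\psi(z) + z_0^3 q$, whose differential has the same
  kernel as that of $\psi$ on the hyperplane of tangent vectors with first coordinate 0.\<close>

lemma codim_dual_ge_2:
  assumes minors: "\<And>z l c. z \<in> carrier_vec (n+1) \<Longrightarrow> l \<le> n \<Longrightarrow> c \<le> n \<Longrightarrow> det (mat_delete (jac z) l c) = 0"
  shows "codim n (dual_closure) \<ge> enat 2"
proof -
  let ?D = "dual_closure"
  obtain q where q: "q \<in> carrier_vec (n+1)" "q \<noteq> 0\<^sub>v (n+1)" "proj_pt q \<notin> ?D" using conormal_proper by blast
  \<comment> \<open>The exponent 3 gives the added term the degree of psi, so each component is
    again a form.\<close>
  define \<Phi> where "\<Phi> = (\<lambda>i z. psi z i + q $ i * (z $ 0) ^ 3)"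
  let ?\<Phi> = "\<lambda>z. vec (n+1) (\<lambda>i. \<Phi> i z)"
  have form: "form_fun n 3 (\<Phi> i)" for i
  proof -
    have "form_fun n (3 * 1) (\<lambda>z. (z $ 0) ^ 3)" by (intro form_fun_power form_fun_coord) simp
    then show ?thesis unfolding \<Phi>_def by (intro form_fun_add form_fun_psi form_fun_cmult) simp
  qed
  note pol = poly_on_lines_form_fun[OF form]
  have \<Phi>0: "?\<Phi> (0\<^sub>v (n+1)) = 0\<^sub>v (n+1)" by (auto simp: \<Phi>_def psi_def X_0)
  have "\<exists>k G. homogeneous n k G \<and> G \<noteq> 0 \<and> (\<forall>z\<in>carrier_vec (n+1). mp_eval G (?\<Phi> z) = 0)"
  proof (rule deficient_forms_dependent[of 3])
    show "form_fun n 3 (\<Phi> i)" for i by (rule form)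
    fix z :: "complex vec" assume z: "z \<in> carrier_vec (n+1)"
    \<comment> \<open>By \<open>det_mat_delete_nonzero\<close> for column 0, the vanishing of these
      minors yields a nonzero kernel vector with first coordinate 0; along it the added term is
      constant.\<close>
    have "\<not> (\<exists>l\<le>n. det (mat_delete (jac z) l 0) \<noteq> 0)" using minors[OF z, of _ 0] by auto
    then obtain w where w: "w \<in> carrier_vec (n+1)" "jac z *\<^sub>v w = 0\<^sub>v (n+1)" "w $ 0 = 0" "w \<noteq> 0\<^sub>v (n+1)"
      using det_mat_delete_nonzero[OF jac_carrier[of z], of 0] by blast
    let ?w = "join ((1/2) \<cdot>\<^sub>v w) w"
    obtain j where j: "j < n + 1" "w $ j \<noteq> 0" using nonzero_vec_coord[OF w(1,4)] by auto
    then have "?w $ j \<noteq> 0\<^sub>v (n+1) $ j" using w(1) by (auto simp: join_def)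
    then have "?w \<noteq> 0\<^sub>v (n+1)" by metis
    moreover have "((\<lambda>s. \<Phi> i (z + s \<cdot>\<^sub>v ?w)) has_field_derivative 0) (at 0)" if i: "i \<le> n" for i
    proof -
      have "(jac z *\<^sub>v w) $ i = 0" unfolding w(2) using i by simp
      then have J: "Y z i * X w i + X z i * Y w i = 0" using jac_mult[OF w(1) i] by simp
      have "((\<lambda>s. psi (z + s \<cdot>\<^sub>v ?w) i) has_field_derivative 0) (at 0)"
        using psi_derivative[OF z join_carrier, of "(1/2) \<cdot>\<^sub>v w" w i] J
        by (simp add: X_join Y_join X_smult[OF w(1)])
      from DERIV_add[OF this DERIV_const[of "q $ i * (z $ 0) ^ 3"]]
      have "((\<lambda>s. psi (z + s \<cdot>\<^sub>v ?w) i + q $ i * (z $ 0) ^ 3) has_field_derivative 0) (at 0)" by simp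
      moreover have "(z + s \<cdot>\<^sub>v ?w) $ 0 = z $ 0" for s using z w(1,3) by (simp add: join_def)
      ultimately show ?thesis unfolding \<Phi>_def by (simp only:)
    qed
    ultimately show "\<exists>w\<in>carrier_vec (n+1). w \<noteq> 0\<^sub>v (n+1) \<and>
      (\<forall>i\<le>n. ((\<lambda>s. \<Phi> i (z + s \<cdot>\<^sub>v w)) has_field_derivative 0) (at 0))"
      using join_carrier by blast
  qed simp
  then obtain k G where G: "homogeneous n k G" "G \<noteq> 0" "\<And>z. z \<in> carrier_vec (n+1) \<Longrightarrow> mp_eval G (?\<Phi> z) = 0"
    by blast
  define U where "U = {z \<in> carrier_vec (n+1). ?\<Phi> z \<noteq> 0\<^sub>v (n+1)}"
  define S where "S = (\<lambda>z. proj_pt (?\<Phi> z)) ` U"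
  have Unz: "?\<Phi> z \<noteq> 0\<^sub>v (n+1)" if "z \<in> U" for z using that by (simp add: U_def)
  have S: "S \<subseteq> proj_space n" using proj_pt_in_proj_space[OF vec_carrier Unz] by (auto simp: S_def)
  have line: "line_open (n+1) U" unfolding U_def by (rule line_open_nonzero[OF pol])
  \<comment> \<open>The u-block of this vector is zero, so psi vanishes and \<Phi> takes the value
    q: the vertex belongs to the cone.\<close>
  let ?e = "unit_vec (n+1) 0 :: complex vec"
  have "Y ?e i = Y (0\<^sub>v (Suc n)) i" for i by (rule Y_cong) (use d_less in auto)
  then have \<Phi>e: "?\<Phi> ?e = q" using q(1) by (intro eq_vecI) (auto simp: \<Phi>_def psi_def Y_0)
  have eU: "?e \<in> U" using \<Phi>e q(2) by (simp add: U_def)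
  have irr: "irreducible_closed n (zariski n closure_of S)"
    unfolding S_def by (rule irreducible_closure_image[OF line _ pol Unz]) (use eU in auto)
  have Scl: "S \<subseteq> zariski n closure_of S" using S by (simp add: closure_of_subset)
  have qS: "proj_pt q \<in> S" using eU \<Phi>e unfolding S_def by (metis image_eqI)
  have "vanishes G p" if "p \<in> S" for p
    using that G(3) vanishes_proj_pt[OF G(1) vec_carrier] by (auto simp: S_def U_def)
  then have GS: "vanishes G p" if "p \<in> zariski n closure_of S" for p
    using that G(1) unfolding zariski_closure_iff[OF S] by blast
  have "mp_eval G (0\<^sub>v (n+1)) = 0" using G(3)[OF zero_carrier_vec] unfolding \<Phi>0 .
  then obtain v where v: "v \<in> carrier_vec (n+1)" "v \<noteq> 0\<^sub>v (n+1)" "\<not> vanishes G (proj_pt v)"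
    using form_point_outside[OF G(1,2)] by blast
  then have ne: "proj_pt v \<in> proj_space n" "proj_pt v \<notin> zariski n closure_of S"
    using GS proj_pt_in_proj_space by blast+
  have sub: "conormal_points \<subseteq> zariski n closure_of S"
  proof
    fix p assume p: "p \<in> conormal_points"
    show "p \<in> zariski n closure_of S" unfolding zariski_closure_iff[OF S]
    proof (intro conjI allI impI)
      show "p \<in> proj_space n" using p conormal_points_sub by blast
      fix j g assume g: "homogeneous n j g" "\<forall>q\<in>S. vanishes g q"
      \<comment> \<open>Scaling q by 0 shows that g vanishes at the origin, even if its degree is 0.
        This covers the parameters where \<Phi> is zero.\<close>
      have gq: "mp_eval g q = 0" using g(2) qS vanishes_proj_pt[OF g(1) q(1)] by blast
      have "mp_eval g (0 \<cdot>\<^sub>v q) = 0" unfolding homogeneous_smult[OF g(1) q(1)] gq by simp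
      moreover have "0 \<cdot>\<^sub>v q = 0\<^sub>v (n+1)" using q(1) by auto
      ultimately have g0: "mp_eval g (0\<^sub>v (n+1)) = 0" by (simp only:)
      have g\<Phi>: "mp_eval g (?\<Phi> z) = 0" if z: "z \<in> carrier_vec (n+1)" for z
      proof (cases "z \<in> U")
        case True
        then have "vanishes g (proj_pt (?\<Phi> z))" using g(2) unfolding S_def by blast
        then show ?thesis unfolding vanishes_proj_pt[OF g(1) vec_carrier] .
      next
        case False
        then have "?\<Phi> z = 0\<^sub>v (n+1)" using z by (simp add: U_def)
        then show ?thesis using g0 by (simp only:)
      qed
      have "mp_eval g (vec (n+1) (psi z)) = 0" if z: "z \<in> carrier_vec (n+1)" for z
      proof (rule eval_eq_zero_of_dense[of "n+1" "\<lambda>z. mp_eval g (vec (n+1) (psi z))" "{()}" "\<lambda>_ z. z $ 0", OF _ _ _ _ _ z])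
        show "poly_on_lines (n+1) (\<lambda>z. mp_eval g (vec (n+1) (psi z)))"
          using poly_on_lines_compose[OF g(1), of "n+1" "\<lambda>i z. psi z i"] poly_on_lines_psi by simp
        show "poly_on_lines (n+1) (\<lambda>z. z $ 0)" by (rule poly_on_lines_coord) simp
        show "\<exists>a\<in>carrier_vec (n+1). a $ 0 \<noteq> (0::complex)" by (intro bexI[of _ ?e]) auto
        fix a :: "complex vec" assume a: "a \<in> carrier_vec (n+1)" "\<And>k. k \<in> {()} \<Longrightarrow> a $ 0 \<noteq> 0"
        then have a0: "a $ 0 \<noteq> 0" by simp
        let ?p = "vec (n+1) (psi a)" and ?b = "?\<Phi> a"
        show "mp_eval g ?p = 0"
        proof (rule ccontr)
          assume "mp_eval g ?p \<noteq> 0"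
          then have fin: "finite {s. mp_eval g (?p + s \<cdot>\<^sub>v (?b - ?p)) = 0}"
            by (intro poly_on_lines_finite_zeros[OF poly_on_lines_form_fun[OF form_fun_eval[OF g(1)]]]) auto
          \<comment> \<open>Replacing (t, u) by (r t, r^{-2} u) fixes psi and multiplies the added
            term by r^3. With r = 1, 2, 3, ... a polynomial in one variable gets infinitely many
            zeros, so it also vanishes at 0, where its value is g(psi).\<close>
          have "mp_eval g (?p + (of_nat (Suc m)) ^ 3 \<cdot>\<^sub>v (?b - ?p)) = 0" for m
          proof -
            let ?r = "of_nat (Suc m) :: complex"
            let ?a = "join (?r \<cdot>\<^sub>v a) ((inverse ?r)\<^sup>2 \<cdot>\<^sub>v a)"
            have r: "?r \<noteq> 0" by (simp del: of_nat_Suc)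
            have "psi ?a i = psi a i" for i
              using r by (simp add: psi_def X_join Y_join X_smult[OF a(1)] Y_smult[OF a(1)] power_mult_distrib power2_eq_square field_simps del: of_nat_Suc)
            moreover have "?a $ 0 = ?r * a $ 0" using a(1) by (simp add: join_def)
            ultimately have "?\<Phi> ?a = ?p + ?r ^ 3 \<cdot>\<^sub>v (?b - ?p)"
              by (intro eq_vecI) (auto simp: \<Phi>_def power_mult_distrib simp del: of_nat_Suc)
            then show ?thesis using g\<Phi>[OF join_carrier] by metis
          qed
          then have "range (\<lambda>m. (of_nat (Suc m)) ^ 3 :: complex) \<subseteq> {s. mp_eval g (?p + s \<cdot>\<^sub>v (?b - ?p)) = 0}" by blast
          then have "finite (range (\<lambda>m. (of_nat (Suc m)) ^ 3 :: complex))" using fin finite_subset by blast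
          moreover have "inj (\<lambda>m. (of_nat (Suc m)) ^ 3 :: complex)"
          proof (rule injI)
            fix m m' assume "(of_nat (Suc m)) ^ 3 = ((of_nat (Suc m')) ^ 3 :: complex)"
            then have "(of_nat (Suc m ^ 3) :: complex) = of_nat (Suc m' ^ 3)" by (simp only: of_nat_power)
            then have "Suc m ^ 3 = Suc m' ^ 3" by (simp only: of_nat_eq_iff)
            then show "m = m'" using power_eq_imp_eq_base[of "Suc m" 3 "Suc m'"] by simp
          qed
          ultimately show False using finite_imageD infinite_UNIV_nat by blast
        qed
      qed simp
      then have "\<forall>q\<in>conormal_points. vanishes g q" using vanishes_conormal_iff[OF g(1)] by blast
      then show "vanishes g p" using p by blast
    qed
  qed
  then have "?D \<subseteq> zariski n closure_of S" by (rule closure_of_minimal) simp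
  then have 1: "?D \<subset> zariski n closure_of S" using q(3) qS Scl by blast
  have 2: "zariski n closure_of S \<subset> proj_space n" using ne irreducible_closed_sub[OF irr] by blast
  define c where "c = (\<lambda>i::nat. if i = 0 then ?D else if i = 1 then zariski n closure_of S else proj_space n)"
  have "\<forall>i\<le>2. irreducible_closed n (c i)" using conormal_irreducible irr irreducible_proj_space by (simp add: c_def)
  moreover have "\<forall>i<2. c i \<subset> c (Suc i)" using 1 2 by (auto simp: c_def less_2_cases_iff)
  ultimately show ?thesis by (intro codim_ge_of_chain[OF conormal_irreducible, of c]) (auto simp: c_def)
qed

end

section \<open>The matrix $J_L(t,u)$\<close>

lemma J_mat_index:
  fixes A B :: "'a::comm_ring_1 mat"
  assumes d: "d < n" and A: "A \<in> carrier_mat (d+1) (n+1)" and B: "B \<in> carrier_mat (n+1) (n-d)"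
  shows "J_mat A B t u = mat (n+1) (n+1) (\<lambda>(i, j).
    if j < d + 1 then (B *\<^sub>v u) $ i * A $$ (j, i) else (A\<^sup>T *\<^sub>v t) $ i * B $$ (i, j - (d+1)))"
proof -
  let ?P = "diag_of_vec (B *\<^sub>v u) * A\<^sup>T" and ?Q = "diag_of_vec (A\<^sup>T *\<^sub>v t) * B"
  have P: "?P = mat (n+1) (d+1) (\<lambda>(i, j). (B *\<^sub>v u) $ i * A\<^sup>T $$ (i, j))"
    using A B mat_diag_mult_left[of "A\<^sup>T" "n+1" "d+1"] unfolding diag_of_vec_def by auto
  have Q: "?Q = mat (n+1) (n-d) (\<lambda>(i, j). (A\<^sup>T *\<^sub>v t) $ i * B $$ (i, j))"
    using A B mat_diag_mult_left[of B "n+1" "n-d"] unfolding diag_of_vec_def by auto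
  have dims: "dim_row ?P = n+1" "dim_col ?P = d+1" "dim_row ?Q = n+1" "dim_col ?Q = n-d"
    unfolding P Q by simp_all
  show ?thesis
  proof (rule eq_matI)
    fix i j assume "i < dim_row (mat (n+1) (n+1) (\<lambda>(i, j).
      if j < d + 1 then (B *\<^sub>v u) $ i * A $$ (j, i) else (A\<^sup>T *\<^sub>v t) $ i * B $$ (i, j - (d+1))))"
      "j < dim_col (mat (n+1) (n+1) (\<lambda>(i, j).
      if j < d + 1 then (B *\<^sub>v u) $ i * A $$ (j, i) else (A\<^sup>T *\<^sub>v t) $ i * B $$ (i, j - (d+1))))"
    then have ij: "i < n+1" "j < n+1" by simp_all
    have len: "length (cols ?P @ cols ?Q) = n+1" using d dims by simp
    have "J_mat A B t u $$ (i, j) = (cols ?P @ cols ?Q) ! j $ i"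
      unfolding J_mat_def using ij B len by (simp add: mat_of_cols_def)
    also have "\<dots> = (if j < d + 1 then ?P $$ (i, j) else ?Q $$ (i, j - (d+1)))"
      using ij d dims by (auto simp: nth_append)
    also have "\<dots> = (if j < d + 1 then (B *\<^sub>v u) $ i * A $$ (j, i) else (A\<^sup>T *\<^sub>v t) $ i * B $$ (i, j - (d+1)))"
      unfolding P Q using ij d A by auto
    finally show "J_mat A B t u $$ (i, j) = mat (n+1) (n+1) (\<lambda>(i, j).
      if j < d + 1 then (B *\<^sub>v u) $ i * A $$ (j, i) else (A\<^sup>T *\<^sub>v t) $ i * B $$ (i, j - (d+1))) $$ (i, j)"
      using ij by simp
  qed (use B d dims in \<open>simp_all add: J_mat_def\<close>)
qed

lemma row_form_eq:
  assumes "A \<in> carrier_mat (d+1) (n+1)" "i < n + 1"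
  shows "(A\<^sup>T *\<^sub>v vec (d+1) (\<lambda>j. z $ j)) $ i = row_form d A z i"
proof -
  have "A\<^sup>T \<in> carrier_mat (n+1) (d+1)" using assms by simp
  from mult_mat_vec_index[OF this vec_carrier assms(2)] show ?thesis
    unfolding row_form_def using assms by (simp only:) (intro sum.cong, auto)
qed

lemma ker_form_eq:
  assumes "B \<in> carrier_mat (n+1) (n-d)" "i < n + 1"
  shows "(B *\<^sub>v vec (n-d) (\<lambda>j. z $ (d + 1 + j))) $ i = ker_form n d B z i"
  unfolding mult_mat_vec_index[OF assms(1) vec_carrier assms(2)] ker_form_def
  by (intro sum.cong) auto

lemma comm_ring_hom_mp_eval: "comm_ring_hom (\<lambda>f. mp_eval f z)"
  by unfold_locales simp_all

text \<open>Makes the minors of \<open>J_generic\<close> forms, so that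
  \<open>zero_of_eval_zero\<close> can decide their vanishing by values.\<close>

lemma homogeneous_det:
  assumes M: "M \<in> carrier_mat m m" and h: "\<And>i j. i < m \<Longrightarrow> j < m \<Longrightarrow> homogeneous n 1 (M $$ (i, j))"
  shows "homogeneous n m (det M)"
  unfolding det_def'[OF M]
proof (rule homogeneous_sum)
  fix p assume p: "p \<in> {p. p permutes {0..<m}}"
  have "homogeneous n (\<Sum>i\<in>I. 1) (\<Prod>i\<in>I. M $$ (i, p i))" if "I \<subseteq> {0..<m}" for I
    using finite_subset[OF that finite_atLeastLessThan] that
  proof (induct I rule: finite_induct)
    case empty
    then show ?case by (simp add: homogeneous_iff)
  next
    case (insert i I)
    then have "homogeneous n 1 (M $$ (i, p i))" using p permutes_in_image[of p "{0..<m}" i] by (intro h) auto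
    then show ?case using insert homogeneous_mult[of n 1 "M $$ (i, p i)"] by simp
  qed
  from this[of "{0..<m}"] have "homogeneous n m (\<Prod>i = 0..<m. M $$ (i, p i))" by simp
  moreover have "homogeneous n 0 (signof p :: mpoly)"
    using homogeneous_single[of 0 n 0 "1::complex"] homogeneous_single[of 0 n 0 "-1::complex"]
    by (auto simp: sign_def single_uminus)
  ultimately show "homogeneous n m (signof p * (\<Prod>i = 0..<m. M $$ (i, p i)))"
    using homogeneous_mult by fastforce
qed

lemma map_mat_delete: "map_mat f (mat_delete M l c) = mat_delete (map_mat f M) l c"
  by (rule eq_matI) (auto simp: mat_delete_def)

context reciprocal_plane begin

context
  assumes A: "A \<in> carrier_mat (d+1) (n+1)" and B: "B \<in> carrier_mat (n+1) (n-d)"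
begin

lemma J_mat_jac:
  "J_mat A B (vec (d+1) (\<lambda>j. z $ j)) (vec (n-d) (\<lambda>j. z $ (d + 1 + j))) = jac z"
  unfolding J_mat_index[OF d_less A B] jac_def
  by (intro eq_matI) (auto simp: row_form_eq[OF A] ker_form_eq[OF B] simp del: One_nat_def)

lemma J_generic_index:
  "J_generic A B = mat (n+1) (n+1) (\<lambda>(i, j).
    if j < d + 1 then (\<Sum>k<n-d. mp_const (B $$ (i, k)) * mp_var (d + 1 + k)) * mp_const (A $$ (j, i))
    else (\<Sum>k<d+1. mp_const (A $$ (k, i)) * mp_var k) * mp_const (B $$ (i, j - (d+1))))"
proof -
  have Ac: "map_mat mp_const A \<in> carrier_mat (d+1) (n+1)" and Bc: "map_mat mp_const B \<in> carrier_mat (n+1) (n-d)"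
    using A B by simp_all
  have At: "(map_mat mp_const A)\<^sup>T \<in> carrier_mat (n+1) (d+1)" using Ac by simp
  have "(map_mat mp_const B *\<^sub>v vec (n-d) (\<lambda>j. mp_var (d + 1 + j))) $ i =
    (\<Sum>k<n-d. mp_const (B $$ (i, k)) * mp_var (d + 1 + k))" if "i < n + 1" for i
    using that B by (auto simp: scalar_prod_def atLeast0LessThan intro!: sum.cong)
  moreover have "((map_mat mp_const A)\<^sup>T *\<^sub>v vec (d+1) mp_var) $ i =
    (\<Sum>k<d+1. mp_const (A $$ (k, i)) * mp_var k)" if "i < n + 1" for i
    using that A by (auto simp: scalar_prod_def atLeast0LessThan intro!: sum.cong simp del: sum.lessThan_Suc)
  moreover have "dim_row A = d + 1" "dim_col B = n - d" using A B by simp_all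
  ultimately show ?thesis
    unfolding J_generic_def J_mat_index[OF d_less Ac Bc]
    using A B d_less by (intro eq_matI) (auto simp del: sum.lessThan_Suc)
qed

lemma J_generic_carrier: "J_generic A B \<in> carrier_mat (n+1) (n+1)"
  unfolding J_generic_index by simp

lemma eval_J_generic: "map_mat (\<lambda>f. mp_eval f z) (J_generic A B) = jac z"
  unfolding J_generic_index jac_def row_form_def ker_form_def
  by (rule eq_matI) (auto simp del: sum.lessThan_Suc)

lemma homogeneous_J_generic:
  assumes "i < n + 1" "j < n + 1" shows "homogeneous n 1 (J_generic A B $$ (i, j))"
proof -
  have c: "homogeneous n 0 (mp_const a)" for a by (simp add: mp_const_def homogeneous_single)
  have v: "homogeneous n 1 (mp_var k)" if "k \<le> n" for k
    using that by (auto simp: mp_var_def intro!: homogeneous_single)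
  have 1: "homogeneous n 1 (mp_const a * mp_var k)" if "k \<le> n" for a k
    using homogeneous_mult[OF c v[OF that]] by simp
  have 2: "homogeneous n 1 (f * mp_const a)" if "homogeneous n 1 f" for f a
    using homogeneous_mult[OF that c] by simp
  show ?thesis using assms d_less
    by (auto simp: J_generic_index simp del: sum.lessThan_Suc One_nat_def intro!: 2 homogeneous_sum 1)
qed

lemma det_minor_zero_iff:
  assumes "l \<le> n" "c \<le> n"
  shows "det (mat_delete (J_generic A B) l c) = 0 \<longleftrightarrow>
    (\<forall>z\<in>carrier_vec (n+1). det (mat_delete (jac z) l c) = 0)"
proof -
  let ?M = "mat_delete (J_generic A B) l c"
  have M: "?M \<in> carrier_mat n n" using mat_delete_carrier[OF J_generic_carrier, of l c] by simp
  have h: "homogeneous n n (det ?M)"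
  proof (rule homogeneous_det[OF M])
    fix i j assume ij: "i < n" "j < n"
    then have "?M $$ (i, j) = J_generic A B $$ (insert_index l i, insert_index c j)"
      using mat_delete_index[of "J_generic A B" n l c i j] J_generic_carrier assms by simp
    moreover have "insert_index l i < n + 1" "insert_index c j < n + 1" using ij by (auto simp: insert_index_def)
    ultimately show "homogeneous n 1 (?M $$ (i, j))" using homogeneous_J_generic by simp
  qed
  have "mp_eval (det ?M) z = det (mat_delete (jac z) l c)" for z
    using comm_ring_hom.hom_det[OF comm_ring_hom_mp_eval, of z ?M]
    by (simp add: map_mat_delete eval_J_generic)
  then show ?thesis using zero_of_eval_zero[OF h] by auto
qed

text \<open>The vector (t, -u) is in the kernel: diag(B u) A^T t and diag(A^T t) B u are the same
  coordinatewise product.\<close>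

lemma det_jac: assumes "z \<in> carrier_vec (n+1)" "z \<noteq> 0\<^sub>v (n+1)" shows "det (jac z) = 0"
proof -
  let ?w = "join z ((-1) \<cdot>\<^sub>v z)"
  obtain j where j: "j < n + 1" "z $ j \<noteq> 0" using nonzero_vec_coord[OF assms] by auto
  then have "?w $ j \<noteq> 0\<^sub>v (n+1) $ j" using assms(1) by (auto simp: join_def)
  then have "?w \<noteq> 0\<^sub>v (n+1)" by metis
  moreover have "jac z *\<^sub>v ?w = 0\<^sub>v (n+1)"
  proof (rule eq_vecI)
    fix i assume "i < dim_vec (0\<^sub>v (n+1) :: complex vec)"
    then have i: "i \<le> n" by simp
    show "(jac z *\<^sub>v ?w) $ i = 0\<^sub>v (n+1) $ i"
      unfolding jac_mult[OF join_carrier i] X_join Y_join Y_smult[OF assms(1)] using i by simp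
  qed (simp add: jac_def)
  ultimately show ?thesis using det_0_iff_vec_prod_zero_field[OF jac_carrier] join_carrier by blast
qed

text \<open>For nonzero z the determinant of \<open>jac z\<close> is zero, so rank n amounts to a
  nonzero minor. This is an open condition on z, and z can be moved so that the entries at 0 and d +
  1, the first ones of t and u, are nonzero; then both blocks represent projective points.\<close>

lemma exists_rank_n_iff:
  "(\<exists>t\<in>carrier_vec (d+1) - {0\<^sub>v (d+1)}. \<exists>u\<in>carrier_vec (n-d) - {0\<^sub>v (n-d)}. vec_space.rank (n+1) (J_mat A B t u) = n)
    \<longleftrightarrow> (\<exists>z\<in>carrier_vec (n+1). \<exists>l\<le>n. \<exists>c\<le>n. det (mat_delete (jac z) l c) \<noteq> 0)"
proof
  assume "\<exists>t\<in>carrier_vec (d+1) - {0\<^sub>v (d+1)}. \<exists>u\<in>carrier_vec (n-d) - {0\<^sub>v (n-d)}. vec_space.rank (n+1) (J_mat A B t u) = n"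
  then obtain t u where tu: "t \<in> carrier_vec (d+1)" "u \<in> carrier_vec (n-d)" "vec_space.rank (n+1) (J_mat A B t u) = n"
    by blast
  define z where "z = vec (n+1) (\<lambda>i. if i < d + 1 then t $ i else u $ (i - (d+1)))"
  have "vec (d+1) (\<lambda>j. z $ j) = t" "vec (n-d) (\<lambda>j. z $ (d + 1 + j)) = u"
    using tu(1,2) d_less by (auto simp: z_def)
  then have "J_mat A B t u = jac z" using J_mat_jac[of z] by simp
  then have "\<exists>l\<le>n. \<exists>c\<le>n. det (mat_delete (jac z) l c) \<noteq> 0"
    using rank_imp_minor[OF jac_carrier, of z] tu(3) by simp
  moreover have "z \<in> carrier_vec (n+1)" by (simp add: z_def)
  ultimately show "\<exists>z\<in>carrier_vec (n+1). \<exists>l\<le>n. \<exists>c\<le>n. det (mat_delete (jac z) l c) \<noteq> 0" by blast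
next
  assume "\<exists>z\<in>carrier_vec (n+1). \<exists>l\<le>n. \<exists>c\<le>n. det (mat_delete (jac z) l c) \<noteq> 0"
  then obtain z0 l c where z0: "z0 \<in> carrier_vec (n+1)" "l \<le> n" "c \<le> n" "det (mat_delete (jac z0) l c) \<noteq> 0" by blast
  let ?\<phi> = "\<lambda>(k::nat) z. if k = 0 then z $ 0 else if k = 1 then z $ (d+1) else det (mat_delete (jac z) l c)"
  have "\<exists>z\<in>carrier_vec (n+1). \<forall>k\<in>{..2}. ?\<phi> k z \<noteq> 0"
  proof (rule common_nonzero)
    fix k :: nat
    have "poly_on_lines (n+1) (\<lambda>z. z $ 0)" "poly_on_lines (n+1) (\<lambda>z. z $ (d+1))"
      using d_less by (auto intro!: poly_on_lines_coord)
    then show "poly_on_lines (n+1) (?\<phi> k)"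
      using poly_on_lines_minor[of l c] by (cases "k = 0"; cases "k = 1") simp_all
    have "\<exists>a\<in>carrier_vec (n+1). a $ j \<noteq> (0::complex)" if "j < n + 1" for j
      using that by (intro bexI[of _ "unit_vec (n+1) j"]) auto
    from this[of 0] this[of "d+1"] show "\<exists>a\<in>carrier_vec (n+1). ?\<phi> k a \<noteq> 0"
      using z0 d_less by (cases "k = 0"; cases "k = 1") auto
  qed simp
  then obtain z where z: "z \<in> carrier_vec (n+1)" "\<And>k. k \<le> 2 \<Longrightarrow> ?\<phi> k z \<noteq> 0" by auto
  have nz: "z $ 0 \<noteq> 0" "z $ (d+1) \<noteq> 0" "det (mat_delete (jac z) l c) \<noteq> 0"
    using z(2)[of 0] z(2)[of 1] z(2)[of 2] by simp_all
  let ?t = "vec (d+1) (\<lambda>j. z $ j)" and ?u = "vec (n-d) (\<lambda>j. z $ (d + 1 + j))"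
  have "?t $ 0 \<noteq> 0\<^sub>v (d+1) $ 0" "?u $ 0 \<noteq> 0\<^sub>v (n-d) $ 0" using nz d_less by simp_all
  then have "?t \<noteq> 0\<^sub>v (d+1)" "?u \<noteq> 0\<^sub>v (n-d)" by metis+
  moreover have "z \<noteq> 0\<^sub>v (n+1)" using nz by auto
  then have "vec_space.rank (n+1) (J_mat A B ?t ?u) = n"
    unfolding J_mat_jac by (intro minor_imp_rank[OF jac_carrier z0(2,3) nz(3)] det_jac z(1))
  ultimately show "\<exists>t\<in>carrier_vec (d+1) - {0\<^sub>v (d+1)}. \<exists>u\<in>carrier_vec (n-d) - {0\<^sub>v (n-d)}. vec_space.rank (n+1) (J_mat A B t u) = n"
    using vec_carrier by blast
qed

end

lemma codim_dual_cases:
  "codim n (dual_variety n variety) = enat 1 \<longleftrightarrow> (\<exists>z\<in>carrier_vec (n+1). \<exists>l\<le>n. \<exists>c\<le>n. det (mat_delete (jac z) l c) \<noteq> 0)"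
  "codim n (dual_variety n variety) > 1 \<longleftrightarrow> \<not> (\<exists>z\<in>carrier_vec (n+1). \<exists>l\<le>n. \<exists>c\<le>n. det (mat_delete (jac z) l c) \<noteq> 0)"
proof -
  let ?c = "codim n (dual_variety n variety)"
  let ?P = "\<exists>z\<in>carrier_vec (n+1). \<exists>l\<le>n. \<exists>c\<le>n. det (mat_delete (jac z) l c) \<noteq> 0"
  have 1: "?c = enat 1" if ?P using that codim_dual_eq_1 unfolding dual_variety_conormal by blast
  have 2: "enat 2 \<le> ?c" if "\<not> ?P" using that codim_dual_ge_2 unfolding dual_variety_conormal by blast
  have "enat 1 < enat 2" by simp
  then have "?c > enat 1" if "\<not> ?P" using 2[OF that] by (rule less_le_trans)
  then have 3: "?c > 1" "?c \<noteq> enat 1" if "\<not> ?P" using that by (auto simp: one_enat_def)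
  show "?c = enat 1 \<longleftrightarrow> ?P" using 1 3(2) by blast
  have "\<not> ?c > 1" if ?P unfolding 1[OF that] by (simp add: one_enat_def)
  then show "?c > 1 \<longleftrightarrow> \<not> ?P" using 3(1) by blast
qed

text \<open>The dual variety is irreducible, hence its own only component.\<close>

lemma hypersurface_dual_iff:
  "hypersurface n (dual_variety n variety) \<longleftrightarrow> codim n (dual_variety n variety) = enat 1"
proof -
  let ?D = "dual_variety n variety"
  have irr: "irreducible_closed n ?D" using conormal_irreducible unfolding dual_variety_conormal .
  then have "irreducible_component n ?D Z \<longleftrightarrow> Z = ?D" for Z
    unfolding irreducible_component_def by blast
  then show ?thesis using irr unfolding hypersurface_def irreducible_closed_def by (simp add: one_enat_def)
qed

end

section \<open>From the given matrices to the coordinate setting\<close>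

lemma reciprocal_plane_of_matrices:
  assumes d: "d < n" and A: "A \<in> carrier_mat (d+1) (n+1)" and B: "B \<in> carrier_mat (n+1) (n-d)"
    and basis: "columns_form_kernel_basis A B"
    and inj: "\<And>t. t \<in> carrier_vec (d+1) \<Longrightarrow> A\<^sup>T *\<^sub>v t = 0\<^sub>v (n+1) \<Longrightarrow> t = 0\<^sub>v (d+1)"
    and nonzero: "\<And>i. i \<le> n \<Longrightarrow> \<exists>t\<in>carrier_vec (d+1). (A\<^sup>T *\<^sub>v t) $ i \<noteq> 0"
  shows "reciprocal_plane n d A B"
proof
  let ?t = "\<lambda>z :: complex vec. vec (d+1) (\<lambda>j. z $ j)" and ?u = "\<lambda>z :: complex vec. vec (n-d) (\<lambda>j. z $ (d + 1 + j))"
  note ker = kernel_basis_facts[OF A B basis]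
  show "d < n" by (rule d)
  show "(\<Sum>i\<le>n. row_form d A z i * ker_form n d B z' i) = 0" for z z'
  proof -
    have Bu: "B *\<^sub>v ?u z' \<in> carrier_vec (n+1)" using B by simp
    have "(\<Sum>i\<le>n. row_form d A z i * ker_form n d B z' i)
      = (\<Sum>i<n+1. \<Sum>j<d+1. z $ j * (A $$ (j, i) * (B *\<^sub>v ?u z') $ i))"
      by (rule sum.cong) (auto simp: row_form_def ker_form_eq[OF B, symmetric] sum_distrib_right mult_ac simp del: sum.lessThan_Suc)
    also have "\<dots> = (\<Sum>j<d+1. z $ j * (A *\<^sub>v (B *\<^sub>v ?u z')) $ j)"
      by (subst sum.swap, intro sum.cong refl)
         (simp only: mult_mat_vec_index[OF A Bu] lessThan_iff sum_distrib_left)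
    also have "\<dots> = 0" using ker(1)[of "?u z'"] by simp
    finally show ?thesis .
  qed
  show "\<exists>z\<in>carrier_vec (n+1). \<forall>i\<le>n. w i = ker_form n d B z i"
    if w: "\<And>z. z \<in> carrier_vec (n+1) \<Longrightarrow> (\<Sum>i\<le>n. row_form d A z i * w i) = 0" for w
  proof -
    have "A *\<^sub>v vec (n+1) w = 0\<^sub>v (d+1)"
    proof (rule eq_vecI)
      fix j assume "j < dim_vec (0\<^sub>v (d+1) :: complex vec)"
      then have j: "j < d + 1" by simp
      have "(A *\<^sub>v vec (n+1) w) $ j = (\<Sum>i<n+1. A $$ (j, i) * w i)"
        unfolding mult_mat_vec_index[OF A vec_carrier j] by (rule sum.cong) auto
      also have "\<dots> = (\<Sum>i\<le>n. row_form d A (unit_vec (n+1) j) i * w i)"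
      proof (rule sum.cong)
        fix i assume "i \<in> {..n}"
        have "row_form d A (unit_vec (n+1) j) i = (\<Sum>k<d+1. if k = j then A $$ (k, i) else 0)"
          unfolding row_form_def by (rule sum.cong) (use d j in auto)
        then show "A $$ (j, i) * w i = row_form d A (unit_vec (n+1) j) i * w i" using j by simp
      qed auto
      also have "\<dots> = 0" by (rule w) simp
      finally show "(A *\<^sub>v vec (n+1) w) $ j = 0\<^sub>v (d+1) $ j" using j by simp
    qed (use A in simp)
    from ker(2)[OF vec_carrier this] obtain u where u: "u \<in> carrier_vec (n-d)" "vec (n+1) w = B *\<^sub>v u" by blast
    let ?z = "vec (n+1) (\<lambda>i. if i < d + 1 then 0 else u $ (i - (d+1)))"
    have "?u ?z = u" using u(1) d by auto
    then have "w i = ker_form n d B ?z i" if "i \<le> n" for i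
      using ker_form_eq[OF B, of i ?z] that u(2)[symmetric] by simp
    then show ?thesis by (intro bexI[of _ ?z]) auto
  qed
  show "z $ j = 0" if z: "z \<in> carrier_vec (n+1)" "\<And>i. i \<le> n \<Longrightarrow> row_form d A z i = 0" "j \<le> d" for z j
  proof -
    have "A\<^sup>T *\<^sub>v ?t z = 0\<^sub>v (n+1)"
      by (rule eq_vecI) (use A z(2) row_form_eq[OF A, of _ z] in auto)
    then have "?t z = 0\<^sub>v (d+1)" by (intro inj) auto
    then have "?t z $ j = 0" using z(3) by simp
    then show ?thesis using z(3) by simp
  qed
  show "z $ (d + 1 + j) = 0" if z: "z \<in> carrier_vec (n+1)" "\<And>i. i \<le> n \<Longrightarrow> ker_form n d B z i = 0" "j < n - d" for z j
  proof -
    have "B *\<^sub>v ?u z = 0\<^sub>v (n+1)"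
      by (rule eq_vecI) (use B z(2) ker_form_eq[OF B, of _ z] in auto)
    then have "?u z = 0\<^sub>v (n-d)" by (intro ker(3)) auto
    then have "?u z $ j = 0" using z(3) by simp
    then show ?thesis using z(3) by simp
  qed
  show "\<exists>z\<in>carrier_vec (n+1). row_form d A z i \<noteq> 0" if i: "i \<le> n" for i
  proof -
    obtain t where t: "t \<in> carrier_vec (d+1)" "(A\<^sup>T *\<^sub>v t) $ i \<noteq> 0" using nonzero[OF i] by blast
    let ?z = "vec (n+1) (\<lambda>i. if i < d + 1 then t $ i else 0)"
    have "?t ?z = t" using t(1) d by auto
    then have "row_form d A ?z i \<noteq> 0" using row_form_eq[OF A, of i ?z] i t(2) by simp
    then show ?thesis by (intro bexI[of _ ?z]) auto
  qed
qed

lemma subspace_closed: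
  assumes "VectorSpace.subspace class_ring W (Cvec m)"
  shows "W \<subseteq> carrier_vec m" "0\<^sub>v m \<in> W" "\<And>c v. v \<in> W \<Longrightarrow> c \<cdot>\<^sub>v v \<in> W"
proof -
  have s: "submodule class_ring W (Cvec m)" using assms by (simp add: VectorSpace.subspace_def)
  show "W \<subseteq> carrier_vec m" using submodule.subset[OF s] by (simp add: module_vec_simps)
  show "0\<^sub>v m \<in> W" using submodule.zero_closed[OF s] by (simp add: module_vec_simps)
  show "c \<cdot>\<^sub>v v \<in> W" if "v \<in> W" for c v
    using submodule.smult_closed[OF s, of c v] that by (simp add: module_vec_simps class_ring_simps)
qed

theorem proposition4p12:
  fixes n d :: nat
    and L :: "complex vec set set"
    and A B :: "complex mat"
  assumes "d < n"
    and "linear_space n d L"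
    and "\<forall>i\<le>n. \<not> L \<subseteq> coordinate_hyperplane n i"
    and "A \<in> carrier_mat (d+1) (n+1)"
    and "projectivization n (vec_space.row_space (n+1) A) = L"
    and "B \<in> carrier_mat (n+1) (n-d)"
    and "columns_form_kernel_basis A B"
    and "\<nexists>e. matroid_coloop {0..n} (column_matroid A) e"
  shows "(dual_defective n (reciprocal n L) \<longleftrightarrow>
      (\<forall>I J. I \<subseteq> {0..n} \<longrightarrow> J \<subseteq> {0..n} \<longrightarrow> card I = n \<longrightarrow> card J = n \<longrightarrow>
        det (submatrix (J_generic A B) I J) = 0)) \<and>
    (hypersurface n (dual_variety n (reciprocal n L)) \<longleftrightarrow>
      (\<exists>t\<in>carrier_vec (d+1) - {0\<^sub>v (d+1)}. \<exists>u\<in>carrier_vec (n-d) - {0\<^sub>v (n-d)}.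
        vec_space.rank (n+1) (J_mat A B t u) = n))"
proof -
  have A: "A \<in> carrier_mat (d+1) (n+1)" and B: "B \<in> carrier_mat (n+1) (n-d)" by fact+
  have At: "A\<^sup>T \<in> carrier_mat (n+1) (d+1)" using A by simp
  let ?R = "{A\<^sup>T *\<^sub>v t | t. t \<in> carrier_vec (d+1)}"
  have R: "vec_space.row_space (n+1) A = ?R"
    using vec_space.row_space_eq[OF A] A by auto
  obtain W0 where W0: "VectorSpace.subspace class_ring W0 (Cvec (n+1))" "lin_dim (n+1) W0 = d + 1"
    "L = projectivization n W0" using assms(2) unfolding linear_space_def by blast
  have R_sub: "?R \<subseteq> carrier_vec (n+1)" using At by auto
  have R_zero: "0\<^sub>v (n+1) \<in> ?R"
    using At by (intro CollectI exI[of _ "0\<^sub>v (d+1)"]) auto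
  have R_smult: "c \<cdot>\<^sub>v v \<in> ?R" if v: "v \<in> ?R" for c v
  proof -
    obtain t where t: "t \<in> carrier_vec (d+1)" "v = A\<^sup>T *\<^sub>v t" using v by blast
    then have "c \<cdot>\<^sub>v v = A\<^sup>T *\<^sub>v (c \<cdot>\<^sub>v t)" using mult_mat_vec[OF At t(1)] by simp
    then show ?thesis using t(1) by (intro CollectI exI[of _ "c \<cdot>\<^sub>v t"]) auto
  qed
  have eq: "projectivization n W0 = projectivization n ?R" using assms(5) W0(3) R by simp
  \<comment> \<open>\<open>linear_space\<close> only provides some subspace of dimension d + 1. It
    has the same projectivization as the row space, so they agree, and A gets full row rank.\<close>
  have "W0 = ?R"
    by (rule projectivization_inject) (rule subspace_closed[OF W0(1)] R_sub R_zero R_smult eq | assumption)+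
  then have rank: "vec_space.rank (n+1) (A\<^sup>T) = d + 1" using W0(2) lin_dim_image[OF At] by simp
  \<comment> \<open>A point of L outside the i-th coordinate hyperplane has a representative in the
    row space; together these nonzero coordinate forms make L meet the torus.\<close>
  have nonzero: "\<exists>t\<in>carrier_vec (d+1). (A\<^sup>T *\<^sub>v t) $ i \<noteq> 0" if i: "i \<le> n" for i
  proof -
    obtain p where p: "p \<in> L" "p \<notin> coordinate_hyperplane n i" using assms(3) i by blast
    obtain w where w: "w \<in> ?R" "w \<noteq> 0\<^sub>v (n+1)" "p = proj_pt w"
      using p(1) assms(5) unfolding R projectivization_def by blast
    have "w \<in> carrier_vec (n+1)" using w(1) R_sub by blast
    then have "p \<in> proj_space n" using w(2,3) proj_pt_in_proj_space by blast
    then obtain v where v: "v \<in> p" "v $ i \<noteq> 0" using p(2) by (auto simp: coordinate_hyperplane_def)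
    then have "v \<in> ?R" using w(1,3) R_smult by (auto simp only: proj_pt_def)
    then show ?thesis using v(2) by blast
  qed
  interpret reciprocal_plane n d A B
    by (rule reciprocal_plane_of_matrices[OF assms(1) A B assms(7) full_rank_injective[OF At rank] nonzero])
  have "W = ?R"
  proof
    show "W \<subseteq> ?R"
    proof
      fix v assume "v \<in> W"
      then obtain z where "v = vec (n+1) (X z)" by (rule W_E)
      then have "v = A\<^sup>T *\<^sub>v vec (d+1) (\<lambda>j. z $ j)"
        using row_form_eq[OF A, of _ z] A by (intro eq_vecI) auto
      then show "v \<in> ?R" by (intro CollectI exI[of _ "vec (d+1) (\<lambda>j. z $ j)"]) auto
    qed
    show "?R \<subseteq> W"
    proof
      fix v assume "v \<in> ?R"
      then obtain t where t: "t \<in> carrier_vec (d+1)" "v = A\<^sup>T *\<^sub>v t" by blast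
      define z where "z = vec (n+1) (\<lambda>i. if i < d + 1 then t $ i else 0)"
      have "vec (d+1) (\<lambda>j. z $ j) = t" using t(1) d_less by (auto simp: z_def)
      then have "v = vec (n+1) (X z)"
        using row_form_eq[OF A, of _ z] A t(2) by (intro eq_vecI) auto
      then show "v \<in> W" by (rule W_I[rotated]) (simp add: z_def)
    qed
  qed
  then have "L = projectivization n W" using assms(5) R by simp
  then have var: "reciprocal n L = variety"
    using reciprocal_projectivization[OF W_carrier W_smult] unfolding variety_def by simp
  have "(\<forall>l\<le>n. \<forall>c\<le>n. det (mat_delete (J_generic A B) l c) = 0) \<longleftrightarrow>
      \<not> (\<exists>z\<in>carrier_vec (n+1). \<exists>l\<le>n. \<exists>c\<le>n. det (mat_delete (jac z) l c) \<noteq> 0)"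
    using det_minor_zero_iff[OF A B] by blast
  then show ?thesis
    unfolding var dual_defective_def hypersurface_dual_iff codim_dual_cases
      exists_rank_n_iff[OF A B] all_minors_zero_iff[OF J_generic_carrier[OF A B]] by blast
qed

end
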